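(* For every integer $d\ge1$ there is a positive constant $C_d$ depending only on $d$ such that the following holds. Let $M^{(1)},\dots,M^{(d)}$ be real anti-symmetric $n\times n$ matrices, let $\pi$ be a uniformly random permutation of $\{1,\dots,n\}$, and let $W=(W_1,\dots,W_d)^t$ with $W_r=\sum_{i<j}M^{(r)}_{\pi(i)\pi(j)}$. Let $$\beta=\sup_{r,u}\sum_v\bigl|M^{(r)}_{uv}\bigr|,\qquad \beta_2=\sup_{r,u}\sum_v\bigl(M^{(r)}_{uv}\bigr)^2,$$ where $1\le r\le d$ and $u,v\in\{1,\dots,n\}$. Assume $\operatorname{Var}(W_r)=1$ for each $1\le r\le d$ and that $\Sigma=\operatorname{Cov}(W)$ is positive definite. Then, with $Z$ a $d$-dimensional standard Gaussian random vector, $$d_c\bigl(\mathscr{L}(W),\mathscr{L}(\Sigma^{1/2}Z)\bigr)\le C_d\,\bigl\|\Sigma^{-1/2}\bigr\|_2^2\,\bigl(n\beta^3+n^{1/2}\beta\beta_2^{1/4}\bigr).$$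
   Context: A real $n\times n$ matrix $M$ is anti-symmetric if $M_{uv}=-M_{vu}$ for all $u,v$. The sum $\sum_{i<j}$ is the double sum $\sum_{i=1}^{n-1}\sum_{j=i+1}^n$. $\|A\|_2$ is the operator norm of a $d\times d$ matrix $A$ with respect to the Euclidean norm. $\mathscr{L}(X)$ denotes the law of $X$, and $d_c(\mathscr{L}(X),\mathscr{L}(Y))=\sup_{A}|\mathbb{P}(X\in A)-\mathbb{P}(Y\in A)|$, where the supremum is over all convex sets $A\subset\mathbb{R}^d$. *)

theory Defs
  imports "HOL-Probability.Probability" "HOL-Combinatorics.Permutations"
begin

text \<open>
  Since the number \<open>n\<close> varies inside the statement, an \<open>n\<close> by \<open>n\<close> matrix is a function
  on \<open>nat\<close> of which only the entries with both indices in \<open>{1..n}\<close> matter.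
\<close>

definition antisymmetric_matrix :: "nat \<Rightarrow> (nat \<Rightarrow> nat \<Rightarrow> real) \<Rightarrow> bool" where
  "antisymmetric_matrix n A \<longleftrightarrow> (\<forall>u\<in>{1..n}. \<forall>v\<in>{1..n}. A u v = - A v u)"

definition uniform_perm :: "nat \<Rightarrow> (nat \<Rightarrow> nat) pmf" where
  "uniform_perm n = pmf_of_set {p. p permutes {1..n}}"

definition perm_stat ::
  "nat \<Rightarrow> ('d::finite \<Rightarrow> nat \<Rightarrow> nat \<Rightarrow> real) \<Rightarrow> (nat \<Rightarrow> nat) \<Rightarrow> real ^ 'd" where
  "perm_stat n M p = (\<chi> r. \<Sum>i=1..n-1. \<Sum>j=i+1..n. M r (p i) (p j))"

definition beta :: "nat \<Rightarrow> ('d::finite \<Rightarrow> nat \<Rightarrow> nat \<Rightarrow> real) \<Rightarrow> real" where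
  "beta n M = (SUP (r, u) \<in> UNIV \<times> {1..n}. \<Sum>v=1..n. \<bar>M r u v\<bar>)"

definition beta2 :: "nat \<Rightarrow> ('d::finite \<Rightarrow> nat \<Rightarrow> nat \<Rightarrow> real) \<Rightarrow> real" where
  "beta2 n M = (SUP (r, u) \<in> UNIV \<times> {1..n}. \<Sum>v=1..n. (M r u v)\<^sup>2)"

definition covariance_matrix :: "'a measure \<Rightarrow> ('a \<Rightarrow> real ^ 'd) \<Rightarrow> real ^ 'd ^ 'd::finite" where
  "covariance_matrix P X =
     (\<chi> r s. \<integral>w. (X w $ r - (\<integral>w'. X w' $ r \<partial>P)) * (X w $ s - (\<integral>w'. X w' $ s \<partial>P)) \<partial>P)"

definition positive_semidefinite :: "real ^ 'd ^ 'd::finite \<Rightarrow> bool" where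
  "positive_semidefinite A \<longleftrightarrow> transpose A = A \<and> (\<forall>x. 0 \<le> x \<bullet> (A *v x))"

definition positive_definite :: "real ^ 'd ^ 'd::finite \<Rightarrow> bool" where
  "positive_definite A \<longleftrightarrow> transpose A = A \<and> (\<forall>x. x \<noteq> 0 \<longrightarrow> 0 < x \<bullet> (A *v x))"

text \<open>The principal square root: every positive semidefinite matrix has exactly one
  positive semidefinite square root.\<close>

definition matrix_sqrt :: "real ^ 'd ^ 'd::finite \<Rightarrow> real ^ 'd ^ 'd" where
  "matrix_sqrt A = (THE B. positive_semidefinite B \<and> B ** B = A)"

definition std_gaussian :: "(real ^ 'd::finite) measure" where
  "std_gaussian = density lborel (\<lambda>x. ennreal (\<Prod>i\<in>UNIV. std_normal_density (x $ i)))"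

text \<open>
  The distance \<open>d\<^sub>c\<close> between two Borel probability measures.  For \<open>d \<ge> 2\<close> a convex set need
  not be a Borel set, and \<^const>\<open>measure\<close> is \<open>0\<close> on non-measurable sets, so both measures are
  completed first.  Convex sets are Lebesgue measurable, hence measurable for the completion
  of every law with a Lebesgue density; for the completion of a finitely supported law every
  set is measurable.
\<close>

definition convex_dist :: "(real ^ 'd::finite) measure \<Rightarrow> (real ^ 'd) measure \<Rightarrow> real" where
  "convex_dist \<mu> \<nu> =
     (SUP A \<in> {A. convex A}. \<bar>measure (completion \<mu>) A - measure (completion \<nu>) A\<bar>)"

end

theory Submission imports Defs begin

text \<open>
  Let \<open>B\<close> be the square root of \<open>\<Sigma>\<close>, let \<open>s\<close> be the operator norm of its inverse, and let \<open>W\<close> be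
  the inverse of \<open>B\<close> applied to the statistic.  Linear isomorphisms permute the convex sets, so
  the distance to be bounded is the supremum \<open>\<delta>\<close> (\<open>discrepancy\<close>) over convex Borel sets \<open>A\<close> of the
  difference between \<open>P(W \<in> A)\<close> and the standard Gaussian measure of \<open>A\<close>.  Here \<open>W\<close> is again a
  statistic of the same kind, for a vector-valued antisymmetric matrix \<open>m\<close> whose rows have total
  norm at most \<open>\<rho> = s d \<beta>\<close>, and \<open>Cov W\<close> is the identity.  The proof gives \<open>\<delta> \<le> C sqrt n \<rho>\<^sup>2\<close>,
  which is a multiple of \<open>s\<^sup>2 sqrt n \<beta>\<^sup>2\<close>; since \<open>Var W\<^sub>r = 1\<close> forces \<open>n \<beta>\<^sup>2 \<ge> 1\<close>, this is at most
  a multiple of \<open>s\<^sup>2 n \<beta>\<^sup>3\<close>.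

  The walk.  Moving the entry at one of the \<open>n\<close> positions of \<open>\<pi>\<close> to the end, or to the front, is a
  bijection of the permutations, so it preserves the uniform law.  It changes \<open>W\<close> by a jump \<open>J\<close> of
  norm at most \<open>2\<rho>\<close> (\<open>pair_sum_jump\<close>).  The \<open>2n\<close> jumps add up to \<open>-4W\<close> (\<open>sum_jumps\<close>).  The sum of
  the tensors \<open>J \<otimes> J\<close> therefore has mean \<open>8 I\<close>, and the sum of the \<open>J \<otimes> J \<otimes> J\<close> has mean zero,
  because reversing \<open>\<pi>\<close> exchanges the two kinds of jumps and their signs.  Exchanging two
  positions of \<open>\<pi>\<close> alters these sums by \<open>O(\<rho>\<^sup>2)\<close> and \<open>O(\<rho>\<^sup>3)\<close> only, so a martingale argument
  (\<open>permutation_variance_le\<close>) bounds their standard deviations by multiples of \<open>b = sqrt n \<rho>\<^sup>2\<close>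
  and of \<open>\<rho> b\<close>.  A third-order term of the natural size \<open>n \<rho>\<^sup>3\<close>, which would cost a factor \<open>s\<^sup>3\<close>,
  never appears.

  The Gaussian side.  With \<open>Z\<close> standard Gaussian and independent of \<open>W\<close>, follow
  \<open>P(cos \<theta> W + sin \<theta> Z \<in> A)\<close> from \<open>\<theta> = \<pi>/2\<close>, where it is the Gaussian measure of \<open>A\<close>, down to a
  small \<open>\<theta>\<^sub>0\<close>.  Its derivative is the expectation of the indicator times
  \<open>cot \<theta> (|Z|\<^sup>2 - d) - Z \<bullet> W\<close> (\<open>smoothed_difference\<close>).  A jump \<open>J\<close> of \<open>W\<close> amounts to a shift of
  \<open>Z\<close> by \<open>v = cot \<theta> J\<close>, whose effect is the density \<open>exp (v \<bullet> Z - |v|\<^sup>2/2)\<close>.  Invariance under the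
  walk says that these densities, each minus one and summed over all jumps, integrate to zero
  against the indicator.  Expanding them in Hermite polynomials, the terms of first and second
  order reproduce the derivative up to the fluctuation of the sum of \<open>J \<otimes> J\<close>; what remains is the
  fluctuation of the sum of \<open>J \<otimes> J \<otimes> J\<close> and a fourth-order remainder (\<open>stein_identity\<close>).

  Convexity enters through the boundary of \<open>A\<close>.  All test functions have Gaussian mean zero, so
  the indicator at \<open>cos \<theta> W + sin \<theta> Z\<close> may be replaced by its difference from the indicator at
  \<open>cos \<theta> W\<close>, which vanishes unless \<open>cos \<theta> W\<close> lies within \<open>sin \<theta> (1 + |Z|)\<close> of the boundary of \<open>A\<close>.
  This boundary layer is a difference of two convex sets, so its probability is its Gaussian
  measure up to \<open>2\<delta>\<close>, and the Gaussian measure is at most proportional to the width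
  (\<open>gaussian_boundary_layer\<close>). Expectations of the difference are thus of order \<open>sin \<theta> + \<delta>\<close>.  This
  makes the second-order term integrable at \<open>\<theta> = 0\<close> without a logarithm.  Integrating down to
  \<open>\<theta>\<^sub>0 = K b\<close> costs at most \<open>C b + \<delta>/4\<close> for a large constant \<open>K\<close>, removing the smoothing costs
  \<open>\<delta>/3 + C \<theta>\<^sub>0\<close> (\<open>discrepancy_smoothing\<close>), and solving for \<open>\<delta>\<close> gives the bound
  (\<open>discrepancy_bound\<close>).
\<close>

section \<open>Square roots of positive definite matrices\<close>

lemma symmetric_matrix_inner:
  fixes A :: "real^'d^'d"
  assumes "transpose A = A"
  shows "x \<bullet> (A *v y) = (A *v x) \<bullet> y"
  by (metis assms dot_lmul_matrix transpose_matrix_vector)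

text \<open>
  By polarization, \<open>4 (x \<bullet> f y)\<close> is the difference of the form at \<open>x + y\<close> and at \<open>x - y\<close>; taking
  \<open>x\<close> parallel to \<open>f y\<close> and as long as \<open>y\<close> turns a bound on the form into one on the norm.
\<close>

lemma symmetric_form_bound_imp_norm_bound:
  fixes f :: "'a::euclidean_space \<Rightarrow> 'a"
  assumes lin: "linear f" and sym: "\<And>x y. x \<bullet> f y = f x \<bullet> y"
    and nonneg: "\<And>x. 0 \<le> x \<bullet> f x" and le: "\<And>x. x \<bullet> f x \<le> \<rho> * (norm x)\<^sup>2"
  shows "norm (f y) \<le> \<rho> * norm y"
proof (cases "f y = 0 \<or> y = 0")
  case True
  have "0 \<le> \<rho> * (norm y)\<^sup>2" using nonneg[of y] le[of y] by linarith
  then have "0 \<le> \<rho> * norm y"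
    by (cases "y = 0") (auto simp: zero_le_mult_iff zero_le_power2)
  with True show ?thesis using linear_0[OF lin] by auto
next
  case False
  define x where "x = (norm y / norm (f y)) *\<^sub>R f y"
  have nx: "norm x = norm y" using False by (simp add: x_def)
  have "4 * (x \<bullet> f y) = (x + y) \<bullet> f (x + y) - (x - y) \<bullet> f (x - y)"
    using sym[of x y] sym[of y x]
    by (simp add: linear_add[OF lin] linear_diff[OF lin] inner_add_left inner_add_right
        inner_diff_left inner_diff_right inner_commute)
  also have "\<dots> \<le> \<rho> * (norm (x + y))\<^sup>2"
    using le[of "x + y"] nonneg[of "x - y"] by linarith
  also have "\<dots> \<le> \<rho> * (2 * norm y)\<^sup>2"
  proof (rule mult_left_mono)
    show "(norm (x + y))\<^sup>2 \<le> (2 * norm y)\<^sup>2"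
      using norm_triangle_ineq[of x y] nx by (intro power_mono) auto
    have "0 \<le> \<rho> * (norm y)\<^sup>2" using nonneg[of y] le[of y] by linarith
    then show "0 \<le> \<rho>" using False by (auto simp: zero_le_mult_iff)
  qed
  finally have "x \<bullet> f y \<le> \<rho> * (norm y)\<^sup>2" by (simp add: power_mult_distrib)
  moreover have "x \<bullet> f y = norm y * norm (f y)"
    using False by (simp add: x_def dot_square_norm power2_eq_square)
  ultimately have "norm y * norm (f y) \<le> norm y * (\<rho> * norm y)"
    by (simp add: power2_eq_square ac_simps)
  then show ?thesis using False by simp
qed

lemma positive_definite_lower_bound:
  fixes A :: "real^'d^'d"
  assumes "positive_definite A"
  obtains m where "m > 0" "\<And>x. m * (norm x)\<^sup>2 \<le> x \<bullet> (A *v x)"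
proof -
  let ?q = "\<lambda>x::real^'d. x \<bullet> (A *v x)"
  have "continuous_on (sphere 0 1) ?q"
    by (intro continuous_intros linear_continuous_on matrix_vector_mul_bounded_linear)
  moreover have "sphere (0::real^'d) 1 \<noteq> {}" by simp
  ultimately obtain u where u: "u \<in> sphere 0 1" "\<And>x. x \<in> sphere 0 1 \<Longrightarrow> ?q u \<le> ?q x"
    using continuous_attains_inf[of "sphere 0 1" ?q] by auto
  have "u \<noteq> 0" using u(1) by auto
  then have "?q u > 0" using assms by (simp add: positive_definite_def)
  moreover have "?q u * (norm x)\<^sup>2 \<le> ?q x" for x
  proof (cases "x = 0")
    case False
    have "?q u \<le> ?q (x /\<^sub>R norm x)" using False by (intro u(2)) simp
    also have "\<dots> = ?q x / (norm x)\<^sup>2"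
      by (simp add: matrix_vector_mult_scaleR power2_eq_square field_simps)
    finally show ?thesis using False by (simp add: field_simps)
  qed simp
  ultimately show thesis by (rule that)
qed

text \<open>
  Scale \<open>A\<close> so that \<open>A = K (I - X)\<close> with \<open>0 \<le> X\<close> and \<open>X\<close> of norm at most \<open>\<rho> < 1\<close>.  Then
  \<open>(I - Y)\<^sup>2 = I - X\<close> is the fixed point equation \<open>Y = (X + Y\<^sup>2) / 2\<close>, and the right-hand side is
  a contraction with factor \<open>\<rho>\<close> of the symmetric operators of norm at most \<open>\<rho>\<close>.
\<close>

lemma positive_definite_has_sqrt:
  fixes A :: "real^'d^'d"
  assumes pd: "positive_definite A"
  shows "\<exists>B. positive_semidefinite B \<and> B ** B = A"
proof -
  define K where "K = onorm ((*v) A)"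
  have bl: "bounded_linear ((*v) A)" by (rule matrix_vector_mul_bounded_linear)
  have sym: "transpose A = A" using pd by (simp add: positive_definite_def)
  obtain m where m: "m > 0" "\<And>x. m * (norm x)\<^sup>2 \<le> x \<bullet> (A *v x)"
    using positive_definite_lower_bound[OF pd] by blast
  have upper: "x \<bullet> (A *v x) \<le> K * (norm x)\<^sup>2" for x
  proof -
    have "x \<bullet> (A *v x) \<le> norm x * norm (A *v x)" by (rule norm_cauchy_schwarz)
    also have "\<dots> \<le> norm x * (K * norm x)"
      unfolding K_def by (intro mult_left_mono onorm[OF bl]) simp
    finally show ?thesis by (simp add: power2_eq_square ac_simps)
  qed
  have mK: "m \<le> K" using m(2)[of "axis undefined 1"] upper[of "axis undefined 1"] by (simp add:
      norm_axis_1)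
  have K: "K > 0" using m(1) mK by linarith
  define \<rho> where "\<rho> = 1 - m / K"
  have \<rho>: "0 \<le> \<rho>" "\<rho> < 1" using m(1) mK K by (auto simp: \<rho>_def)
  define f where "f = (\<lambda>x. x - (A *v x) /\<^sub>R K)"
  have blf: "bounded_linear f" unfolding f_def
    by (intro bounded_linear_sub bounded_linear_ident bounded_linear_scaleR_right
        bounded_linear_compose[OF bounded_linear_scaleR_right bl, unfolded o_def])
  have fsym: "x \<bullet> f y = f x \<bullet> y" for x y
    by (simp add: f_def inner_diff_left inner_diff_right symmetric_matrix_inner[OF sym])
  have f0: "0 \<le> x \<bullet> f x" for x
    using upper[of x] K by (simp add: f_def inner_diff_right dot_square_norm field_simps)
  have f1: "x \<bullet> f x \<le> \<rho> * (norm x)\<^sup>2" for x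
    using m(2)[of x] K by (simp add: f_def \<rho>_def inner_diff_right dot_square_norm field_simps)
  define X where "X = Blinfun f"
  have X: "blinfun_apply X = f" unfolding X_def by (rule bounded_linear_Blinfun_apply[OF blf])
  have nX: "norm X \<le> \<rho>"
    using symmetric_form_bound_imp_norm_bound[OF bounded_linear.linear[OF blf] fsym f0 f1]
    by (intro norm_blinfun_bound \<rho>) (simp add: X)
  define S where "S = {Y :: (real^'d) \<Rightarrow>\<^sub>L (real^'d). norm Y \<le> \<rho> \<and> (\<forall>x y. x \<bullet> blinfun_apply Y y =
      blinfun_apply Y x \<bullet> y)}"
  define \<Phi> where "\<Phi> = (\<lambda>Y :: (real^'d) \<Rightarrow>\<^sub>L (real^'d). (X + (Y o\<^sub>L Y)) /\<^sub>R 2)"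
  have "closed S"
  proof -
    have "S = {Y. norm Y \<le> \<rho>} \<inter> (\<Inter>x. \<Inter>y. {Y. x \<bullet> blinfun_apply Y y = blinfun_apply Y x \<bullet> y})"
      by (auto simp: S_def)
    moreover have "closed {Y::(real^'d) \<Rightarrow>\<^sub>L (real^'d). norm Y \<le> \<rho>}"
      by (intro closed_Collect_le continuous_intros)
    moreover have "closed {Y::(real^'d) \<Rightarrow>\<^sub>L (real^'d). x \<bullet> blinfun_apply Y y = blinfun_apply Y x \<bullet>
        y}" for x y
      by (intro closed_Collect_eq continuous_intros)
    ultimately show ?thesis by (simp add: closed_Int closed_INT)
  qed
  then have "\<exists>!Y. Y \<in> S \<and> \<Phi> Y = Y" if
      "\<Phi> ` S \<subseteq> S" "\<And>Y Y'. Y \<in> S \<Longrightarrow> Y' \<in> S \<Longrightarrow> dist (\<Phi> Y) (\<Phi> Y') \<le> \<rho> * dist Y Y'" "S \<noteq> {}"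
    using Banach_fix[of S \<rho> \<Phi>] \<rho> that by (simp add: complete_eq_closed)
  moreover have "S \<noteq> {}" using \<rho> by (auto simp: S_def intro!: exI[of _ 0])
  \<comment> \<open>Norm bound: \<open>(\<rho> + \<rho>\<^sup>2) / 2 \<le> \<rho>\<close>.\<close>
  moreover have "\<Phi> ` S \<subseteq> S"
  proof safe
    fix Y assume Y: "Y \<in> S"
    have "norm (\<Phi> Y) \<le> (norm X + norm (Y o\<^sub>L Y)) / 2"
      unfolding \<Phi>_def using norm_triangle_ineq[of X "Y o\<^sub>L Y"] by simp
    also have "norm (Y o\<^sub>L Y) \<le> norm Y * norm Y" by (rule norm_blinfun_compose)
    also have "\<dots> \<le> \<rho> * \<rho>" using Y \<rho> by (intro mult_mono) (auto simp: S_def)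
    also have "\<dots> \<le> \<rho> * 1" using \<rho> by (intro mult_left_mono) auto
    finally have "norm (\<Phi> Y) \<le> \<rho>" using nX by simp
    moreover have "x \<bullet> \<Phi> Y y = \<Phi> Y x \<bullet> y" for x y
    proof -
      have YY: "x \<bullet> Y y = Y x \<bullet> y" for x y using Y by (simp add: S_def)
      have "x \<bullet> Y (Y y) = Y (Y x) \<bullet> y" by (simp add: YY)
      then show ?thesis
        by (simp add: \<Phi>_def scaleR_blinfun.rep_eq plus_blinfun.rep_eq inner_add_left
            inner_add_right X fsym)
    qed
    ultimately show "\<Phi> Y \<in> S" by (simp add: S_def)
  qed
  moreover have "dist (\<Phi> Y) (\<Phi> Y') \<le> \<rho> * dist Y Y'" if "Y \<in> S" "Y' \<in> S" for Y Y'
  proof -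
    have "\<Phi> Y - \<Phi> Y' = ((Y o\<^sub>L (Y - Y')) + ((Y - Y') o\<^sub>L Y')) /\<^sub>R 2"
      by (rule blinfun_eqI) (simp add: \<Phi>_def scaleR_blinfun.rep_eq plus_blinfun.rep_eq
          minus_blinfun.rep_eq blinfun.diff_right algebra_simps)
    then have "dist (\<Phi> Y) (\<Phi> Y') \<le> (norm (Y o\<^sub>L (Y - Y')) + norm ((Y - Y') o\<^sub>L Y')) / 2"
      using norm_triangle_ineq[of "Y o\<^sub>L (Y - Y')" "(Y - Y') o\<^sub>L Y'"] by (simp add: dist_norm)
    also have "\<dots> \<le> (norm Y * norm (Y - Y') + norm (Y - Y') * norm Y') / 2"
      by (intro divide_right_mono add_mono norm_blinfun_compose) simp
    also have "\<dots> \<le> (\<rho> * norm (Y - Y') + norm (Y - Y') * \<rho>) / 2"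
      using that \<rho> by (intro divide_right_mono add_mono mult_mono) (auto simp: S_def)
    finally show ?thesis by (simp add: dist_norm ac_simps)
  qed
  ultimately obtain Y where Y: "Y \<in> S" "\<Phi> Y = Y"
    by blast
  define g where "g = (\<lambda>x. sqrt K *\<^sub>R (x - Y x))"
  have "linear g" unfolding g_def
    by (intro bounded_linear.linear bounded_linear_intros)
  define B where "B = matrix g"
  have B: "B *v x = g x" for x unfolding B_def by (simp add: \<open>linear g\<close>)
  have gsym: "x \<bullet> g y = g x \<bullet> y" for x y
    using Y(1) by (simp add: g_def S_def inner_diff_left inner_diff_right)
  have "transpose B = B"
  proof (rule matrix_eq[THEN iffD2], rule allI, rule vector_eq_rdot[THEN iffD1], rule allI)
    fix x z
    show "(transpose B *v x) \<bullet> z = (B *v x) \<bullet> z"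
      by (metis B dot_lmul_matrix gsym inner_commute transpose_matrix_vector)
  qed
  moreover have "0 \<le> x \<bullet> (B *v x)" for x
  proof -
    have "x \<bullet> Y x \<le> norm x * norm (Y x)" by (rule norm_cauchy_schwarz)
    also have "\<dots> \<le> norm x * (norm Y * norm x)" by (intro mult_left_mono norm_blinfun) simp
    also have "\<dots> \<le> norm x * (1 * norm x)"
      using Y(1) \<rho> by (intro mult_left_mono mult_right_mono) (auto simp: S_def)
    finally have "x \<bullet> Y x \<le> x \<bullet> x" by (simp add: dot_square_norm power2_eq_square)
    then show ?thesis using K by (simp add: B g_def inner_diff_right)
  qed
  moreover have "B ** B = A"
  proof (rule matrix_eq[THEN iffD2], rule allI)
    fix x
    have "Y x = (f x + Y (Y x)) /\<^sub>R 2"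
      using arg_cong[OF Y(2), of "\<lambda>Z. Z x"] by (simp add: \<Phi>_def scaleR_blinfun.rep_eq
          plus_blinfun.rep_eq X)
    then have "2 *\<^sub>R Y x = 2 *\<^sub>R ((f x + Y (Y x)) /\<^sub>R 2)" by (rule arg_cong)
    then have "2 *\<^sub>R Y x = f x + Y (Y x)" by (simp only: scaleR_scaleR) simp
    moreover have "(B ** B) *v x = K *\<^sub>R (x - 2 *\<^sub>R Y x + Y (Y x))"
      using K by (simp add: matrix_vector_mul_assoc[symmetric] B g_def blinfun.diff_right
          blinfun.scaleR_right algebra_simps scaleR_2)
    ultimately have "(B ** B) *v x = K *\<^sub>R (x - f x)" by simp
    then show "(B ** B) *v x = A *v x" using K by (simp add: f_def)
  qed
  ultimately show ?thesis unfolding positive_semidefinite_def by blast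
qed

lemma psd_square_root_definite:
  fixes B :: "real^'d^'d"
  assumes B: "positive_semidefinite B" "B ** B = A" and A: "positive_definite A"
  shows "positive_definite B"
proof -
  have sym: "transpose B = B" using B by (simp add: positive_semidefinite_def)
  have "0 < x \<bullet> (B *v x)" if "x \<noteq> 0" for x
  proof (rule ccontr)
    assume "\<not> ?thesis"
    then have 0: "x \<bullet> (B *v x) = 0" using B by (metis positive_semidefinite_def
        order.order_iff_strict)
    \<comment> \<open>The form of \<open>B\<close> is minimal at \<open>x\<close>, so its gradient \<open>2 B x\<close> vanishes there.\<close>
    define y where "y = B *v x"
    define e where "e = (y \<bullet> (B *v y))"
    have e: "e \<ge> 0" using B by (simp add: e_def positive_semidefinite_def)
    have yy: "x \<bullet> (B *v y) = y \<bullet> y" by (simp add: symmetric_matrix_inner[OF sym] y_def)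
    define t where "t = (y \<bullet> y) / (e + 1)"
    have "0 \<le> (x - t *\<^sub>R y) \<bullet> (B *v (x - t *\<^sub>R y))" using B by (simp add: positive_semidefinite_def)
    also have "\<dots> = - 2 * t * (y \<bullet> y) + t\<^sup>2 * e"
      using 0 yy by (simp add: matrix_vector_mult_diff_distrib matrix_vector_mult_scaleR
          inner_diff_left
          inner_diff_right e_def power2_eq_square flip: y_def) (simp add: algebra_simps
              inner_commute)
    also have "\<dots> = (y \<bullet> y)\<^sup>2 * (e - 2 * (e + 1)) / (e + 1)\<^sup>2"
    proof -
      have "- 2 * (Y / (e + 1)) * Y + (Y / (e + 1))\<^sup>2 * e = Y\<^sup>2 * (e - 2 * (e + 1)) / (e + 1)\<^sup>2"
          for Y :: real
        using e by (simp add: divide_simps power2_eq_square) algebra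
      then show ?thesis by (simp add: t_def)
    qed
    finally have "0 \<le> (y \<bullet> y)\<^sup>2 * (e - 2 * (e + 1))"
      using e by (auto simp: zero_le_divide_iff)
    then have "y = 0" using e by (auto simp: zero_le_mult_iff)
    then have "A *v x = 0" using B(2) unfolding y_def
      by (metis matrix_vector_mul_assoc matrix_vector_mult_0_right)
    then show False using A that by (auto simp: positive_definite_def)
  qed
  with sym show ?thesis by (simp add: positive_definite_def)
qed

lemma matrix_quad_form_trace:
  fixes D P :: "real^'d^'d"
  assumes "transpose D = D"
  shows "trace (D ** P ** D) = (\<Sum>i\<in>UNIV. column i D \<bullet> (P *v column i D))"
proof -
  have DD: "D$i$j = D$j$i" for i j using assms by (metis transpose_def vec_lambda_beta)
  have "column i D \<bullet> (P *v column i D) = (D ** P ** D) $ i $ i" for i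
  proof -
    have "(D ** P ** D) $ i $ i = (D ** (P ** D)) $ i $ i" by (simp add: matrix_mul_assoc)
    also have "\<dots> = (\<Sum>k\<in>UNIV. D$i$k * (\<Sum>l\<in>UNIV. P$k$l * D$l$i))"
      by (simp add: matrix_matrix_mult_def)
    also have "\<dots> = column i D \<bullet> (P *v column i D)"
      unfolding DD[of i] by (simp add: inner_vec_def column_def matrix_vector_mult_def)
    finally show ?thesis by simp
  qed
  then show ?thesis by (simp add: trace_def)
qed

text \<open>
  For two roots, \<open>D = B - C\<close> satisfies \<open>B D + D C = 0\<close>, because \<open>B\<^sup>2 = C\<^sup>2\<close>.  Multiplying by \<open>D\<close>
  and taking traces, \<open>tr (D B D) + tr (D C D) = 0\<close>; both traces are nonnegative, so the columns of
  \<open>D\<close> are null vectors of the form of \<open>B\<close>, which is definite.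
\<close>

lemma positive_definite_sqrt_unique:
  fixes A :: "real^'d^'d"
  assumes A: "positive_definite A"
    and B: "positive_semidefinite B" "B ** B = A" and C: "positive_semidefinite C" "C ** C = A"
  shows "B = C"
proof -
  define D where "D = B - C"
  have symB: "transpose B = B" and symC: "transpose C = C"
    using B C by (auto simp: positive_semidefinite_def)
  have symD: "transpose D = D"
    using symB symC by (simp add: D_def transpose_def vec_eq_iff)
  have "B ** D + D ** C = 0"
    using B C by (simp add: D_def matrix_mul_assoc vec_eq_iff matrix_matrix_mult_def algebra_simps
        sum_subtractf)
  then have "D ** (B ** D + D ** C) = 0" by simp
  then have "D ** B ** D + D ** D ** C = 0"
    by (simp add: matrix_add_ldistrib matrix_mul_assoc)
  then have "trace (D ** B ** D) + trace (D ** D ** C) = 0"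
    by (metis trace_add trace_0 mat_0)
  moreover have "trace (D ** D ** C) = trace (D ** C ** D)"
    by (metis matrix_mul_assoc trace_mul_sym)
  ultimately have sum0: "(\<Sum>i\<in>UNIV. column i D \<bullet> (B *v column i D)) + (\<Sum>i\<in>UNIV. column i D \<bullet> (C *v
      column i D)) = 0"
    by (simp add: matrix_quad_form_trace[OF symD])
  have nB: "0 \<le> x \<bullet> (B *v x)" and nC: "0 \<le> x \<bullet> (C *v x)" for x
    using B C by (auto simp: positive_semidefinite_def)
  have "(\<Sum>i\<in>UNIV. column i D \<bullet> (B *v column i D)) = 0"
    using sum0 sum_nonneg[of UNIV "\<lambda>i. column i D \<bullet> (B *v column i D)"]
      sum_nonneg[of UNIV "\<lambda>i. column i D \<bullet> (C *v column i D)"] nB nC by fastforce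
  then have "column i D \<bullet> (B *v column i D) = 0" for i
    using nB by (subst (asm) sum_nonneg_eq_0_iff) auto
  moreover have "positive_definite B" using psd_square_root_definite[OF B A] .
  ultimately have "column i D = 0" for i
    unfolding positive_definite_def by (metis less_irrefl)
  then have "D = 0" by (simp add: vec_eq_iff column_def)
  then show ?thesis by (simp add: D_def)
qed

lemma matrix_sqrt_works:
  fixes A :: "real^'d^'d"
  assumes "positive_definite A"
  shows "positive_definite (matrix_sqrt A)" "matrix_sqrt A ** matrix_sqrt A = A"
proof -
  have "\<exists>!B. positive_semidefinite B \<and> B ** B = A"
    using positive_definite_has_sqrt[OF assms] positive_definite_sqrt_unique[OF assms] by blast
  from theI'[OF this] have *: "positive_semidefinite (matrix_sqrt A)" "matrix_sqrt A **
      matrix_sqrt A = A"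
    unfolding matrix_sqrt_def by auto
  then show "matrix_sqrt A ** matrix_sqrt A = A" by simp
  show "positive_definite (matrix_sqrt A)" using psd_square_root_definite[OF * assms] .
qed

section \<open>Functions of a uniform permutation\<close>

text \<open>
  The law of total variance for a uniform pair \<open>(b, q)\<close>: the conditional variances given \<open>b\<close> are
  at most \<open>V / card Q\<close>, and the conditional means are within \<open>D\<close> of each other.
\<close>

lemma sum_square_deviation_le:
  fixes h :: "'b \<Rightarrow> real" and f :: "'b \<Rightarrow> 'p \<Rightarrow> real" and V D :: real
  assumes fin: "finite P" "finite Q" and ne: "P \<noteq> {}" "Q \<noteq> {}"
    and inner: "\<And>b. b \<in> P \<Longrightarrow> (\<Sum>q\<in>Q. (f b q - (\<Sum>q\<in>Q. f b q) / card Q)\<^sup>2) \<le> V"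
    and outer: "\<And>b b'. b \<in> P \<Longrightarrow> b' \<in> P \<Longrightarrow> \<bar>(\<Sum>q\<in>Q. f b q) / card Q - (\<Sum>q\<in>Q. f b' q) / card Q\<bar> \<le> D"
  shows "(\<Sum>b\<in>P. \<Sum>q\<in>Q. (f b q - (\<Sum>b\<in>P. \<Sum>q\<in>Q. f b q) / (card P * card Q))\<^sup>2)
           \<le> card P * (V + card Q * D\<^sup>2)"
proof -
  define N where "N = real (card Q)"
  define A where "A = (\<lambda>b. (\<Sum>q\<in>Q. f b q) / N)"
  define \<mu> where "\<mu> = (\<Sum>b\<in>P. A b) / card P"
  have N: "N > 0" and P: "card P > 0" using fin ne by (auto simp: N_def card_gt_0_iff)
  have \<mu>: "(\<Sum>b\<in>P. \<Sum>q\<in>Q. f b q) / (card P * card Q) = \<mu>"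
    by (simp add: \<mu>_def A_def N_def sum_divide_distrib[symmetric] mult.commute)
  have dev: "(A b - \<mu>)\<^sup>2 \<le> D\<^sup>2" if b: "b \<in> P" for b
  proof -
    have "A b - \<mu> = (\<Sum>b'\<in>P. A b - A b') / card P"
      using P by (simp add: \<mu>_def sum_subtractf field_simps)
    then have "\<bar>A b - \<mu>\<bar> = \<bar>\<Sum>b'\<in>P. A b - A b'\<bar> / card P" by (simp add: abs_divide)
    also have "\<dots> \<le> (\<Sum>b'\<in>P. \<bar>A b - A b'\<bar>) / card P" by (intro divide_right_mono sum_abs) simp
    also have "\<dots> \<le> (\<Sum>b'\<in>P. D) / card P"
      using outer[OF b] by (intro divide_right_mono sum_mono) (auto simp: A_def N_def)
    also have "\<dots> = D" using P by simp
    finally show ?thesis by (metis abs_ge_zero power2_abs power_mono)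
  qed
  have "(\<Sum>q\<in>Q. (f b q - \<mu>)\<^sup>2) \<le> V + N * D\<^sup>2" if b: "b \<in> P" for b
  proof -
    have NA: "(\<Sum>q\<in>Q. f b q) = N * A b" using N by (simp add: A_def)
    have "(f b q - \<mu>)\<^sup>2 = (f b q - A b)\<^sup>2 + 2 * (A b - \<mu>) * (f b q - A b) + (A b - \<mu>)\<^sup>2" for q
      by (simp add: power2_eq_square algebra_simps)
    then have "(\<Sum>q\<in>Q. (f b q - \<mu>)\<^sup>2)
        = (\<Sum>q\<in>Q. (f b q - A b)\<^sup>2) + 2 * (A b - \<mu>) * (\<Sum>q\<in>Q. f b q - A b) + N * (A b - \<mu>)\<^sup>2"
      by (simp add: sum.distrib sum_distrib_left N_def)
    also have "(\<Sum>q\<in>Q. f b q - A b) = 0" by (simp add: sum_subtractf NA N_def)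
    finally have eq: "(\<Sum>q\<in>Q. (f b q - \<mu>)\<^sup>2)
        = (\<Sum>q\<in>Q. (f b q - A b)\<^sup>2) + 2 * (A b - \<mu>) * 0 + N * (A b - \<mu>)\<^sup>2" .
    show ?thesis
    proof -
      have "N * (A b - \<mu>)\<^sup>2 \<le> N * D\<^sup>2" using N dev[OF b] by (intro mult_left_mono) auto
      moreover have "(\<Sum>q\<in>Q. (f b q - A b)\<^sup>2) \<le> V" using inner[OF b] by (simp add: A_def N_def)
      ultimately show ?thesis using eq by simp
    qed
  qed
  then have "(\<Sum>b\<in>P. \<Sum>q\<in>Q. (f b q - \<mu>)\<^sup>2) \<le> (\<Sum>b\<in>P. V + N * D\<^sup>2)" by (rule sum_mono)
  then show ?thesis unfolding \<mu> by (simp add: N_def)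
qed

text \<open>
  An Efron-Stein bound for permutations, by induction on the set: a uniform permutation of
  \<open>insert a S\<close> is a uniform permutation of \<open>S\<close> followed by the exchange of \<open>a\<close> with a uniform \<open>b\<close>.
  Given \<open>b\<close> the induction hypothesis applies, and changing \<open>b\<close> amounts to two transpositions.
\<close>

lemma permutation_variance_le:
  fixes f :: "('a \<Rightarrow> 'a) \<Rightarrow> real" and c :: real
  assumes "finite S"
    and "\<And>p x y. p permutes S \<Longrightarrow> x \<in> S \<Longrightarrow> y \<in> S \<Longrightarrow> \<bar>f (p \<circ> Transposition.transpose x y) - f p\<bar> \<le> c"
  shows "(\<Sum>p | p permutes S. (f p - (\<Sum>p | p permutes S. f p) / fact (card S))\<^sup>2)
           \<le> 4 * c\<^sup>2 * card S * fact (card S)"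
  using assms
proof (induction S arbitrary: f rule: finite_induct)
  case empty
  have "{p. p permutes {}} = {id :: 'a \<Rightarrow> 'a}" by auto
  then show ?case by simp
next
  case (insert a S)
  let ?P = "insert a S" and ?Q = "{p. p permutes S}"
  let ?g = "\<lambda>b p. f (Transposition.transpose a b \<circ> p)"
  have cQ: "card ?Q = fact (card S)" and cP: "card ?P = Suc (card S)"
    using insert by (auto simp: card_permutations)
  have inj: "inj_on (\<lambda>(b, p). Transposition.transpose a b \<circ> p) (?P \<times> ?Q)"
    using insert.hyps(2)
  proof (intro inj_onI, clarsimp)
    fix b p b' q assume *: "a \<notin> S" "p permutes S" "q permutes S" "Transposition.transpose a b \<circ> p
        = Transposition.transpose a b' \<circ> q"
    then have "p a = a" "q a = a" by (auto simp: permutes_not_in)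
    then have "b = b'" using fun_cong[OF *(4), of a] by simp
    then have "Transposition.transpose a b \<circ> (Transposition.transpose a b \<circ> p) =
        Transposition.transpose a b \<circ> (Transposition.transpose a b \<circ> q)" using *(4) by simp
    then show "b = b' \<and> p = q" using \<open>b = b'\<close> by (simp add: fun_eq_iff)
  qed
  have ins: "{p. p permutes insert a S} = (\<lambda>(b, p). Transposition.transpose a b \<circ> p) ` (?P \<times> ?Q)"
    unfolding permutes_insert by auto
  have sum: "(\<Sum>p | p permutes insert a S. h p) = (\<Sum>b\<in>?P. \<Sum>q\<in>?Q. h (Transposition.transpose a b \<circ>
      q))"
    for h :: "('a \<Rightarrow> 'a) \<Rightarrow> real"
    unfolding ins by (subst sum.reindex[OF inj]) (simp add: sum.cartesian_product o_def
        case_prod_unfold)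
  have perm: "Transposition.transpose a b \<circ> p permutes ?P" if "b \<in> ?P" "p permutes S" for b p
  proof -
    have "Transposition.transpose a b \<circ> p \<in> {p. p permutes insert a S}"
      unfolding ins using that by (auto intro!: image_eqI[where x = "(b, p)"])
    then show ?thesis by simp
  qed
  \<comment> \<open>A transposition of values is a transposition of positions.\<close>
  have swap_left: "\<bar>f (Transposition.transpose x y \<circ> p) - f p\<bar> \<le> c" if p: "p permutes ?P" and "x \<in>
      ?P" "y \<in> ?P" for p x y
  proof -
    have eq: "Transposition.transpose x y \<circ> p = p \<circ> Transposition.transpose (inv p x) (inv p y)"
      using p by (metis bij_is_inj bij_imp_bij_inv inv_inv_eq permutes_bij permutes_inv_o(1)
          transpose_comp_eq o_assoc comp_id id_comp inj_imp_surj_inv)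
    show ?thesis unfolding eq using insert.prems[OF p] that
      by (meson permutes_in_image permutes_inv)
  qed
  have inner: "(\<Sum>q\<in>?Q. (?g b q - (\<Sum>q\<in>?Q. ?g b q) / card ?Q)\<^sup>2) \<le> 4 * c\<^sup>2 * card S * fact (card S)"
    if b: "b \<in> ?P" for b
    unfolding cQ of_nat_fact
  proof (rule insert.IH)
    fix p x y assume "p permutes S" "x \<in> S" "y \<in> S"
    then show "\<bar>?g b (p \<circ> Transposition.transpose x y) - ?g b p\<bar> \<le> c"
      using insert.prems[OF perm[OF b], of p x y] by (simp only: o_assoc insertI2)
  qed
  have outer: "\<bar>(\<Sum>q\<in>?Q. ?g b q) / card ?Q - (\<Sum>q\<in>?Q. ?g b' q) / card ?Q\<bar> \<le> 2 * c"
    if b: "b \<in> ?P" "b' \<in> ?P" for b b'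
  proof -
    have "\<bar>?g b q - ?g b' q\<bar> \<le> 2 * c" if q: "q \<in> ?Q" for q
    proof -
      let ?r = "Transposition.transpose a b \<circ> q"
      have r: "?r permutes ?P" and q': "q permutes ?P" 
        using perm[OF b(1)] q by (auto intro: permutes_subset)
      have "\<bar>f ?r - f q\<bar> \<le> c" "\<bar>f (Transposition.transpose a b' \<circ> q) - f q\<bar> \<le> c"
        using swap_left[OF q', of a b] swap_left[OF q', of a b'] b by auto
      then show ?thesis by linarith
    qed
    then have "(\<Sum>q\<in>?Q. \<bar>?g b q - ?g b' q\<bar>) \<le> card ?Q * (2 * c)"
      by (intro sum_bounded_above) auto
    then have "\<bar>\<Sum>q\<in>?Q. ?g b q - ?g b' q\<bar> \<le> card ?Q * (2 * c)"
      by (rule order_trans[OF sum_abs])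
    then have "\<bar>\<Sum>q\<in>?Q. ?g b q - ?g b' q\<bar> / card ?Q \<le> 2 * c"
      unfolding cQ by (simp add: field_simps)
    then show ?thesis by (simp add: sum_subtractf diff_divide_distrib[symmetric] abs_divide)
  qed
  have "(\<Sum>p | p permutes insert a S. (f p - (\<Sum>p | p permutes insert a S. f p) / fact (card ?P))\<^sup>2)
      = (\<Sum>b\<in>?P. \<Sum>q\<in>?Q. (?g b q - (\<Sum>b\<in>?P. \<Sum>q\<in>?Q. ?g b q) / (card ?P * card ?Q))\<^sup>2)"
  proof -
    have e: "(fact (card ?P) :: real) = card ?P * card ?Q" unfolding cQ cP by (simp add:
        distrib_right)
    show ?thesis by (simp only: sum e of_nat_mult)
  qed
  also have "\<dots> \<le> card ?P * (4 * c\<^sup>2 * card S * fact (card S) + card ?Q * (2 * c)\<^sup>2)"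
    using insert.hyps inner outer
    by (intro sum_square_deviation_le) (auto simp: finite_permutations intro: permutes_id)
  also have "\<dots> = 4 * c\<^sup>2 * card ?P * fact (card ?P)"
    unfolding cQ cP by (simp add: algebra_simps power2_eq_square)
  finally show ?case .
qed

section \<open>Antisymmetric pair sums and relocations\<close>

definition pair_sum :: "nat \<Rightarrow> (nat \<Rightarrow> nat \<Rightarrow> 'v::real_vector) \<Rightarrow> (nat \<Rightarrow> nat) \<Rightarrow> 'v" where
  "pair_sum n m p = (\<Sum>i\<in>{1..n}. \<Sum>j\<in>{i<..n}. m (p i) (p j))"

text \<open>
  The signs turn the sum over ordered positions into a sum over all pairs of positions.  The
  latter is convenient because a relocation only alters the signs of pairs containing the moved
  entry.
\<close>

definition order_sign :: "nat \<Rightarrow> nat \<Rightarrow> real" where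
  "order_sign k l = sgn (real l - real k)"

lemma pair_sum_order_sign:
  assumes anti: "\<And>u v. u \<in> {1..n} \<Longrightarrow> v \<in> {1..n} \<Longrightarrow> m u v = - m v u" and p: "p permutes {1..n}"
  shows "2 *\<^sub>R pair_sum n m p = (\<Sum>k\<in>{1..n}. \<Sum>l\<in>{1..n}. order_sign k l *\<^sub>R m (p k) (p l))"
proof -
  have pin: "p k \<in> {1..n}" if "k \<in> {1..n}" for k using permutes_in_image[OF p, of k] that by blast
  have up: "(\<Sum>j\<in>{i<..n}. m (p i) (p j)) = (\<Sum>l\<in>{1..n}. (if i < l then m (p i) (p l) else 0))" if "i
      \<in> {1..n}" for i
    using that by (subst sum.inter_filter[symmetric]) (auto intro!: sum.cong)
  have W: "pair_sum n m p = (\<Sum>k\<in>{1..n}. \<Sum>l\<in>{1..n}. (if k < l then m (p k) (p l) else 0))"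
    unfolding pair_sum_def by (intro sum.cong refl up)
  also have "\<dots> = (\<Sum>k\<in>{1..n}. \<Sum>l\<in>{1..n}. (if l < k then m (p l) (p k) else 0))"
    by (rule sum.swap)
  also have "\<dots> = (\<Sum>k\<in>{1..n}. \<Sum>l\<in>{1..n}. (if l < k then - m (p k) (p l) else 0))"
    by (intro sum.cong refl if_cong anti pin)
  finally have "pair_sum n m p + pair_sum n m p =
      (\<Sum>k\<in>{1..n}. \<Sum>l\<in>{1..n}. (if k < l then m (p k) (p l) else 0) + (if l < k then - m (p k) (p l)
          else 0))"
    using W by (simp add: sum.distrib)
  also have "\<dots> = (\<Sum>k\<in>{1..n}. \<Sum>l\<in>{1..n}. order_sign k l *\<^sub>R m (p k) (p l))"
    by (intro sum.cong refl) (auto simp: order_sign_def sgn_if)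
  finally show ?thesis by (simp add: scaleR_2)
qed

text \<open>
  If \<open>\<rho>\<close> moves position \<open>i\<close> and keeps the order of all others, the signs of pairs that avoid \<open>i\<close>
  do not change.  The pairs \<open>(i, l)\<close> and \<open>(l, i)\<close> contribute equally by antisymmetry.
\<close>

lemma pair_sum_relocate:
  assumes anti: "\<And>u v. u \<in> {1..n} \<Longrightarrow> v \<in> {1..n} \<Longrightarrow> m u v = - m v u" and p: "p permutes {1..n}"
    and r: "\<rho> permutes {1..n}" and i: "i \<in> {1..n}"
    and ord: "\<And>k l. k \<in> {1..n} \<Longrightarrow> l \<in> {1..n} \<Longrightarrow> k \<noteq> i \<Longrightarrow> l \<noteq> i \<Longrightarrow> \<rho> k < \<rho> l \<longleftrightarrow> k < l"
  shows "pair_sum n m (p \<circ> inv \<rho>) = pair_sum n m p +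
    (\<Sum>l\<in>{1..n}. (order_sign (\<rho> i) (\<rho> l) - order_sign i l) *\<^sub>R m (p i) (p l))"
proof -
  define V where "V = {1..n}"
  note defs = V_def[symmetric]
  define c where "c = (\<lambda>k l. order_sign (\<rho> k) (\<rho> l) - order_sign k l)"
  have pin: "p k \<in> V" if "k \<in> V" for k using permutes_in_image[OF p, of k] that by (simp only:
      V_def)
  have os_anti: "order_sign k l = - order_sign l k" for k l
    by (simp add: order_sign_def sgn_if)
  have c0: "c k l = 0" if "k \<in> V" "l \<in> V" "k \<noteq> i" "l \<noteq> i" for k l
    using ord[of k l] ord[of l k] that by (auto simp: c_def order_sign_def sgn_if V_def)
  have cii: "c i i = 0" by (simp add: c_def order_sign_def)
  have c_anti: "c k l = - c l k" for k l using os_anti[of k l] os_anti[of "\<rho> k" "\<rho> l"] by (simp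
      add: c_def)
  have reindex: "(\<Sum>k\<in>V. h (inv \<rho> k) k) = (\<Sum>k\<in>V. h k (\<rho> k))" for h :: "nat \<Rightarrow> nat \<Rightarrow> 'a"
    using sum.permute[OF r[folded V_def], of "\<lambda>k. h (inv \<rho> k) k"] by (simp add: o_def
        permutes_inverses[OF r])
  have two: "2 *\<^sub>R pair_sum n m p = (\<Sum>k\<in>V. \<Sum>l\<in>V. order_sign k l *\<^sub>R m (p k) (p l))"
    unfolding V_def by (rule pair_sum_order_sign[OF anti p])
  have "2 *\<^sub>R pair_sum n m (p \<circ> inv \<rho>)
      = (\<Sum>k\<in>V. \<Sum>l\<in>V. order_sign k l *\<^sub>R m (p (inv \<rho> k)) (p (inv \<rho> l)))"
    using pair_sum_order_sign[of n m "p \<circ> inv \<rho>", OF anti permutes_compose[OF permutes_inv[OF r]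
        p]] by (simp add: V_def)
  also have "\<dots> = (\<Sum>k\<in>V. \<Sum>l\<in>V. order_sign k (\<rho> l) *\<^sub>R m (p (inv \<rho> k)) (p l))"
    by (intro sum.cong refl reindex[of "\<lambda>l' l. order_sign _ l *\<^sub>R m _ (p l')"])
  also have "\<dots> = (\<Sum>k\<in>V. \<Sum>l\<in>V. order_sign (\<rho> k) (\<rho> l) *\<^sub>R m (p k) (p l))"
    by (rule reindex[of "\<lambda>k' k. \<Sum>l\<in>V. order_sign k (\<rho> l) *\<^sub>R m (p k') (p l)"])
  finally have "2 *\<^sub>R pair_sum n m (p \<circ> inv \<rho>) - 2 *\<^sub>R pair_sum n m p
      = (\<Sum>k\<in>V. \<Sum>l\<in>V. c k l *\<^sub>R m (p k) (p l))"
    by (simp add: two c_def sum_subtractf[symmetric] scaleR_diff_left)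
  also have "\<dots> = (\<Sum>l\<in>V. c i l *\<^sub>R m (p i) (p l)) + (\<Sum>k\<in>V - {i}. \<Sum>l\<in>V. c k l *\<^sub>R m (p k) (p l))"
    using i by (subst sum.remove[of _ i]) (auto simp: V_def)
  also have "(\<Sum>k\<in>V - {i}. \<Sum>l\<in>V. c k l *\<^sub>R m (p k) (p l)) = (\<Sum>k\<in>V - {i}. c k i *\<^sub>R m (p k) (p i))"
  proof (rule sum.cong[OF refl])
    fix k assume k: "k \<in> V - {i}"
    have "(\<Sum>l\<in>V. c k l *\<^sub>R m (p k) (p l)) = c k i *\<^sub>R m (p k) (p i) + (\<Sum>l\<in>V - {i}. c k l *\<^sub>R m (p
        k) (p l))"
      using i by (subst sum.remove[of _ i]) (auto simp: V_def)
    also have "(\<Sum>l\<in>V - {i}. c k l *\<^sub>R m (p k) (p l)) = 0"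
      using k by (intro sum.neutral) (auto simp: c0)
    finally show "(\<Sum>l\<in>V. c k l *\<^sub>R m (p k) (p l)) = c k i *\<^sub>R m (p k) (p i)" by simp
  qed
  also have "\<dots> = (\<Sum>k\<in>V. c i k *\<^sub>R m (p i) (p k))"
  proof -
    have "(\<Sum>k\<in>V - {i}. c k i *\<^sub>R m (p k) (p i)) = (\<Sum>k\<in>V - {i}. c i k *\<^sub>R m (p i) (p k))"
    proof (rule sum.cong[OF refl])
      fix k assume "k \<in> V - {i}"
      then show "c k i *\<^sub>R m (p k) (p i) = c i k *\<^sub>R m (p i) (p k)"
        using anti[of "p k" "p i"] c_anti[of k i] pin[of k] pin[of i] i by (simp add: V_def)
    qed
    also have "\<dots> = (\<Sum>k\<in>V. c i k *\<^sub>R m (p i) (p k))"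
      using i by (subst sum.remove[of V i]) (auto simp: V_def cii)
    finally show ?thesis .
  qed
  finally have "2 *\<^sub>R (pair_sum n m (p \<circ> inv \<rho>) - pair_sum n m p) = 2 *\<^sub>R (\<Sum>l\<in>V. c i l *\<^sub>R m (p i)
      (p l))"
    by (simp add: scaleR_2 scaleR_diff_right o_def)
  then have "pair_sum n m (p \<circ> inv \<rho>) - pair_sum n m p = (\<Sum>l\<in>V. c i l *\<^sub>R m (p i) (p l))"
    by (simp only: scaleR_cancel_left) simp
  then show ?thesis by (simp add: c_def V_def algebra_simps)
qed

text \<open>
  The new position of each entry when the entry at \<open>i\<close> is moved to the end (\<open>e\<close> true) or to the
  front (\<open>e\<close> false).
\<close>

fun relocate :: "nat \<Rightarrow> nat \<times> bool \<Rightarrow> nat \<Rightarrow> nat" where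
  "relocate n (i, e) k =
     (if k \<notin> {1..n} then k
      else if e then (if k < i then k else if k = i then n else k - 1)
      else (if k < i then k + 1 else if k = i then 1 else k))"

definition jump_coeff :: "nat \<times> bool \<Rightarrow> nat \<Rightarrow> real" where
  "jump_coeff ie l = (case ie of (i, e) \<Rightarrow> if e then (if i < l then - 2 else 0) else (if l < i then
      2 else 0))"

definition jump :: "nat \<Rightarrow> (nat \<Rightarrow> nat \<Rightarrow> 'v::real_vector) \<Rightarrow> nat \<times> bool \<Rightarrow> (nat \<Rightarrow> nat) \<Rightarrow> 'v" where
  "jump n m ie p = (\<Sum>l\<in>{1..n}. jump_coeff ie l *\<^sub>R m (p (fst ie)) (p l))"

lemma relocate_permutes:
  assumes "i \<in> {1..n}"
  shows "relocate n (i, e) permutes {1..n}"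
proof (rule bij_imp_permutes)
  have "inj_on (relocate n (i, e)) {1..n}"
  proof (rule inj_onI)
    fix k l assume "k \<in> {1..n}" "l \<in> {1..n}" "relocate n (i, e) k = relocate n (i, e) l"
    then show "k = l" using assms
      by (cases e; cases k i rule: linorder_cases; cases l i rule: linorder_cases; simp)
  qed
  moreover have "relocate n (i, e) ` {1..n} \<subseteq> {1..n}"
  proof (rule image_subsetI)
    fix k assume "k \<in> {1..n}"
    then show "relocate n (i, e) k \<in> {1..n}" using assms
      by (cases e; cases k i rule: linorder_cases; simp; linarith?)
  qed
  ultimately show "bij_betw (relocate n (i, e)) {1..n} {1..n}"
    using endo_inj_surj[of "{1..n}" "relocate n (i, e)"] unfolding bij_betw_def by blast
qed (simp only: relocate.simps not_False_eq_True if_True)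

lemma pair_sum_jump:
  assumes anti: "\<And>u v. u \<in> {1..n} \<Longrightarrow> v \<in> {1..n} \<Longrightarrow> m u v = - m v u" and p: "p permutes {1..n}"
    and i: "i \<in> {1..n}"
  shows "pair_sum n m (p \<circ> inv (relocate n (i, e))) = pair_sum n m p + jump n m (i, e) p"
proof -
  have "pair_sum n m (p \<circ> inv (relocate n (i, e))) = pair_sum n m p +
    (\<Sum>l\<in>{1..n}. (order_sign (relocate n (i, e) i) (relocate n (i, e) l) - order_sign i l) *\<^sub>R m (p
        i) (p l))"
    using i by (intro pair_sum_relocate anti p relocate_permutes) auto
  also have "(\<Sum>l\<in>{1..n}. (order_sign (relocate n (i, e) i) (relocate n (i, e) l) - order_sign i l)
      *\<^sub>R m (p i) (p l))
      = jump n m (i, e) p"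
    unfolding jump_def fst_conv
  proof (intro sum.cong refl arg_cong2[of _ _ _ _ scaleR])
    fix l assume "l \<in> {1..n}"
    then show "order_sign (relocate n (i, e) i) (relocate n (i, e) l) - order_sign i l =
        jump_coeff (i, e) l"
      using i by (auto simp: jump_coeff_def order_sign_def sgn_if)
  qed
  finally show ?thesis .
qed

lemma bij_betw_compose_perm:
  assumes "q permutes S"
  shows "bij_betw (\<lambda>p. p \<circ> q) {p. p permutes S} {p. p permutes S}"
proof (rule bij_betw_byWitness[where f' = "\<lambda>p. p \<circ> inv q"])
  show "\<forall>p\<in>{p. p permutes S}. p \<circ> q \<circ> inv q = p" "\<forall>p\<in>{p. p permutes S}. p \<circ> inv q \<circ> q = p"
    by (simp_all add: fun_eq_iff permutes_inverses[OF assms])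
  show "(\<lambda>p. p \<circ> q) ` {p. p permutes S} \<subseteq> {p. p permutes S}"
    using permutes_compose[OF assms] by blast
  show "(\<lambda>p. p \<circ> inv q) ` {p. p permutes S} \<subseteq> {p. p permutes S}"
    using permutes_compose[OF permutes_inv[OF assms]] by blast
qed

abbreviation moves :: "nat \<Rightarrow> (nat \<times> bool) set" where "moves n \<equiv> {1..n} \<times> UNIV"

lemma sum_moves: "(\<Sum>ie\<in>moves n. h ie) = (\<Sum>i\<in>{1..n}. h (i, True) + h (i, False))"
proof -
  have "(\<Sum>ie\<in>moves n. h ie) = (\<Sum>(i, e)\<in>moves n. h (i, e))" by simp
  also have "\<dots> = (\<Sum>i\<in>{1..n}. \<Sum>e\<in>UNIV. h (i, e))" by (rule sum.cartesian_product[symmetric])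
  finally show ?thesis by (simp add: UNIV_bool add.commute)
qed

text \<open>
  At each position, the two jumps together have the coefficient \<open>-2\<close> towards later and \<open>2\<close> towards
  earlier positions, so their total is \<open>-2\<close> times the sum over all pairs with signs.
\<close>

lemma sum_jumps:
  assumes anti: "\<And>u v. u \<in> {1..n} \<Longrightarrow> v \<in> {1..n} \<Longrightarrow> m u v = - m v u" and p: "p permutes {1..n}"
  shows "(\<Sum>ie\<in>moves n. jump n m ie p) = - 4 *\<^sub>R pair_sum n m p"
proof -
  have "(\<Sum>ie\<in>moves n. jump n m ie p) = (\<Sum>i\<in>{1..n}. jump n m (i, True) p + jump n m (i, False) p)"
    by (rule sum_moves)
  also have "\<dots> = (\<Sum>i\<in>{1..n}. \<Sum>l\<in>{1..n}. (- 2 * order_sign i l) *\<^sub>R m (p i) (p l))"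
    unfolding jump_def sum.distrib[symmetric] scaleR_add_left[symmetric] fst_conv
    by (intro sum.cong refl arg_cong2[of _ _ _ _ scaleR]) (auto simp: jump_coeff_def
        order_sign_def sgn_if)
  also have "\<dots> = - 2 *\<^sub>R (\<Sum>i\<in>{1..n}. \<Sum>l\<in>{1..n}. order_sign i l *\<^sub>R m (p i) (p l))"
    by (simp add: scaleR_sum_right)
  also have "\<dots> = - 2 *\<^sub>R (2 *\<^sub>R pair_sum n m p)" 
    by (rule arg_cong[OF pair_sum_order_sign[OF anti p, symmetric]])
  finally show ?thesis by simp
qed

lemma abs_jump_coeff_le: "\<bar>jump_coeff ie l\<bar> \<le> 2"
  by (auto simp: jump_coeff_def split: prod.splits)

lemma norm_jump_le:
  fixes m :: "nat \<Rightarrow> nat \<Rightarrow> 'v::real_normed_vector"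
  assumes row: "\<And>u. u \<in> {1..n} \<Longrightarrow> (\<Sum>v\<in>{1..n}. norm (m u v)) \<le> B"
    and p: "p permutes {1..n}" and ie: "ie \<in> moves n"
  shows "norm (jump n m ie p) \<le> 2 * B"
proof -
  have "norm (jump n m ie p) \<le> (\<Sum>l\<in>{1..n}. norm (jump_coeff ie l *\<^sub>R m (p (fst ie)) (p l)))"
    unfolding jump_def by (rule norm_sum)
  also have "\<dots> \<le> (\<Sum>l\<in>{1..n}. 2 * norm (m (p (fst ie)) (p l)))"
    by (intro sum_mono) (simp add: abs_jump_coeff_le mult_right_mono)
  also have "\<dots> = 2 * (\<Sum>l\<in>{1..n}. norm (m (p (fst ie)) l))"
    using sum.permute[OF p, of "\<lambda>l. norm (m (p (fst ie)) l)"] by (simp add: o_def sum_distrib_left)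
  also have "\<dots> \<le> 2 * B" using ie p by (intro mult_left_mono row) (auto simp: permutes_in_image
      simp del: atLeastAtMost_iff)
  finally show ?thesis .
qed

text \<open>
  After exchanging the positions \<open>x\<close> and \<open>y\<close>, a jump from another position changes in the two
  terms containing these entries only.  Summed over all positions, these terms are column sums of
  the matrix, which antisymmetry identifies with row sums.  The jumps from \<open>x\<close> and \<open>y\<close> themselves
  are bounded individually.
\<close>

lemma sum_jump_swap_le:
  fixes m :: "nat \<Rightarrow> nat \<Rightarrow> 'v::real_normed_vector"
  assumes anti: "\<And>u v. u \<in> {1..n} \<Longrightarrow> v \<in> {1..n} \<Longrightarrow> m u v = - m v u"
    and row: "\<And>u. u \<in> {1..n} \<Longrightarrow> (\<Sum>v\<in>{1..n}. norm (m u v)) \<le> B"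
    and p: "p permutes {1..n}" and xy: "x \<in> {1..n}" "y \<in> {1..n}"
  shows "(\<Sum>ie\<in>moves n. norm (jump n m ie (p \<circ> Transposition.transpose x y) - jump n m ie p)) \<le> 32
      * B"
proof -
  let ?q = "p \<circ> Transposition.transpose x y"
  have q: "?q permutes {1..n}" using p xy by (simp add: permutes_compose permutes_swap_id)
  have pin: "p k \<in> {1..n}" if "k \<in> {1..n}" for k using permutes_in_image[OF p, of k] that by blast
  have B: "B \<ge> 0" using row[OF xy(1)] by (meson norm_ge_zero order_trans sum_nonneg)
  have le: "norm (jump n m ie ?q - jump n m ie p)
     \<le> 4 * (norm (m (p (fst ie)) (p x)) + norm (m (p (fst ie)) (p y))) + (if fst ie \<in> {x, y} then
         4 * B else 0)"
    if ie: "ie \<in> moves n" for ie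
  proof (cases "fst ie \<in> {x, y}")
    case True
    have "norm (jump n m ie ?q - jump n m ie p) \<le> 2 * B + 2 * B"
      using norm_jump_le[of n m B, OF row q ie] norm_jump_le[of n m B, OF row p ie] by (intro
          norm_triangle_le_diff) auto
    then show ?thesis using True by (simp add: add_increasing)
  next
    case False
    let ?i = "fst ie"
    have qi: "?q ?i = p ?i" using False by (simp add: transpose_apply_other)
    have "norm (jump n m ie ?q - jump n m ie p)
        = norm (\<Sum>l\<in>{1..n}. jump_coeff ie l *\<^sub>R (m (p ?i) (?q l) - m (p ?i) (p l)))"
      unfolding jump_def qi by (simp add: sum_subtractf[symmetric] scaleR_diff_right)
    also have "\<dots> \<le> (\<Sum>l\<in>{1..n}. norm (jump_coeff ie l *\<^sub>R (m (p ?i) (?q l) - m (p ?i) (p l))))"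
      by (rule norm_sum)
    also have "\<dots> = (\<Sum>l\<in>{x, y}. norm (jump_coeff ie l *\<^sub>R (m (p ?i) (?q l) - m (p ?i) (p l))))"
      using xy by (intro sum.mono_neutral_right) (auto simp: transpose_apply_other)
    also have "\<dots> \<le> (\<Sum>l\<in>{x, y}. 2 * (norm (m (p ?i) (p x)) + norm (m (p ?i) (p y))))"
    proof (rule sum_mono)
      fix l assume "l \<in> {x, y}"
      then have "norm (m (p ?i) (?q l) - m (p ?i) (p l)) \<le> norm (m (p ?i) (p x)) + norm (m (p ?i)
          (p y))"
        using norm_triangle_ineq4[of "m (p ?i) (p x)" "m (p ?i) (p y)"]
          norm_triangle_ineq4[of "m (p ?i) (p y)" "m (p ?i) (p x)"] by auto
      then show "norm (jump_coeff ie l *\<^sub>R (m (p ?i) (?q l) - m (p ?i) (p l)))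
          \<le> 2 * (norm (m (p ?i) (p x)) + norm (m (p ?i) (p y)))"
        unfolding norm_scaleR by (intro mult_mono abs_jump_coeff_le) auto
    qed
    also have "\<dots> \<le> 2 * (2 * (norm (m (p ?i) (p x)) + norm (m (p ?i) (p y))))"
      by (cases "x = y") auto
    finally show ?thesis using False by auto
  qed
  \<comment> \<open>Antisymmetry turns column sums into row sums.\<close>
  have col: "(\<Sum>i\<in>{1..n}. norm (m (p i) (p z))) \<le> B" if z: "z \<in> {1..n}" for z
  proof -
    have "(\<Sum>i\<in>{1..n}. norm (m (p i) (p z))) = (\<Sum>i\<in>{1..n}. norm (m (p z) (p i)))"
      using anti pin z by (intro sum.cong refl) (metis norm_minus_cancel)
    also have "\<dots> = (\<Sum>v\<in>{1..n}. norm (m (p z) v))"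
      using sum.permute[OF p, of "\<lambda>v. norm (m (p z) v)"] by (simp add: o_def)
    finally show ?thesis using row[OF pin[OF z]] by simp
  qed
  have "(\<Sum>ie\<in>moves n. norm (jump n m ie ?q - jump n m ie p))
     \<le> (\<Sum>ie\<in>moves n. 4 * (norm (m (p (fst ie)) (p x)) + norm (m (p (fst ie)) (p y))) + (if fst ie
         \<in> {x, y} then 4 * B else 0))"
    by (intro sum_mono le)
  also have "\<dots> = (\<Sum>i\<in>{1..n}. 2 * (4 * (norm (m (p i) (p x)) + norm (m (p i) (p y))) + (if i \<in> {x,
      y} then 4 * B else 0)))"
    unfolding sum_moves by (simp only: fst_conv mult_2)
  also have "\<dots> = 8 * ((\<Sum>i\<in>{1..n}. norm (m (p i) (p x))) + (\<Sum>i\<in>{1..n}. norm (m (p i) (p y)))) + 8 *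
      B * card {x, y}"
  proof -
    have "(\<Sum>i\<in>{1..n}. (if i \<in> {x, y} then 4 * B else 0)) = 4 * B * card {x, y}"
      using xy by (subst sum.inter_restrict[symmetric]) (auto simp: Int_absorb1)
    then show ?thesis by (simp add: sum.distrib sum_distrib_left[symmetric] del: insert_iff)
  qed
  also have "\<dots> \<le> 8 * (B + B) + 8 * B * 2"
    using B col xy by (intro add_mono mult_left_mono) (auto simp: card_insert_if)
  finally show ?thesis by simp
qed

text \<open>
  An exchange of two positions moves the jumps by \<open>32 B\<close> in total, hence \<open>T\<close> by at most \<open>32 B L\<close>.
  The constant is \<open>4096 = 4 * 32\<^sup>2\<close>.
\<close>

lemma jump_statistic_variance:
  fixes m :: "nat \<Rightarrow> nat \<Rightarrow> 'v::real_normed_vector" and \<phi> :: "'v \<Rightarrow> real"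
  assumes anti: "\<And>u v. u \<in> {1..n} \<Longrightarrow> v \<in> {1..n} \<Longrightarrow> m u v = - m v u"
    and row: "\<And>u. u \<in> {1..n} \<Longrightarrow> (\<Sum>v\<in>{1..n}. norm (m u v)) \<le> B"
    and lip: "\<And>x y. norm x \<le> 2 * B \<Longrightarrow> norm y \<le> 2 * B \<Longrightarrow> \<bar>\<phi> x - \<phi> y\<bar> \<le> L * norm (x - y)" and L: "L \<ge> 0"
  defines "T \<equiv> \<lambda>p. \<Sum>ie\<in>moves n. \<phi> (jump n m ie p)"
  shows "(\<Sum>p | p permutes {1..n}. (T p - (\<Sum>p | p permutes {1..n}. T p) / fact n)\<^sup>2) / fact n
           \<le> 4096 * n * (B * L)\<^sup>2"
proof -
  have "\<bar>T (p \<circ> Transposition.transpose x y) - T p\<bar> \<le> 32 * B * L"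
    if p: "p permutes {1..n}" and xy: "x \<in> {1..n}" "y \<in> {1..n}" for p x y
  proof -
    let ?q = "p \<circ> Transposition.transpose x y"
    have q: "?q permutes {1..n}" using p xy by (simp add: permutes_compose permutes_swap_id)
    have "\<bar>T ?q - T p\<bar> \<le> (\<Sum>ie\<in>moves n. \<bar>\<phi> (jump n m ie ?q) - \<phi> (jump n m ie p)\<bar>)"
      unfolding T_def sum_subtractf[symmetric] by (rule sum_abs)
    also have "\<dots> \<le> (\<Sum>ie\<in>moves n. L * norm (jump n m ie ?q - jump n m ie p))"
      using norm_jump_le[of n m B, OF row p] norm_jump_le[of n m B, OF row q] by (intro sum_mono
          lip) auto
    also have "\<dots> \<le> L * (32 * B)"
      unfolding sum_distrib_left[symmetric] by (intro mult_left_mono sum_jump_swap_le anti row p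
          xy L)
    finally show ?thesis by (simp add: ac_simps)
  qed
  from permutation_variance_le[of "{1..n}" T "32 * B * L", OF _ this]
  have "(\<Sum>p | p permutes {1..n}. (T p - (\<Sum>p | p permutes {1..n}. T p) / fact n)\<^sup>2) \<le> 4 * (32 * B *
      L)\<^sup>2 * n * fact n"
    by simp
  then show ?thesis by (simp add: field_simps power2_eq_square)
qed

text \<open>
  Reversal of the permutation exchanges moves to the end with moves to the front and changes the
  sign of the jump.
\<close>

lemma odd_jump_statistic_mean_zero:
  fixes m :: "nat \<Rightarrow> nat \<Rightarrow> 'v::real_normed_vector" and \<phi> :: "'v \<Rightarrow> real"
  assumes odd: "\<And>x. \<phi> (- x) = - \<phi> x"
  shows "(\<Sum>p | p permutes {1..n}. \<Sum>ie\<in>moves n. \<phi> (jump n m ie p)) = 0"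
proof -
  define r where "r = (\<lambda>k. if k \<in> {1..n} then n + 1 - k else k)"
  have bij: "bij_betw r {1..n} {1..n}"
    by (rule bij_betw_byWitness[where f' = r]) (auto simp: r_def)
  have r: "r permutes {1..n}"
    by (rule bij_imp_permutes[OF bij]) (auto simp: r_def)
  let ?f = "\<lambda>ie. (r (fst ie), \<not> snd ie)"
  have bijf: "bij_betw ?f (moves n) (moves n)"
    by (rule bij_betw_byWitness[where f' = ?f]) (auto simp: r_def)
  have j: "jump n m ie (p \<circ> r) = - jump n m (?f ie) p" if "ie \<in> moves n" for ie p
  proof -
    have "jump n m ie (p \<circ> r) = (\<Sum>l\<in>{1..n}. jump_coeff ie (r l) *\<^sub>R m (p (r (fst ie))) (p l))"
      unfolding jump_def
      by (subst sum.permute[OF r]) (auto intro!: sum.cong simp: r_def)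
    also have "\<dots> = (\<Sum>l\<in>{1..n}. - (jump_coeff (?f ie) l *\<^sub>R m (p (r (fst ie))) (p l)))"
      using that by (intro sum.cong refl) (auto simp: jump_coeff_def r_def split: prod.splits)
    finally show ?thesis by (simp add: jump_def sum_negf)
  qed
  let ?T = "\<lambda>p. \<Sum>ie\<in>moves n. \<phi> (jump n m ie p)"
  have "(\<Sum>p | p permutes {1..n}. ?T p) = (\<Sum>p | p permutes {1..n}. ?T (p \<circ> r))"
    by (rule sum.reindex_bij_betw[OF bij_betw_compose_perm[OF r], symmetric])
  also have "\<dots> = (\<Sum>p | p permutes {1..n}. - ?T p)"
  proof (rule sum.cong[OF refl])
    fix p
    have "?T (p \<circ> r) = (\<Sum>ie\<in>moves n. - \<phi> (jump n m (?f ie) p))"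
      by (intro sum.cong refl) (simp add: j odd del: o_apply)
    also have "\<dots> = - ?T p" 
      using sum.reindex_bij_betw[OF bijf, of "\<lambda>ie. \<phi> (jump n m ie p)"] by (simp add: sum_negf)
    finally show "?T (p \<circ> r) = - ?T p" .
  qed
  finally show ?thesis by (simp add: sum_negf)
qed

section \<open>The standard Gaussian measure\<close>

definition gauss_density :: "real^'d \<Rightarrow> real" where
  "gauss_density x = (1 / sqrt (2 * pi)) ^ CARD('d) * exp (- (norm x)\<^sup>2 / 2)"

lemma gauss_density_eq_prod:
  fixes x :: "real^'d::finite"
  shows "(\<Prod>i\<in>UNIV. std_normal_density (x $ i)) = gauss_density x"
proof -
  have "(norm x)\<^sup>2 = (\<Sum>i\<in>UNIV. (x $ i)\<^sup>2)"
    by (simp add: inner_vec_def power2_eq_square dot_square_norm[symmetric, unfolded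
        power2_eq_square])
  then have "exp (- (norm x)\<^sup>2 / 2) = (\<Prod>i\<in>UNIV. exp (- (x $ i)\<^sup>2 / 2))"
    by (simp add: exp_sum[symmetric] sum_negf sum_divide_distrib)
  then show ?thesis
    by (simp add: gauss_density_def std_normal_density_def prod_dividef power_divide)
qed

lemma std_gaussian_eq: "std_gaussian = density lborel (\<lambda>x::real^'d::finite. ennreal (gauss_density
    x))"
  by (simp add: std_gaussian_def gauss_density_eq_prod)

lemma gauss_density_pos: "gauss_density x > 0"
  by (simp add: gauss_density_def)

lemma gauss_density_nonneg [simp]: "0 \<le> gauss_density x"
  using gauss_density_pos[of x] by simp

lemma continuous_gauss_density: "continuous_on S gauss_density"
  unfolding gauss_density_def by (intro continuous_intros) auto

lemma measurable_gauss_density [measurable]: "gauss_density \<in> borel_measurable borel"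
  by (rule borel_measurable_continuous_onI[OF continuous_gauss_density])

lemma sets_std_gaussian [simp, measurable_cong]: "sets std_gaussian = sets borel"
  and space_std_gaussian [simp]: "space std_gaussian = UNIV"
  by (simp_all add: std_gaussian_def)

lemma nn_integral_std_gaussian:
  fixes f :: "real^'d::finite \<Rightarrow> ennreal"
  assumes [measurable]: "f \<in> borel_measurable borel"
  shows "(\<integral>\<^sup>+x. f x \<partial>std_gaussian) = (\<integral>\<^sup>+x. ennreal (gauss_density x) * f x \<partial>lborel)"
  unfolding std_gaussian_eq by (subst nn_integral_density) auto

lemma integral_std_gaussian:
  fixes f :: "real^'d::finite \<Rightarrow> real"
  assumes [measurable]: "f \<in> borel_measurable borel"
  shows "(\<integral>x. f x \<partial>std_gaussian) = (\<integral>x. gauss_density x * f x \<partial>lborel)"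
  unfolding std_gaussian_eq by (subst integral_density) auto

interpretation gauss: prob_space "std_gaussian :: (real^'d::finite) measure"
proof
  have axis: "(\<Prod>i\<in>UNIV. f (x $ i)) = (\<Prod>b\<in>Basis. f (x \<bullet> b))" for f :: "real \<Rightarrow> real" and x ::
      "real^'d"
  proof -
    have B: "(Basis :: (real^'d) set) = range (\<lambda>i. axis i 1)" by (auto simp: Basis_vec_def)
    have inj: "inj (\<lambda>i. axis i (1::real) :: real^'d)" by (auto intro!: injI simp: axis_eq_axis)
    show ?thesis unfolding B prod.reindex[OF inj] by (simp add: cart_eq_inner_axis)
  qed
  have "emeasure std_gaussian (space (std_gaussian :: (real^'d) measure)) =
      (\<integral>\<^sup>+x. (\<Prod>b\<in>Basis. ennreal (std_normal_density (x \<bullet> b))) \<partial>(lborel :: (real^'d) measure))"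
    by (simp add: std_gaussian_def emeasure_density axis prod_ennreal del: space_std_gaussian)
  also have "\<dots> = (\<Prod>b\<in>(Basis::(real^'d) set). (\<integral>\<^sup>+u. ennreal (std_normal_density u) \<partial>lborel))"
    by (rule nn_integral_lborel_prod) auto
  also have "(\<integral>\<^sup>+u. ennreal (std_normal_density u) \<partial>lborel) = 1"
    by (simp add: nn_integral_eq_integral)
  finally show "emeasure std_gaussian (space (std_gaussian :: (real^'d) measure)) = 1" by simp
qed

lemma measure_std_gaussian_UNIV [simp]: "measure (std_gaussian :: (real^'d::finite) measure) UNIV
    = 1"
  using gauss.prob_space by (simp only: space_std_gaussian)

lemma nn_integral_lborel_affine:
  fixes f :: "'a::euclidean_space \<Rightarrow> ennreal" and t :: 'a
  assumes [measurable]: "f \<in> borel_measurable borel" and c: "c \<noteq> 0"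
  shows "(\<integral>\<^sup>+x. f x \<partial>lborel) = ennreal (\<bar>c\<bar> ^ DIM('a)) * (\<integral>\<^sup>+x. f (t + c *\<^sub>R x) \<partial>lborel)"
  by (subst lborel_affine[OF c, of t])
     (simp add: nn_integral_density nn_integral_distr nn_integral_cmult ennreal_power)

lemma integral_lborel_affine:
  fixes f :: "'a::euclidean_space \<Rightarrow> real" and t :: 'a
  assumes [measurable]: "f \<in> borel_measurable borel" and c: "c \<noteq> 0"
  shows "(\<integral>x. f x \<partial>lborel) = \<bar>c\<bar> ^ DIM('a) * (\<integral>x. f (t + c *\<^sub>R x) \<partial>lborel)"
  by (subst lborel_affine[OF c, of t])
     (simp add: integral_density integral_distr)

text \<open>
  The density of the standard Gaussian measure shifted by \<open>v\<close> with respect to the unshifted one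
  (Cameron and Martin).
\<close>

definition shift_weight :: "'a::real_inner \<Rightarrow> 'a \<Rightarrow> real" where
  "shift_weight v z = exp (v \<bullet> z - (norm v)\<^sup>2 / 2)"

lemma measurable_shift_weight [measurable]:
  "shift_weight (v :: 'a::euclidean_space) \<in> borel_measurable borel"
  unfolding shift_weight_def by measurable

lemma gauss_density_diff: "gauss_density (x - v) = gauss_density x * shift_weight v x"
proof -
  have "(norm (x - v))\<^sup>2 = (norm x)\<^sup>2 - 2 * (v \<bullet> x) + (norm v)\<^sup>2"
    by (simp add: inner_diff_left inner_diff_right inner_commute flip: dot_square_norm)
  then have "- (norm (x - v))\<^sup>2 / 2 = - (norm x)\<^sup>2 / 2 + (v \<bullet> x - (norm v)\<^sup>2 / 2)" by simp
  then show ?thesis by (simp only: gauss_density_def shift_weight_def exp_add mult.assoc)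
qed

lemma integral_std_gaussian_shift:
  fixes f :: "real^'d::finite \<Rightarrow> real"
  assumes [measurable]: "f \<in> borel_measurable borel"
  shows "(\<integral>z. f (z + v) \<partial>std_gaussian) = (\<integral>z. f z * shift_weight v z \<partial>std_gaussian)"
proof -
  have "(\<integral>z. f z * shift_weight v z \<partial>std_gaussian) = (\<integral>z. gauss_density (z - v) * f z \<partial>lborel)"
    by (subst integral_std_gaussian) (auto simp: gauss_density_diff ac_simps)
  also have "\<dots> = (\<integral>z. gauss_density z * f (z + v) \<partial>lborel)"
    by (subst integral_lborel_affine[where c = 1 and t = v]) (auto simp: add.commute)
  also have "\<dots> = (\<integral>z. f (z + v) \<partial>std_gaussian)" by (subst integral_std_gaussian) auto
  finally show ?thesis ..
qed

lemma integral_std_gaussian_uminus: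
  fixes f :: "real^'d::finite \<Rightarrow> real"
  assumes [measurable]: "f \<in> borel_measurable borel"
  shows "(\<integral>z. f (- z) \<partial>std_gaussian) = (\<integral>z. f z \<partial>std_gaussian)"
  apply (subst (1 2) integral_std_gaussian, measurable)
  apply (subst integral_lborel_affine[where c = "-1" and t = 0])
  apply (auto simp: gauss_density_def)
  done

lemma integral_std_gaussian_odd:
  fixes f :: "real^'d::finite \<Rightarrow> real"
  assumes "f \<in> borel_measurable borel" "\<And>z. f (- z) = - f z"
  shows "(\<integral>z. f z \<partial>std_gaussian) = 0"
  using integral_std_gaussian_uminus[OF assms(1)] assms(2) by simp

text \<open>
  Half of the quadratic exponent absorbs the linear one, as \<open>t |z| \<le> |z|\<^sup>2/4 + t\<^sup>2\<close>; what is left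
  is a Gaussian density of variance \<open>2\<close>.
\<close>

lemma integrable_exp_norm:
  "integrable std_gaussian (\<lambda>z::real^'d::finite. exp (t * norm z))"
proof (rule integrableI_bounded)
  have le: "gauss_density z * exp (t * norm z) \<le> exp (t\<^sup>2) * gauss_density (z /\<^sub>R sqrt 2)" for z
      :: "real^'d"
  proof -
    have "0 \<le> (norm z / 2 - t)\<^sup>2" by simp
    then have "t * norm z - (norm z)\<^sup>2 / 2 \<le> t\<^sup>2 - (norm (z /\<^sub>R sqrt 2))\<^sup>2 / 2"
      by (simp add: power2_eq_square field_simps)
    then have "exp (- (norm z)\<^sup>2 / 2) * exp (t * norm z) \<le> exp (t\<^sup>2) * exp (- (norm (z /\<^sub>R sqrt
        2))\<^sup>2 / 2)"
      unfolding exp_add[symmetric] by simp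
    then have "(1 / sqrt (2 * pi)) ^ CARD('d) * (exp (- (norm z)\<^sup>2 / 2) * exp (t * norm z))
        \<le> (1 / sqrt (2 * pi)) ^ CARD('d) * (exp (t\<^sup>2) * exp (- (norm (z /\<^sub>R sqrt 2))\<^sup>2 / 2))"
      by (intro mult_left_mono) auto
    then show ?thesis by (simp add: gauss_density_def ac_simps)
  qed
  have "(\<integral>\<^sup>+z. ennreal (norm (exp (t * norm z))) \<partial>(std_gaussian :: (real^'d) measure))
      = (\<integral>\<^sup>+z. ennreal (gauss_density z * exp (t * norm z)) \<partial>(lborel :: (real^'d) measure))"
    by (subst nn_integral_std_gaussian) (auto simp: ennreal_mult)
  also have "\<dots> \<le> (\<integral>\<^sup>+z. ennreal (exp (t\<^sup>2)) * ennreal (gauss_density (z /\<^sub>R sqrt 2)) \<partial>(lborel ::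
      (real^'d) measure))"
    using le by (intro nn_integral_mono) (simp add: ennreal_mult[symmetric] ennreal_leI)
  also have "\<dots> = ennreal (exp (t\<^sup>2)) * (\<integral>\<^sup>+z. ennreal (gauss_density (z /\<^sub>R sqrt 2)) \<partial>(lborel ::
      (real^'d) measure))"
    by (subst nn_integral_cmult) auto
  also have "(\<integral>\<^sup>+z. ennreal (gauss_density (z /\<^sub>R sqrt 2)) \<partial>(lborel :: (real^'d) measure))
      = ennreal (sqrt 2 ^ CARD('d)) * (\<integral>\<^sup>+z. ennreal (gauss_density z) \<partial>(lborel :: (real^'d)
          measure))"
    by (subst nn_integral_lborel_affine[where c = "sqrt 2" and t = 0]) auto
  also have "(\<integral>\<^sup>+z. ennreal (gauss_density z) \<partial>(lborel :: (real^'d) measure)) = 1"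
    using gauss.emeasure_space_1[where 'd = 'd] by (simp add: std_gaussian_eq emeasure_density)
  finally show "(\<integral>\<^sup>+z. ennreal (norm (exp (t * norm z))) \<partial>(std_gaussian :: (real^'d) measure)) < \<infinity>"
    by (auto simp: ennreal_mult[symmetric] intro: le_less_trans)
qed measurable

lemma integrable_exp_bounded:
  fixes f :: "real^'d::finite \<Rightarrow> real"
  assumes [measurable]: "f \<in> borel_measurable borel" and "\<And>z. \<bar>f z\<bar> \<le> C * exp (t * norm z)"
  shows "integrable std_gaussian f"
proof (rule Bochner_Integration.integrable_bound)
  show "integrable std_gaussian (\<lambda>z::real^'d. C * exp (t * norm z))"
    by (intro integrable_mult_right integrable_exp_norm)
  show "AE z in std_gaussian. norm (f z) \<le> norm (C * exp (t * norm z))"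
    using order_trans[OF assms(2) abs_ge_self] by simp
qed measurable

text \<open>
  Stability of the Gaussian law: \<open>c Z' + \<sigma> Z\<close> has the law of \<open>Z\<close>.  Completing the square,
  \<open>|w|\<^sup>2 + |y - c w|\<^sup>2/\<sigma>\<^sup>2\<close> is symmetric in \<open>w\<close> and \<open>y\<close>, so the joint density at \<open>(w, y)\<close> factors
  with the roles of the two variables exchanged.
\<close>

lemma std_gaussian_mixture:
  fixes A :: "(real^'d::finite) set"
  assumes [measurable]: "A \<in> sets borel" and cs: "c\<^sup>2 + \<sigma>\<^sup>2 = 1" "\<sigma> > 0"
  shows "(\<integral>z. measure std_gaussian {w. c *\<^sub>R w + \<sigma> *\<^sub>R z \<in> A} \<partial>std_gaussian) = measure
      std_gaussian A"
proof -
  let ?f = "indicator A :: real^'d \<Rightarrow> ennreal"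
  have sq: "gauss_density w * gauss_density ((y - c *\<^sub>R w) /\<^sub>R \<sigma>) = gauss_density y *
      gauss_density ((w - c *\<^sub>R y) /\<^sub>R \<sigma>)"
    for w y :: "real^'d"
  proof -
    have nsq: "(norm (u /\<^sub>R \<sigma>))\<^sup>2 = (u \<bullet> u) / \<sigma>\<^sup>2" for u :: "real^'d"
      using cs by (simp add: dot_square_norm power_mult_distrib divide_simps)
    have "\<sigma>\<^sup>2 * (w \<bullet> w) + (y - c *\<^sub>R w) \<bullet> (y - c *\<^sub>R w)
        = (c\<^sup>2 + \<sigma>\<^sup>2) * (w \<bullet> w) + (y \<bullet> y) - 2 * c * (w \<bullet> y)"
      by (simp add: inner_diff_left inner_diff_right inner_commute power2_eq_square algebra_simps)
    also have "\<dots> = (w \<bullet> w) + (c\<^sup>2 + \<sigma>\<^sup>2) * (y \<bullet> y) - 2 * c * (w \<bullet> y)" using cs by simp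
    also have "\<dots> = \<sigma>\<^sup>2 * (y \<bullet> y) + (w - c *\<^sub>R y) \<bullet> (w - c *\<^sub>R y)"
      by (simp add: inner_diff_left inner_diff_right inner_commute power2_eq_square algebra_simps)
    finally have "(norm w)\<^sup>2 + (norm ((y - c *\<^sub>R w) /\<^sub>R \<sigma>))\<^sup>2 = (norm y)\<^sup>2 + (norm ((w - c *\<^sub>R y)
        /\<^sub>R \<sigma>))\<^sup>2"
      unfolding nsq using cs by (simp add: dot_square_norm[symmetric] field_simps)
    then have "- (norm w)\<^sup>2 / 2 + - (norm ((y - c *\<^sub>R w) /\<^sub>R \<sigma>))\<^sup>2 / 2 = - (norm y)\<^sup>2 / 2 + -
        (norm ((w - c *\<^sub>R y) /\<^sub>R \<sigma>))\<^sup>2 / 2"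
      by argo
    then have "exp (- (norm w)\<^sup>2 / 2) * exp (- (norm ((y - c *\<^sub>R w) /\<^sub>R \<sigma>))\<^sup>2 / 2)
        = exp (- (norm y)\<^sup>2 / 2) * exp (- (norm ((w - c *\<^sub>R y) /\<^sub>R \<sigma>))\<^sup>2 / 2)"
      unfolding exp_add[symmetric] by simp
    then show ?thesis by (simp add: gauss_density_def)
  qed
  have scale: "(\<integral>\<^sup>+y. f y * ennreal (gauss_density ((y - a) /\<^sub>R \<sigma>)) \<partial>lborel)
      = ennreal (\<sigma> ^ CARD('d)) * (\<integral>\<^sup>+z. f (a + \<sigma> *\<^sub>R z) \<partial>std_gaussian)"
    if [measurable]: "f \<in> borel_measurable borel" for f and a :: "real^'d"
  proof -
    have "(\<integral>\<^sup>+y. f y * ennreal (gauss_density ((y - a) /\<^sub>R \<sigma>)) \<partial>lborel)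
      = ennreal (\<bar>\<sigma>\<bar> ^ DIM(real^'d)) * (\<integral>\<^sup>+z. f (a + \<sigma> *\<^sub>R z) * ennreal (gauss_density (((a + \<sigma>
          *\<^sub>R z) - a) /\<^sub>R \<sigma>)) \<partial>lborel)"
      using cs by (intro nn_integral_lborel_affine) auto
    then show ?thesis
      using cs by (simp add: nn_integral_std_gaussian mult.commute)
  qed
  interpret GG: pair_sigma_finite "std_gaussian :: (real^'d) measure" "std_gaussian :: (real^'d)
      measure" ..
  let ?s = "ennreal (\<sigma> ^ CARD('d))"
  have "(\<integral>\<^sup>+z. emeasure std_gaussian {w. c *\<^sub>R w + \<sigma> *\<^sub>R z \<in> A} \<partial>std_gaussian)
      = (\<integral>\<^sup>+z. (\<integral>\<^sup>+w. ?f (c *\<^sub>R w + \<sigma> *\<^sub>R z) \<partial>std_gaussian) \<partial>std_gaussian)"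
  proof (rule nn_integral_cong)
    fix z :: "real^'d"
    have "{w. c *\<^sub>R w + \<sigma> *\<^sub>R z \<in> A} \<in> sets borel" by measurable
    moreover have "?f (c *\<^sub>R w + \<sigma> *\<^sub>R z) = indicator {w. c *\<^sub>R w + \<sigma> *\<^sub>R z \<in> A} w" for w
      by (simp add: indicator_def)
    ultimately show "emeasure std_gaussian {w. c *\<^sub>R w + \<sigma> *\<^sub>R z \<in> A} = (\<integral>\<^sup>+w. ?f (c *\<^sub>R w + \<sigma> *\<^sub>R
        z) \<partial>std_gaussian)"
      by simp
  qed
  also have "\<dots> = (\<integral>\<^sup>+w. (\<integral>\<^sup>+z. ?f (c *\<^sub>R w + \<sigma> *\<^sub>R z) \<partial>std_gaussian) \<partial>std_gaussian)"
    by (rule GG.Fubini') measurable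
  finally have 1: "(\<integral>\<^sup>+z. emeasure std_gaussian {w. c *\<^sub>R w + \<sigma> *\<^sub>R z \<in> A} \<partial>std_gaussian) = \<dots>" .
  have "?s * \<dots> = (\<integral>\<^sup>+w. ?s * (\<integral>\<^sup>+z. ?f (c *\<^sub>R w + \<sigma> *\<^sub>R z) \<partial>std_gaussian) \<partial>std_gaussian)"
    by (rule nn_integral_cmult[symmetric]) measurable
  also have "\<dots> = (\<integral>\<^sup>+w. (\<integral>\<^sup>+y. ?f y * ennreal (gauss_density ((y - c *\<^sub>R w) /\<^sub>R \<sigma>)) \<partial>lborel)
      \<partial>std_gaussian)"
    by (intro nn_integral_cong scale[symmetric]) measurable
  also have "\<dots> = (\<integral>\<^sup>+w. ennreal (gauss_density w) * (\<integral>\<^sup>+y. ?f y * ennreal (gauss_density ((y - c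
      *\<^sub>R w) /\<^sub>R \<sigma>)) \<partial>lborel) \<partial>lborel)"
    by (rule nn_integral_std_gaussian) measurable
  also have "\<dots> = (\<integral>\<^sup>+w. (\<integral>\<^sup>+y. ennreal (gauss_density w) * (?f y * ennreal (gauss_density ((y - c
      *\<^sub>R w) /\<^sub>R \<sigma>))) \<partial>lborel) \<partial>lborel)"
    by (intro nn_integral_cong nn_integral_cmult[symmetric]) measurable
  also have "\<dots> = (\<integral>\<^sup>+w. (\<integral>\<^sup>+y. (?f y * ennreal (gauss_density y)) * ennreal (gauss_density ((w - c
      *\<^sub>R y) /\<^sub>R \<sigma>)) \<partial>lborel) \<partial>lborel)"
  proof (intro nn_integral_cong)
    fix w y :: "real^'d"
    have "ennreal (gauss_density w) * ennreal (gauss_density ((y - c *\<^sub>R w) /\<^sub>R \<sigma>))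
        = ennreal (gauss_density y) * ennreal (gauss_density ((w - c *\<^sub>R y) /\<^sub>R \<sigma>))"
      by (simp only: ennreal_mult[symmetric] gauss_density_nonneg sq)
    then show "ennreal (gauss_density w) * (?f y * ennreal (gauss_density ((y - c *\<^sub>R w) /\<^sub>R \<sigma>)))
        = (?f y * ennreal (gauss_density y)) * ennreal (gauss_density ((w - c *\<^sub>R y) /\<^sub>R \<sigma>))"
      by (simp only: mult.left_commute[of _ "?f y"] mult.assoc)
  qed
  also have "\<dots> = (\<integral>\<^sup>+y. (\<integral>\<^sup>+w. (?f y * ennreal (gauss_density y)) * ennreal (gauss_density ((w - c
      *\<^sub>R y) /\<^sub>R \<sigma>)) \<partial>lborel) \<partial>lborel)"
    by (rule lborel_pair.Fubini'[symmetric]) measurable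
  also have "\<dots> = (\<integral>\<^sup>+y. (?f y * ennreal (gauss_density y)) * ?s \<partial>lborel)"
  proof (intro nn_integral_cong)
    fix y :: "real^'d"
    have "(\<integral>\<^sup>+w. (?f y * ennreal (gauss_density y)) * ennreal (gauss_density ((w - c *\<^sub>R y) /\<^sub>R
        \<sigma>)) \<partial>lborel)
        = (?f y * ennreal (gauss_density y)) * (\<integral>\<^sup>+w. 1 * ennreal (gauss_density ((w - c *\<^sub>R y)
            /\<^sub>R \<sigma>)) \<partial>lborel)"
      by (subst nn_integral_cmult) auto
    also have "(\<integral>\<^sup>+w. 1 * ennreal (gauss_density ((w - c *\<^sub>R y) /\<^sub>R \<sigma>)) \<partial>lborel) = ?s"
      using scale[of "\<lambda>_. 1" "c *\<^sub>R y"] gauss.emeasure_space_1[where 'd = 'd] by simp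
    finally show "(\<integral>\<^sup>+w. (?f y * ennreal (gauss_density y)) * ennreal (gauss_density ((w - c *\<^sub>R
        y) /\<^sub>R \<sigma>)) \<partial>lborel)
        = (?f y * ennreal (gauss_density y)) * ?s" .
  qed
  also have "\<dots> = ?s * emeasure std_gaussian A"
    by (subst nn_integral_multc)
       (auto simp: std_gaussian_eq emeasure_density mult.commute)
  finally have "(\<integral>\<^sup>+w. (\<integral>\<^sup>+z. ?f (c *\<^sub>R w + \<sigma> *\<^sub>R z) \<partial>std_gaussian) \<partial>std_gaussian) = emeasure
      std_gaussian A"
    using cs by (subst (asm) ennreal_mult_cancel_left) auto
  with 1 have 2: "(\<integral>\<^sup>+z. emeasure std_gaussian {w. c *\<^sub>R w + \<sigma> *\<^sub>R z \<in> A} \<partial>std_gaussian) =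
      emeasure std_gaussian A"
    by simp
  have "(\<integral>z. measure std_gaussian {w. c *\<^sub>R w + \<sigma> *\<^sub>R z \<in> A} \<partial>std_gaussian)
      = enn2real (\<integral>\<^sup>+z. ennreal (measure std_gaussian {w. c *\<^sub>R w + \<sigma> *\<^sub>R z \<in> A}) \<partial>std_gaussian)"
    by (intro integral_eq_nn_integral) auto
  also have "\<dots> = measure std_gaussian A"
    using 2 by (simp add: gauss.emeasure_eq_measure)
  finally show ?thesis .
qed

section \<open>Gaussian measure near the boundary of a convex set\<close>

text \<open>
  The translates of \<open>S\<close> by \<open>-k u\<close> with \<open>k < m\<close> are disjoint.  Each has at least \<open>exp (-1/2)\<close> times
  the measure of \<open>S\<close>, because the shift has length at most one and is opposite to a direction in
  which every point of \<open>S\<close> has a nonnegative component.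
\<close>

lemma disjoint_translates_measure:
  fixes S :: "(real^'d::finite) set"
  assumes [measurable]: "S \<in> sets borel" and pos: "\<And>x. x \<in> S \<Longrightarrow> 0 \<le> u \<bullet> x"
    and disj: "\<And>x k. x \<in> S \<Longrightarrow> x + real (Suc k) *\<^sub>R u \<notin> S" and m: "real m * norm u \<le> 1"
  shows "real m * (exp (- 1/2) * measure std_gaussian S) \<le> 1"
proof -
  define E where "E = (\<lambda>k::nat. {y. y + real k *\<^sub>R u \<in> S})"
  have [measurable]: "E k \<in> sets borel" for k unfolding E_def by measurable
  have ge: "exp (- 1/2) * measure std_gaussian S \<le> measure std_gaussian (E k)" if k: "k < m" for k
  proof -
    have int: "integrable std_gaussian (\<lambda>z. indicator S z * shift_weight (real k *\<^sub>R u) z)"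
    proof (rule integrable_exp_bounded[where C = 1 and t = "norm (real k *\<^sub>R u)"])
      fix z :: "real^'d"
      have "(real k *\<^sub>R u) \<bullet> z \<le> norm (real k *\<^sub>R u) * norm z" by (rule norm_cauchy_schwarz)
      then have "shift_weight (real k *\<^sub>R u) z \<le> exp (norm (real k *\<^sub>R u) * norm z)"
        unfolding shift_weight_def exp_le_cancel_iff using zero_le_power2[of "norm (real k *\<^sub>R
            u)"] by linarith
      then show "\<bar>indicator S z * shift_weight (real k *\<^sub>R u) z\<bar> \<le> 1 * exp (norm (real k *\<^sub>R u) *
          norm z)"
        by (simp add: indicator_def shift_weight_def)
    qed measurable
    have "exp (- 1/2) * measure std_gaussian S = (\<integral>z. exp (- 1/2) * indicator S z \<partial>std_gaussian)"
      by simp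
    also have "\<dots> \<le> (\<integral>z. indicator S z * shift_weight (real k *\<^sub>R u) z \<partial>std_gaussian)"
    proof (rule integral_mono[OF _ int])
      fix z :: "real^'d"
      have "real k * norm u \<le> real m * norm u" using k by (intro mult_right_mono) auto
      then have "(norm (real k *\<^sub>R u))\<^sup>2 \<le> 1" using m by (intro power_le_one) auto
      moreover have "0 \<le> (real k *\<^sub>R u) \<bullet> z" if "z \<in> S" using pos[OF that] by simp
      ultimately show "exp (- 1/2) * indicator S z \<le> indicator S z * shift_weight (real k *\<^sub>R u) z"
        by (auto simp: indicator_def shift_weight_def)
    qed (intro integrable_mult_right integrable_real_indicator; simp add: gauss.emeasure_eq_measure)
    also have "\<dots> = (\<integral>z. indicator S (z + real k *\<^sub>R u) \<partial>std_gaussian)"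
      by (rule integral_std_gaussian_shift[symmetric]) measurable
    also have "\<dots> = (\<integral>z. indicator (E k) z \<partial>std_gaussian)"
      by (intro Bochner_Integration.integral_cong) (auto simp: E_def indicator_def)
    finally show ?thesis by simp
  qed
  have lt: "E k \<inter> E l = {}" if "k < l" for k l
  proof (rule equals0I)
    fix y assume "y \<in> E k \<inter> E l"
    then have y: "y + real k *\<^sub>R u \<in> S" "y + real l *\<^sub>R u \<in> S" by (auto simp: E_def)
    have "real k + real (Suc (l - Suc k)) = real l" using that by simp
    then have "y + real k *\<^sub>R u + real (Suc (l - Suc k)) *\<^sub>R u = y + real l *\<^sub>R u"
      by (metis add.assoc scaleR_add_left)
    then show False using disj[OF y(1), of "l - Suc k"] y(2) by metis
  qed
  have "disjoint_family_on E {..<m}"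
    unfolding disjoint_family_on_def using lt by (metis Int_commute nat_neq_iff)
  then have "measure std_gaussian (\<Union>k<m. E k) = (\<Sum>k<m. measure std_gaussian (E k))"
    by (intro gauss.finite_measure_finite_Union) auto
  moreover have "(\<Sum>k<m. exp (- 1/2) * measure std_gaussian S) \<le> (\<Sum>k<m. measure std_gaussian (E k))"
    by (intro sum_mono ge) simp
  ultimately show ?thesis using gauss.prob_le_1[of "\<Union>k<m. E k"] by simp
qed

text \<open>
  A line parallel to \<open>v\<close> leaves a convex set only once, so the set of points from which the step
  \<open>v\<close> leads out of \<open>K\<close> is disjoint from its translates by multiples of \<open>v\<close>.  About \<open>1 / |v|\<close> of
  these translates have a measure comparable to that of the set, once it is split by the sign of
  \<open>v \<bullet> x\<close> so that the direction of translation can be chosen accordingly.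
\<close>

lemma convex_exit_measure:
  fixes K :: "(real^'d::finite) set"
  assumes K: "convex K" and [measurable]: "K \<in> sets borel"
  shows "measure std_gaussian {x \<in> K. x + v \<notin> K} \<le> 8 * norm v"
proof -
  let ?B = "{x \<in> K. x + v \<notin> K}"
  consider "v = 0" | "1 \<le> norm v" | "v \<noteq> 0" "norm v < 1" by force
  then show ?thesis
  proof cases
    case 2
    then show ?thesis using gauss.prob_le_1[of ?B] by linarith
  next
    case 3
    \<comment> \<open>As many steps as fit into length one; since \<open>|v| < 1\<close>, they cover at least half of it.\<close>
    define m where "m = nat \<lfloor>1 / norm v\<rfloor>"
    have nv: "norm v > 0" using 3 by simp
    have m: "real m * norm v \<le> 1"
    proof -
      have "real m \<le> 1 / norm v" using nv by (simp add: m_def)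
      then show ?thesis using nv by (simp add: field_simps)
    qed
    have m2: "1 / 2 \<le> real m * norm v"
    proof -
      have "1 \<le> 1 / norm v" using 3 nv by simp
      moreover have "x / 2 \<le> real (nat \<lfloor>x\<rfloor>)" if "1 \<le> x" for x :: real
      proof -
        have "1 \<le> \<lfloor>x\<rfloor>" using that by simp
        then have "real (nat \<lfloor>x\<rfloor>) = real_of_int \<lfloor>x\<rfloor>" "1 \<le> real_of_int \<lfloor>x\<rfloor>" by auto
        then show ?thesis using floor_correct[of x] by linarith
      qed
      ultimately have "1 / norm v / 2 \<le> real m" unfolding m_def by blast
      then show ?thesis using nv by (simp add: field_simps)
    qed
    have no_return: False if "x \<in> K" "x + v \<notin> K" "x + real (Suc k) *\<^sub>R v \<in> K" for x k
    proof -
      have "(1 - 1 / real (Suc k)) *\<^sub>R x + (1 / real (Suc k)) *\<^sub>R (x + real (Suc k) *\<^sub>R v) \<in> K"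
        using K that by (intro convexD) auto
      moreover have "(1 - 1 / real (Suc k)) *\<^sub>R x + (1 / real (Suc k)) *\<^sub>R (x + real (Suc k) *\<^sub>R
          v) = x + v"
        by (simp add: algebra_simps del: of_nat_Suc) 
      ultimately show False using that by simp
    qed
    let ?P = "{x \<in> ?B. 0 \<le> v \<bullet> x}" and ?N = "{x \<in> ?B. 0 \<le> (- v) \<bullet> x}"
    have meas: "?P \<in> sets borel" "?N \<in> sets borel" by measurable
    have P: "real m * (exp (- 1/2) * measure std_gaussian ?P) \<le> 1"
      by (rule disjoint_translates_measure[where u = v]) (use m meas no_return in auto)
    have N: "real m * (exp (- 1/2) * measure std_gaussian ?N) \<le> 1"
    proof (rule disjoint_translates_measure[where u = "- v"])
      fix x k assume x: "x \<in> ?N"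
      show "x + real (Suc k) *\<^sub>R - v \<notin> ?N"
      proof
        assume y: "x + real (Suc k) *\<^sub>R - v \<in> ?N"
        have "x + real (Suc k) *\<^sub>R - v + real (Suc k) *\<^sub>R v = x" by simp
        then show False using no_return[of "x + real (Suc k) *\<^sub>R - v" k] x y by force
      qed
    qed (use m meas in auto)
    have "?B = ?P \<union> ?N" by auto
    then have "measure std_gaussian ?B = measure std_gaussian (?P \<union> ?N)" by (rule arg_cong)
    also have "\<dots> \<le> measure std_gaussian ?P + measure std_gaussian ?N"
      using meas unfolding sets_std_gaussian[symmetric] by (rule measure_Un_le)
    finally have "measure std_gaussian ?B \<le> measure std_gaussian ?P + measure std_gaussian ?N" .
    then have "real m * (exp (- 1/2) * measure std_gaussian ?B)
        \<le> real m * (exp (- 1/2) * (measure std_gaussian ?P + measure std_gaussian ?N))"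
      by (intro mult_left_mono) auto
    also have "\<dots> \<le> 2" using P N by (simp add: distrib_left)
    finally have "exp (- 1/2) * (real m * measure std_gaussian ?B) \<le> 2" by (simp add: ac_simps)
    then have "real m * measure std_gaussian ?B \<le> 2 * exp (1/2)"
      by (simp add: exp_minus field_simps)
    also have "exp (1/2 :: real) \<le> 2"
    proof -
      have "(exp (1/2 :: real))\<^sup>2 = exp 1" by (simp add: power2_eq_square exp_add[symmetric])
      also have "\<dots> \<le> 2\<^sup>2" using exp_le by simp
      finally show ?thesis by (rule power2_le_imp_le) simp
    qed
    finally have "real m * measure std_gaussian ?B * norm v \<le> 4 * norm v"
      using nv by (intro mult_right_mono) auto
    moreover have "1 / 2 * measure std_gaussian ?B \<le> real m * norm v * measure std_gaussian ?B"
      using m2 by (intro mult_right_mono) auto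
    ultimately show ?thesis by (simp add: ac_simps)
  qed simp
qed

text \<open>
  Open neighbourhoods are used for both: \<open>thicken A r\<close> is then open and \<open>erode A r\<close> closed for
  every \<open>A\<close>, so both are Borel sets.
\<close>

definition thicken :: "'a::metric_space set \<Rightarrow> real \<Rightarrow> 'a set" where
  "thicken A r = (\<Union>y\<in>A. ball y r)"

definition erode :: "'a::metric_space set \<Rightarrow> real \<Rightarrow> 'a set" where
  "erode A r = {x. ball x r \<subseteq> A}"

lemma open_thicken: "open (thicken A r)"
  by (auto simp: thicken_def)

lemma erode_eq_Compl: "erode A r = - thicken (- A) r"
  by (auto simp: erode_def thicken_def dist_commute subset_eq)

lemma closed_erode: "closed (erode A r)"
  using open_thicken by (simp add: erode_eq_Compl closed_def)

lemma thicken_in_borel [measurable]: "thicken A r \<in> sets borel"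
  and erode_in_borel [measurable]: "erode A r \<in> sets borel"
  using borel_open[OF open_thicken] borel_closed[OF closed_erode] by blast+

lemma convex_thicken:
  fixes A :: "'a::real_normed_vector set"
  assumes "convex A"
  shows "convex (thicken A r)"
proof -
  have "thicken A r = (\<Union>x\<in>A. \<Union>y\<in>ball 0 r. {x + y})"
  proof safe
    fix z assume "z \<in> thicken A r"
    then obtain y where "y \<in> A" "norm (y - z) < r" by (auto simp: thicken_def dist_norm)
    then show "z \<in> (\<Union>x\<in>A. \<Union>y\<in>ball 0 r. {x + y})"
      by (intro UN_I[of y] UN_I[of "z - y"]) (auto simp: norm_minus_commute)
  next
    fix x y :: 'a assume "x \<in> A" "y \<in> ball 0 r"
    then show "x + y \<in> thicken A r" by (auto simp: thicken_def dist_norm intro!: bexI[of _ x])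
  qed
  then show ?thesis using convex_sums[OF assms convex_ball[of 0 r]] by simp
qed

lemma convex_erode:
  fixes A :: "'a::real_normed_vector set"
  assumes "convex A"
  shows "convex (erode A r)"
proof (rule convexI)
  fix x y :: 'a and u v :: real
  assume x: "x \<in> erode A r" and y: "y \<in> erode A r" and uv: "0 \<le> u" "0 \<le> v" "u + v = 1"
  have "z \<in> A" if z: "dist (u *\<^sub>R x + v *\<^sub>R y) z < r" for z
  proof -
    define w where "w = z - (u *\<^sub>R x + v *\<^sub>R y)"
    have "norm w < r" using z by (simp add: w_def dist_norm norm_minus_commute)
    then have "x + w \<in> A" "y + w \<in> A" using x y by (auto simp: erode_def subset_eq dist_norm)
    then have "u *\<^sub>R (x + w) + v *\<^sub>R (y + w) \<in> A" using assms uv by (intro convexD)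
    moreover have "u *\<^sub>R (x + w) + v *\<^sub>R (y + w) = u *\<^sub>R x + v *\<^sub>R y + (u + v) *\<^sub>R w"
      by (simp add: algebra_simps)
    ultimately show ?thesis using uv by (simp add: w_def)
  qed
  then show "u *\<^sub>R x + v *\<^sub>R y \<in> erode A r" by (auto simp: erode_def)
qed

lemma erode_subset: "r > 0 \<Longrightarrow> erode A r \<subseteq> A"
  and subset_thicken: "r > 0 \<Longrightarrow> A \<subseteq> thicken A r"
  by (auto simp: erode_def thicken_def subset_eq intro: bexI[rotated])

text \<open>
  Near \<open>x\<close> there is a point \<open>y\<close> outside \<open>A\<close>; separate it from \<open>A\<close> by a hyperplane with normal \<open>a\<close>.
  Some coordinate of \<open>a\<close> is at least \<open>|a| / d\<close> in absolute value, and a step of length \<open>2 d r\<close> in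
  this coordinate direction ends at least \<open>r\<close> beyond the hyperplane, where \<open>thicken A r\<close> does not
  reach.
\<close>

lemma convex_boundary_layer_cover:
  fixes A :: "(real^'d::finite) set" and r :: real
  assumes A: "convex A" and r: "r > 0" and x: "x \<in> thicken A r - erode A r"
  obtains i and s :: real where "s \<in> {1, -1}" "x + (s * (2 * CARD('d) * r)) *\<^sub>R axis i 1 \<notin> thicken
      A r"
proof -
  obtain y where y: "y \<notin> A" "dist x y < r" using x by (auto simp: erode_def subset_eq)
  obtain a where a: "a \<noteq> 0" "\<And>z. z \<in> A \<Longrightarrow> a \<bullet> z \<le> a \<bullet> y"
    using separating_hyperplane_sets[OF A convex_singleton[of y]] x y by (force simp: thicken_def)
  have na: "norm a > 0" using a by simp
  have "\<exists>i. norm a \<le> CARD('d) * \<bar>a $ i\<bar>"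
  proof (rule ccontr)
    assume "\<not> ?thesis"
    then have "CARD('d) * \<bar>a $ i\<bar> < norm a" for i by (auto simp: not_le)
    then have "(\<Sum>i\<in>UNIV. CARD('d) * \<bar>a $ i\<bar>) < (\<Sum>i\<in>(UNIV::'d set). norm a)"
      by (intro sum_strict_mono) auto
    then have "(\<Sum>i\<in>UNIV. \<bar>a $ i\<bar>) < norm a" by (simp add: sum_distrib_left[symmetric])
    then show False using norm_le_l1_cart[of a] by linarith
  qed
  then obtain i where i: "norm a \<le> CARD('d) * \<bar>a $ i\<bar>" by blast
  define s where "s = (if a $ i \<ge> 0 then 1 else - 1 :: real)"
  let ?x' = "x + (s * (2 * CARD('d) * r)) *\<^sub>R axis i 1"
  have "?x' \<notin> thicken A r"
  proof
    assume "?x' \<in> thicken A r"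
    then obtain z where z: "z \<in> A" "norm (?x' - z) < r" by (auto simp: thicken_def dist_norm
        norm_minus_commute)
    have "a \<bullet> (?x' - z) \<le> norm a * norm (?x' - z)" by (rule norm_cauchy_schwarz)
    also have "\<dots> < norm a * r" using z na by simp
    finally have 1: "a \<bullet> ?x' < a \<bullet> y + norm a * r" using a(2)[OF z(1)] by (simp add:
        inner_diff_right)
    have "a \<bullet> (y - x) \<le> norm a * norm (y - x)" by (rule norm_cauchy_schwarz)
    also have "\<dots> < norm a * r" using y na by (simp add: dist_norm norm_minus_commute)
    finally have 2: "a \<bullet> y - norm a * r < a \<bullet> x" by (simp add: inner_diff_right)
    have "a \<bullet> ?x' = a \<bullet> x + 2 * r * (CARD('d) * \<bar>a $ i\<bar>)"
      by (simp add: inner_add_right inner_axis s_def)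
    also have "\<dots> \<ge> a \<bullet> x + 2 * r * norm a" using i r by (intro add_left_mono mult_left_mono) auto
    finally show False using 1 2 by (simp add: ac_simps)
  qed
  then show thesis by (intro that[of s i]) (auto simp: s_def)
qed

lemma gaussian_boundary_layer:
  fixes A :: "(real^'d::finite) set" and r :: real
  assumes A: "convex A" and r: "r > 0"
  shows "measure std_gaussian (thicken A r - erode A r) \<le> 32 * (CARD('d))\<^sup>2 * r"
proof -
  define K where "K = thicken A r"
  have K: "convex K" "K \<in> sets borel" unfolding K_def by (auto intro: convex_thicken A)
  note [measurable] = K(2)
  define v where "v = (\<lambda>(i :: 'd, s :: real). (s * (2 * CARD('d) * r)) *\<^sub>R axis i 1 :: real^'d)"
  define E where "E = (\<lambda>p. {x \<in> K. x + v p \<notin> K})"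
  have E: "E p \<in> sets std_gaussian" for p unfolding E_def sets_std_gaussian by measurable
  let ?I = "(UNIV :: 'd set) \<times> {1, -1 :: real}"
  have "thicken A r - erode A r \<subseteq> (\<Union>p\<in>?I. E p)"
  proof
    fix x assume x: "x \<in> thicken A r - erode A r"
    obtain i and s :: real where "s \<in> {1, -1}" "x + (s * (2 * CARD('d) * r)) *\<^sub>R axis i 1 \<notin>
        thicken A r"
      by (rule convex_boundary_layer_cover[OF A r x])
    then show "x \<in> (\<Union>p\<in>?I. E p)"
      using x by (intro UN_I[of "(i, s)"]) (auto simp: K_def E_def v_def)
  qed
  then have "measure std_gaussian (thicken A r - erode A r) \<le> measure std_gaussian (\<Union>p\<in>?I. E p)"
    using E by (intro gauss.finite_measure_mono sets.finite_UN) (simp_all del: sets_std_gaussian)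
  also have "\<dots> \<le> (\<Sum>p\<in>?I. measure std_gaussian (E p))"
    using E by (intro gauss.finite_measure_subadditive_finite) (simp, blast)
  also have "\<dots> \<le> (\<Sum>p\<in>?I. 16 * CARD('d) * r)"
  proof (rule sum_mono)
    fix p assume "p \<in> ?I"
    then have "norm (v p) = 2 * CARD('d) * r" using r by (cases p) (auto simp: v_def norm_axis_1
        abs_mult)
    then show "measure std_gaussian (E p) \<le> 16 * CARD('d) * r"
      using convex_exit_measure[OF K, of "v p"] by (simp add: E_def)
  qed
  also have "\<dots> = 32 * (CARD('d))\<^sup>2 * r" by (simp add: card_cartesian_product power2_eq_square)
  finally show ?thesis .
qed

section \<open>Hermite expansion of a Gaussian shift\<close>

text \<open>
  The terms of second and third order of the expansion of \<open>shift_weight (t v) z\<close> in \<open>t\<close> are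
  \<open>t\<^sup>2 hermite2 v z / 2\<close> and \<open>t\<^sup>3 hermite3 v z / 6\<close>.
\<close>

definition hermite2 :: "'a::real_inner \<Rightarrow> 'a \<Rightarrow> real" where
  "hermite2 v z = (v \<bullet> z)\<^sup>2 - (norm v)\<^sup>2"

definition hermite3 :: "'a::real_inner \<Rightarrow> 'a \<Rightarrow> real" where
  "hermite3 v z = (v \<bullet> z) ^ 3 - 3 * (norm v)\<^sup>2 * (v \<bullet> z)"

definition shift_remainder :: "'a::real_inner \<Rightarrow> 'a \<Rightarrow> real" where
  "shift_remainder v z = shift_weight v z - 1 - v \<bullet> z - hermite2 v z / 2 - hermite3 v z / 6"

lemma measurable_hermite [measurable]:
  fixes v :: "'a::euclidean_space"
  shows "hermite2 v \<in> borel_measurable borel" "hermite3 v \<in> borel_measurable borel"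
    "shift_remainder v \<in> borel_measurable borel"
  unfolding hermite2_def hermite3_def shift_remainder_def by measurable

lemma power_le_exp: "0 \<le> x \<Longrightarrow> (1 + x) ^ k \<le> exp (real k * x)" for x :: real
  using power_mono[OF exp_ge_add_one_self[of x], of k] by (simp add: exp_of_nat_mult)

text \<open>
  Taylor's formula of order four for \<open>t \<mapsto> shift_weight (t v) z\<close> on \<open>[0, 1]\<close>: the fourth derivative
  is the weight times the fourth Hermite polynomial \<open>y\<^sup>4 - 6 q y\<^sup>2 + 3 q\<^sup>2\<close> at \<open>y = v \<bullet> z - t q\<close>,
  where \<open>q = |v|\<^sup>2\<close>.
\<close>

lemma shift_remainder_bound:
  assumes v: "norm v \<le> 1"
  shows "\<bar>shift_remainder v z\<bar> \<le> norm v ^ 4 * exp (5 * norm z)"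
proof -
  define x where "x = v \<bullet> z"
  define q where "q = (norm v)\<^sup>2"
  define G where "G = (\<lambda>t::real. exp (t * x - t\<^sup>2 * q / 2))"
  define D where "D = (\<lambda>(k::nat) (t::real). let y = x - t * q in
    (if k = 0 then 1 else if k = 1 then y else if k = 2 then y\<^sup>2 - q else if k = 3 then y ^ 3 - 3
        * q * y
     else y ^ 4 - 6 * q * y\<^sup>2 + 3 * q\<^sup>2) * G t)"
  have G': "(G has_real_derivative (x - t * q) * G t) (at t)" for t
    unfolding G_def by (auto intro!: derivative_eq_intros simp: field_simps)
  have "\<forall>k t. k < 4 \<and> 0 \<le> t \<and> t \<le> 1 \<longrightarrow> (D k has_real_derivative D (Suc k) t) (at t)"
  proof (intro allI impI)
    fix k :: nat and t :: real assume "k < 4 \<and> 0 \<le> t \<and> t \<le> 1"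
    then consider "k = 0" | "k = 1" | "k = 2" | "k = 3" by linarith
    then show "(D k has_real_derivative D (Suc k) t) (at t)"
    proof cases
      case 1 then show ?thesis using G'[of t] by (simp add: D_def Let_def fun_eq_iff)
    next
      case 2
      have "((\<lambda>t. (x - t * q) * G t) has_real_derivative ((x - t * q)\<^sup>2 - q) * G t) (at t)"
        by (auto intro!: derivative_eq_intros G' simp: algebra_simps power2_eq_square)
      with 2 show ?thesis by (simp add: D_def Let_def)
    next
      case 3
      have "((\<lambda>t. ((x - t * q)\<^sup>2 - q) * G t) has_real_derivative ((x - t * q) ^ 3 - 3 * q * (x - t
          * q)) * G t) (at t)"
        by (auto intro!: derivative_eq_intros G' simp: algebra_simps power2_eq_square
            power3_eq_cube)
      with 3 show ?thesis by (simp add: D_def Let_def)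
    next
      case 4
      have "((\<lambda>t. ((x - t * q) ^ 3 - 3 * q * (x - t * q)) * G t) has_real_derivative
          ((x - t * q) ^ 4 - 6 * q * (x - t * q)\<^sup>2 + 3 * q\<^sup>2) * G t) (at t)"
        by (auto intro!: derivative_eq_intros G' simp: algebra_simps power2_eq_square
            power3_eq_cube power4_eq_xxxx)
      with 4 show ?thesis by (simp add: D_def Let_def)
    qed
  qed
  from Maclaurin[OF _ _ _ this, of "D 0"] obtain t where t: "0 < t" "t < 1"
    and eq: "D 0 1 = (\<Sum>k<4. D k 0 / fact k * 1 ^ k) + D 4 t / fact 4 * 1 ^ 4" by auto
  have "shift_remainder v z = D 4 t / 24"
  proof -
    have "D 0 1 = G 1" "D 0 0 = 1" "D 1 0 = x" "D 2 0 = x\<^sup>2 - q" "D 3 0 = x ^ 3 - 3 * q * x"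
      by (simp_all add: D_def G_def)
    moreover have "(\<Sum>k<4. D k 0 / fact k * 1 ^ k) = D 0 0 + D 1 0 + D 2 0 / 2 + D 3 0 / 6"
      by (simp add: eval_nat_numeral)
    moreover have "fact 4 = (24 :: real)" by (simp add: eval_nat_numeral)
    ultimately have "G 1 = 1 + x + (x\<^sup>2 - q) / 2 + (x ^ 3 - 3 * q * x) / 6 + D 4 t / 24"
      using eq by simp
    moreover have "shift_remainder v z = G 1 - 1 - x - (x\<^sup>2 - q) / 2 - (x ^ 3 - 3 * q * x) / 6"
      by (simp add: G_def shift_remainder_def shift_weight_def hermite2_def hermite3_def x_def
          q_def)
    ultimately show ?thesis by simp
  qed
  define y where "y = x - t * q"
  have D4: "D 4 t = (y ^ 4 - 6 * q * y\<^sup>2 + 3 * q\<^sup>2) * G t" by (simp add: D_def y_def Let_def)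
  have xz: "\<bar>x\<bar> \<le> norm v * norm z" unfolding x_def by (rule Cauchy_Schwarz_ineq2)
  have "\<bar>y\<bar> \<le> \<bar>x\<bar> + t * q" unfolding y_def using t q_def by (simp add: abs_mult abs_triangle_ineq4
      order_trans[OF abs_triangle_ineq4])
  also have "t * q \<le> 1 * (norm v * norm v)" unfolding q_def power2_eq_square using t by (intro
      mult_right_mono) auto
  also have "\<dots> \<le> norm v * 1" using v by (simp add: mult_left_le)
  finally have y: "\<bar>y\<bar> \<le> norm v * (1 + norm z)" using xz by (simp add: algebra_simps)
  have y2: "y\<^sup>2 \<le> (norm v)\<^sup>2 * (1 + norm z)\<^sup>2"
    using power_mono[OF y abs_ge_zero, of 2] by (simp add: power_mult_distrib)
  have y4: "y ^ 4 \<le> norm v ^ 4 * (1 + norm z) ^ 4"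
    using power_mono[OF y abs_ge_zero, of 4] by (simp add: power_mult_distrib)
  have one: "1 \<le> (1 + norm z)\<^sup>2" "(1 + norm z)\<^sup>2 \<le> (1 + norm z) ^ 4" "1 \<le> (1 + norm z) ^ 4"
    by (auto intro: one_le_power power_increasing)
  have v4: "norm v ^ 4 = q\<^sup>2" by (simp add: q_def)
  have "\<bar>y ^ 4 - 6 * q * y\<^sup>2 + 3 * q\<^sup>2\<bar> \<le> y ^ 4 + 6 * (q * y\<^sup>2) + 3 * q\<^sup>2"
    by (simp add: abs_le_iff q_def)
  also have "\<dots> \<le> q\<^sup>2 * (1 + norm z) ^ 4 + 6 * (q\<^sup>2 * (1 + norm z) ^ 4) + 3 * (q\<^sup>2 * (1 + norm z) ^
      4)"
  proof (intro add_mono mult_left_mono)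
    show "y ^ 4 \<le> q\<^sup>2 * (1 + norm z) ^ 4" using y4 v4 by simp
    have "q * y\<^sup>2 \<le> q * (q * (1 + norm z)\<^sup>2)" using y2 by (intro mult_left_mono) (auto simp: q_def)
    also have "\<dots> \<le> q * (q * (1 + norm z) ^ 4)" using one by (intro mult_left_mono) (auto simp:
        q_def)
    finally show "q * y\<^sup>2 \<le> q\<^sup>2 * (1 + norm z) ^ 4" by (simp add: power2_eq_square ac_simps)
    show "q\<^sup>2 \<le> q\<^sup>2 * (1 + norm z) ^ 4" using one(3) mult_left_mono[of 1 "(1 + norm z) ^ 4" "q\<^sup>2"]
        by simp
  qed auto
  finally have a: "\<bar>y ^ 4 - 6 * q * y\<^sup>2 + 3 * q\<^sup>2\<bar> \<le> 10 * q\<^sup>2 * (1 + norm z) ^ 4" by simp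
  have "t * x - t\<^sup>2 * q / 2 \<le> norm z"
  proof -
    have "t * x \<le> t * \<bar>x\<bar>" using t by (intro mult_left_mono) auto
    also have "\<dots> \<le> 1 * (norm v * norm z)" using t xz by (intro mult_mono) auto
    also have "\<dots> \<le> norm z" using mult_right_mono[OF v, of "norm z"] by simp
    finally show ?thesis using q_def by (smt (verit) mult_nonneg_nonneg zero_le_power2
        divide_nonneg_nonneg)
  qed
  then have "G t \<le> exp (norm z)" by (simp add: G_def)
  then have "\<bar>D 4 t\<bar> \<le> 10 * q\<^sup>2 * (1 + norm z) ^ 4 * exp (norm z)"
    unfolding D4 abs_mult using a by (intro mult_mono) (auto simp: G_def)
  also have "\<dots> \<le> 10 * q\<^sup>2 * exp (4 * norm z) * exp (norm z)"
    using power_le_exp[of "norm z" 4] by (intro mult_right_mono mult_left_mono) auto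
  also have "\<dots> = 10 * (norm v ^ 4 * exp (5 * norm z))" by (simp add: v4 exp_add[symmetric]
      mult.assoc)
  finally have "\<bar>D 4 t\<bar> / 24 \<le> 10 * (norm v ^ 4 * exp (5 * norm z)) / 24" by (simp add:
      divide_right_mono)
  also have "\<dots> \<le> norm v ^ 4 * exp (5 * norm z)" by simp
  finally show ?thesis using \<open>shift_remainder v z = D 4 t / 24\<close> by simp
qed

lemma hermite_growth:
  shows "\<bar>hermite2 v z\<bar> \<le> (norm v)\<^sup>2 * (2 * exp (2 * norm z))"
    and "\<bar>hermite3 v z\<bar> \<le> norm v ^ 3 * (4 * exp (3 * norm z))"
    and "\<bar>v \<bullet> z\<bar> \<le> norm v * exp (norm z)"
proof -
  have e1: "norm z \<le> exp (norm z)" using exp_ge_add_one_self[of "norm z"] by linarith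
  have x: "\<bar>v \<bullet> z\<bar> \<le> norm v * norm z" by (rule Cauchy_Schwarz_ineq2)
  also have "\<dots> \<le> norm v * exp (norm z)" using e1 by (intro mult_left_mono) auto
  finally show 1: "\<bar>v \<bullet> z\<bar> \<le> norm v * exp (norm z)" .
  have 2: "(v \<bullet> z)\<^sup>2 \<le> (norm v)\<^sup>2 * exp (2 * norm z)"
    using power_mono[OF 1 abs_ge_zero, of 2] by (simp add: power_mult_distrib
        exp_of_nat_mult[symmetric])
  have "\<bar>v \<bullet> z\<bar> ^ 3 \<le> norm v ^ 3 * exp (3 * norm z)"
    using power_mono[OF 1 abs_ge_zero, of 3] by (simp add: power_mult_distrib
        exp_of_nat_mult[symmetric])
  then have 3: "\<bar>(v \<bullet> z) ^ 3\<bar> \<le> norm v ^ 3 * exp (3 * norm z)" by (simp add: power_abs)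
  have "(norm v)\<^sup>2 * 1 \<le> (norm v)\<^sup>2 * exp (2 * norm z)" by (intro mult_left_mono) auto
  with 2 show "\<bar>hermite2 v z\<bar> \<le> (norm v)\<^sup>2 * (2 * exp (2 * norm z))"
    unfolding hermite2_def using zero_le_power2[of "v \<bullet> z"] zero_le_power2[of "norm v"] by linarith
  have "(norm v)\<^sup>2 * \<bar>v \<bullet> z\<bar> \<le> (norm v)\<^sup>2 * (norm v * exp (norm z))" using 1 by (intro
      mult_left_mono) auto
  also have "\<dots> \<le> (norm v)\<^sup>2 * (norm v * exp (3 * norm z))" by (intro mult_left_mono) auto
  finally have "\<bar>(norm v)\<^sup>2 * (v \<bullet> z)\<bar> \<le> norm v ^ 3 * exp (3 * norm z)"
    by (simp add: abs_mult power2_eq_square power3_eq_cube ac_simps)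
  with 3 show "\<bar>hermite3 v z\<bar> \<le> norm v ^ 3 * (4 * exp (3 * norm z))"
    unfolding hermite3_def by linarith
qed

lemma integrable_hermite:
  fixes v :: "real^'d::finite"
  shows "integrable std_gaussian (\<lambda>z. v \<bullet> z)" "integrable std_gaussian (hermite2 v)"
    "integrable std_gaussian (hermite3 v)" "integrable std_gaussian (shift_weight v)"
    "integrable std_gaussian (shift_remainder v)"
proof -
  show 1: "integrable std_gaussian (\<lambda>z. v \<bullet> z)"
    by (rule integrable_exp_bounded[where C = "norm v" and t = 1]) (auto simp: hermite_growth(3))
  show 2: "integrable std_gaussian (hermite2 v)"
    by (rule integrable_exp_bounded[where C = "(norm v)\<^sup>2 * 2" and t = 2]) (use hermite_growth(1)
        in \<open>auto simp: mult.assoc\<close>)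
  show 3: "integrable std_gaussian (hermite3 v)"
    by (rule integrable_exp_bounded[where C = "norm v ^ 3 * 4" and t = 3]) (use hermite_growth(2)
        in \<open>auto simp: mult.assoc\<close>)
  show 4: "integrable std_gaussian (shift_weight v)"
  proof (rule integrable_exp_bounded[where C = 1 and t = "norm v"])
    fix z
    have "v \<bullet> z \<le> norm v * norm z" by (rule norm_cauchy_schwarz)
    then have "v \<bullet> z - (norm v)\<^sup>2 / 2 \<le> norm v * norm z"
      using zero_le_power2[of "norm v"] by linarith
    then show "\<bar>shift_weight v z\<bar> \<le> 1 * exp (norm v * norm z)" by (simp add: shift_weight_def)
  qed measurable
  show "integrable std_gaussian (shift_remainder v)"
    unfolding shift_remainder_def
    by (intro Bochner_Integration.integrable_diff integrable_divide 1 2 3 4) simp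
qed

text \<open>
  This moment controls the error terms of the comparison: the test functions grow at most like
  \<open>exp (5 |z|)\<close>, and the width of the boundary layer contributes a factor \<open>1 + |z| \<le> exp |z|\<close>.
\<close>

definition exp_moment :: "'d::finite itself \<Rightarrow> real" where
  "exp_moment _ = (\<integral>z. exp (6 * norm z) \<partial>(std_gaussian :: (real^'d) measure))"

text \<open>
  The first and third order are odd and the weight is a probability density, so the remainder has
  minus half the mean of \<open>hermite2\<close>.  Replacing \<open>v\<close> by \<open>t v\<close>, the former is \<open>O(t\<^sup>4)\<close> and the
  latter proportional to \<open>t\<^sup>2\<close>; hence both vanish.
\<close>

lemma hermite_mean_zero:
  fixes v :: "real^'d::finite"
  shows "(\<integral>z. v \<bullet> z \<partial>std_gaussian) = 0" "(\<integral>z. hermite2 v z \<partial>std_gaussian) = 0"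
    "(\<integral>z. hermite3 v z \<partial>std_gaussian) = 0" "(\<integral>z. shift_weight v z \<partial>std_gaussian) = 1"
    "(\<integral>z. shift_remainder v z \<partial>std_gaussian) = 0"
proof -
  show 1: "(\<integral>z. v \<bullet> z \<partial>std_gaussian) = 0" for v :: "real^'d"
    by (rule integral_std_gaussian_odd) auto
  show 3: "(\<integral>z. hermite3 v z \<partial>std_gaussian) = 0" for v :: "real^'d"
    by (rule integral_std_gaussian_odd) (auto simp: hermite3_def)
  show 4: "(\<integral>z. shift_weight v z \<partial>std_gaussian) = 1" for v :: "real^'d"
    using integral_std_gaussian_shift[of "\<lambda>_. 1" v] by simp
  have R: "(\<integral>z. shift_remainder v z \<partial>std_gaussian) = - (\<integral>z. hermite2 v z \<partial>std_gaussian) / 2" for v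
      :: "real^'d"
    unfolding shift_remainder_def
    by (simp add: integrable_hermite 1 3 4 gauss.prob_space)
  show 2: "(\<integral>z. hermite2 v z \<partial>std_gaussian) = 0"
  proof (rule ccontr)
    assume ne: "(\<integral>z. hermite2 v z \<partial>std_gaussian) \<noteq> 0"
    define m where "m = (\<integral>z. hermite2 v z \<partial>std_gaussian)"
    define K where "K = norm v ^ 4 * (\<integral>z. exp (5 * norm z) \<partial>(std_gaussian :: (real^'d) measure))"
    have K: "K \<ge> 0" by (simp add: K_def)
    have le: "\<bar>m\<bar> \<le> 2 * t\<^sup>2 * K" if t: "t > 0" "t * norm v \<le> 1" for t
    proof -
      have "hermite2 (t *\<^sub>R v) = (\<lambda>z. t\<^sup>2 * hermite2 v z)"
        by (rule ext) (simp add: hermite2_def power_mult_distrib algebra_simps)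
      then have "\<bar>t\<^sup>2 * m\<bar> / 2 = \<bar>\<integral>z. shift_remainder (t *\<^sub>R v) z \<partial>std_gaussian\<bar>"
        unfolding R by (simp add: m_def)
      also have "\<dots> \<le> (\<integral>z. norm (t *\<^sub>R v) ^ 4 * exp (5 * norm z) \<partial>(std_gaussian :: (real^'d)
          measure))"
        using t by (intro integral_abs_bound[THEN order_trans] integral_mono integrable_abs
            integrable_hermite
            integrable_mult_right integrable_exp_norm shift_remainder_bound) auto
      also have "\<dots> = t\<^sup>2 * (t\<^sup>2 * K)" using t by (simp add: K_def power_mult_distrib)
      finally have "t\<^sup>2 * \<bar>m\<bar> \<le> t\<^sup>2 * (2 * (t\<^sup>2 * K))"
        by (simp add: abs_mult power4_eq_xxxx power2_eq_square ac_simps)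
      then show ?thesis using t by simp
    qed
    have m: "\<bar>m\<bar> > 0" using ne by (simp add: m_def)
    have "((\<lambda>t. 2 * t\<^sup>2 * K) \<longlongrightarrow> 2 * 0\<^sup>2 * K) (at_right 0)" by (intro tendsto_intros)
    then have "eventually (\<lambda>t. 2 * t\<^sup>2 * K < \<bar>m\<bar>) (at_right 0)" using m by (intro order_tendstoD)
        auto
    moreover have "((\<lambda>t. t * norm v) \<longlongrightarrow> 0 * norm v) (at_right 0)" by (intro tendsto_intros)
    then have "eventually (\<lambda>t. t * norm v < 1) (at_right 0)" by (intro order_tendstoD) auto
    moreover have "eventually (\<lambda>t::real. 0 < t) (at_right 0)" by (rule eventually_at_right_less)
    ultimately have "eventually (\<lambda>t::real. False) (at_right 0)"
      by eventually_elim (use le in force)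
    then show False by simp
  qed
  show "(\<integral>z. shift_remainder v z \<partial>std_gaussian) = 0" using R[of v] 2 by simp
qed

section \<open>The interpolation path\<close>

definition smoothed :: "(real^'d::finite) set \<Rightarrow> real \<Rightarrow> real^'d \<Rightarrow> real" where
  "smoothed A \<theta> w = (\<integral>z. indicator A (cos \<theta> *\<^sub>R w + sin \<theta> *\<^sub>R z) \<partial>std_gaussian)"

text \<open>
  The logarithmic derivative in \<open>\<theta>\<close> of the density of \<open>cos \<theta> w + sin \<theta> Z\<close>, as a function of the
  value \<open>z\<close> of \<open>Z\<close>.
\<close>

definition path_drift :: "real^'d::finite \<Rightarrow> real \<Rightarrow> real^'d \<Rightarrow> real" where
  "path_drift w \<theta> z = (cos \<theta> / sin \<theta>) * ((norm z)\<^sup>2 - CARD('d)) - z \<bullet> w"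

definition smoothed_deriv :: "(real^'d::finite) set \<Rightarrow> real \<Rightarrow> real^'d \<Rightarrow> real" where
  "smoothed_deriv A \<theta> w = (\<integral>z. indicator A (cos \<theta> *\<^sub>R w + sin \<theta> *\<^sub>R z) * path_drift w \<theta> z
      \<partial>std_gaussian)"

definition path_inv :: "real^'d::finite \<Rightarrow> real \<Rightarrow> real^'d \<Rightarrow> real^'d" where
  "path_inv w \<theta> y = (1 / sin \<theta>) *\<^sub>R (y - cos \<theta> *\<^sub>R w)"

definition path_density :: "real^'d::finite \<Rightarrow> real \<Rightarrow> real^'d \<Rightarrow> real" where
  "path_density w \<theta> y = (1 / sin \<theta>) ^ CARD('d) * gauss_density (path_inv w \<theta> y)"

lemma measurable_sin_cos [measurable]:
  "(sin :: real \<Rightarrow> real) \<in> borel_measurable borel" "(cos :: real \<Rightarrow> real) \<in> borel_measurable borel"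
  by (auto intro!: borel_measurable_continuous_onI continuous_intros)

lemma path_density_deriv:
  fixes y w :: "real^'d::finite"
  assumes s: "sin \<theta> > 0"
  shows "((\<lambda>\<theta>. path_density w \<theta> y) has_real_derivative
      path_density w \<theta> y * path_drift w \<theta> (path_inv w \<theta> y)) (at \<theta>)"
proof -
  define Y P Q K where "Y = y \<bullet> y" "P = y \<bullet> w" "Q = w \<bullet> w" "K = (1 / sqrt (2 * pi)) ^ CARD('d)"
  define N where "N = (\<lambda>t. Y - 2 * cos t * P + (cos t)\<^sup>2 * Q)"
  have N: "(norm (path_inv w t y))\<^sup>2 = N t * (1 / sin t)\<^sup>2" for t
  proof -
    have "(norm (path_inv w t y))\<^sup>2 = (1 / sin t)\<^sup>2 * ((y - cos t *\<^sub>R w) \<bullet> (y - cos t *\<^sub>R w))"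
      by (simp only: path_inv_def norm_scaleR power_mult_distrib power2_abs dot_square_norm)
    also have "(y - cos t *\<^sub>R w) \<bullet> (y - cos t *\<^sub>R w) = N t"
      by (simp add: N_def Y_P_Q_K_def inner_diff_left inner_diff_right inner_commute
          power2_eq_square)
    finally show ?thesis by (simp add: mult.commute)
  qed
  have pd: "path_density w t y = K * ((1 / sin t) ^ CARD('d) * exp (- (N t * (1 / sin t)\<^sup>2) / 2))"
      for t
    by (simp only: path_density_def gauss_density_def N) (simp add: Y_P_Q_K_def ac_simps)
  let ?s = "sin \<theta>" and ?c = "cos \<theta>"
  let ?E = "exp (- (N \<theta> * (1 / ?s)\<^sup>2) / 2)"
  have dN: "(N has_real_derivative (2 * ?s * P - 2 * ?c * ?s * Q)) (at \<theta>)"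
    unfolding N_def by (auto intro!: derivative_eq_intros)
  have ds: "((\<lambda>t. 1 / sin t) has_real_derivative (- ?c / ?s\<^sup>2)) (at \<theta>)"
    using s by (auto intro!: derivative_eq_intros simp: power2_eq_square)
  have "((\<lambda>t. (1 / sin t) ^ CARD('d)) has_real_derivative
      CARD('d) * ((- ?c / ?s\<^sup>2) * (1 / ?s) ^ (CARD('d) - 1))) (at \<theta>)"
    using DERIV_power[OF ds, of "CARD('d)"] by simp
  moreover have "CARD('d) * ((- ?c / ?s\<^sup>2) * (1 / ?s) ^ (CARD('d) - 1)) = - (CARD('d) * ?c / ?s) *
      (1 / ?s) ^ CARD('d)"
  proof -
    have "(1 / ?s) ^ CARD('d) = (1 / ?s) * (1 / ?s) ^ (CARD('d) - 1)"
      by (subst power_Suc[symmetric]) simp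
    then show ?thesis using s by (simp add: power2_eq_square field_simps)
  qed
  ultimately have dp: "((\<lambda>t. (1 / sin t) ^ CARD('d)) has_real_derivative
      - (CARD('d) * ?c / ?s) * (1 / ?s) ^ CARD('d)) (at \<theta>)" by simp
  have dE: "((\<lambda>t. exp (- (N t * (1 / sin t)\<^sup>2) / 2)) has_real_derivative
      ?E * (- (2 * ?s * P - 2 * ?c * ?s * Q) * (1 / ?s)\<^sup>2 / 2 + N \<theta> * (1 / ?s) * ?c / ?s\<^sup>2)) (at \<theta>)"
    using s by (auto intro!: derivative_eq_intros dN ds
        simp: algebra_simps add_divide_distrib diff_divide_distrib power2_eq_square)
  have "((\<lambda>\<theta>. path_density w \<theta> y) has_real_derivative
     K * (((1 / ?s) ^ CARD('d) * ?E) * (- (CARD('d) * ?c / ?s) +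
      (- (2 * ?s * P - 2 * ?c * ?s * Q) * (1 / ?s)\<^sup>2 / 2 + N \<theta> * (1 / ?s) * ?c / ?s\<^sup>2)))) (at \<theta>)"
    unfolding pd by (rule DERIV_cmult, rule DERIV_cong[OF DERIV_mult[OF dp dE]]) (simp add:
        algebra_simps)
  moreover have "- (CARD('d) * ?c / ?s) + (- (2 * ?s * P - 2 * ?c * ?s * Q) * (1 / ?s)\<^sup>2 / 2 + N \<theta>
      * (1 / ?s) * ?c / ?s\<^sup>2)
      = path_drift w \<theta> (path_inv w \<theta> y)"
  proof -
    have zw: "path_inv w \<theta> y \<bullet> w = (P - ?c * Q) / ?s"
      by (simp add: path_inv_def Y_P_Q_K_def inner_diff_left)
    have "- (2 * ?s * P - 2 * ?c * ?s * Q) * (1 / ?s)\<^sup>2 / 2 = - ((P - ?c * Q) / ?s)"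
      using s by (simp add: field_simps power2_eq_square)
    then show ?thesis unfolding path_drift_def N zw
      using s by (simp add: field_simps power2_eq_square)
  qed
  ultimately show ?thesis unfolding pd by (simp add: mult.assoc)
qed

lemma measurable_path [measurable]:
  "(\<lambda>(\<theta>, y). path_inv w \<theta> y) \<in> borel_measurable (borel \<Otimes>\<^sub>M borel)"
  "(\<lambda>(\<theta>, y). path_density w \<theta> y) \<in> borel_measurable (borel \<Otimes>\<^sub>M borel)"
  "(\<lambda>(\<theta>, z). path_drift w \<theta> z) \<in> borel_measurable (borel \<Otimes>\<^sub>M borel)"
  "path_inv w \<theta> \<in> borel_measurable borel"
  "path_density w \<theta> \<in> borel_measurable borel"
  "path_drift w \<theta> \<in> borel_measurable borel"
  unfolding path_inv_def path_density_def path_drift_def by measurable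

lemma integral_path_density:
  fixes f :: "real^'d::finite \<Rightarrow> real \<Rightarrow> real"
  assumes [measurable]: "(\<lambda>(y, u). f y u) \<in> borel_measurable (borel \<Otimes>\<^sub>M borel)" and s: "sin \<theta> > 0"
  shows "(\<integral>y. path_density w \<theta> y * f y (path_drift w \<theta> (path_inv w \<theta> y)) \<partial>lborel)
    = (\<integral>z. f (cos \<theta> *\<^sub>R w + sin \<theta> *\<^sub>R z) (path_drift w \<theta> z) \<partial>std_gaussian)"
proof -
  have inv: "path_inv w \<theta> (cos \<theta> *\<^sub>R w + sin \<theta> *\<^sub>R z) = z" for z using s by (simp add: path_inv_def)
  have "(\<integral>y. path_density w \<theta> y * f y (path_drift w \<theta> (path_inv w \<theta> y)) \<partial>lborel)
    = \<bar>sin \<theta>\<bar> ^ DIM(real^'d) * (\<integral>z. path_density w \<theta> (cos \<theta> *\<^sub>R w + sin \<theta> *\<^sub>R z) *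
        f (cos \<theta> *\<^sub>R w + sin \<theta> *\<^sub>R z) (path_drift w \<theta> (path_inv w \<theta> (cos \<theta> *\<^sub>R w + sin \<theta> *\<^sub>R z)))
            \<partial>lborel)"
    using s by (intro integral_lborel_affine) auto
  also have "\<dots> = (\<integral>z. gauss_density z * f (cos \<theta> *\<^sub>R w + sin \<theta> *\<^sub>R z) (path_drift w \<theta> z) \<partial>lborel)"
    using s by (subst integral_mult_right_zero[symmetric]) (simp add: inv path_density_def
        power_divide)
  also have "\<dots> = (\<integral>z. f (cos \<theta> *\<^sub>R w + sin \<theta> *\<^sub>R z) (path_drift w \<theta> z) \<partial>std_gaussian)"
    by (rule integral_std_gaussian[symmetric]) measurable
  finally show ?thesis .
qed

lemma nn_integral_path_density:
  fixes f :: "real^'d::finite \<Rightarrow> real \<Rightarrow> ennreal"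
  assumes [measurable]: "(\<lambda>(y, u). f y u) \<in> borel_measurable (borel \<Otimes>\<^sub>M borel)" and s: "sin \<theta> > 0"
  shows "(\<integral>\<^sup>+y. ennreal (path_density w \<theta> y) * f y (path_drift w \<theta> (path_inv w \<theta> y)) \<partial>lborel)
    = (\<integral>\<^sup>+z. f (cos \<theta> *\<^sub>R w + sin \<theta> *\<^sub>R z) (path_drift w \<theta> z) \<partial>std_gaussian)"
proof -
  have inv: "path_inv w \<theta> (cos \<theta> *\<^sub>R w + sin \<theta> *\<^sub>R z) = z" for z using s by (simp add: path_inv_def)
  have pd: "ennreal (\<bar>sin \<theta>\<bar> ^ DIM(real^'d)) * ennreal (path_density w \<theta> (cos \<theta> *\<^sub>R w + sin \<theta> *\<^sub>R
      z))
      = ennreal (gauss_density z)" for z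
    using s by (simp add: inv path_density_def power_divide ennreal_mult[symmetric])
  have "(\<integral>\<^sup>+y. ennreal (path_density w \<theta> y) * f y (path_drift w \<theta> (path_inv w \<theta> y)) \<partial>lborel)
    = ennreal (\<bar>sin \<theta>\<bar> ^ DIM(real^'d)) * (\<integral>\<^sup>+z. ennreal (path_density w \<theta> (cos \<theta> *\<^sub>R w + sin \<theta> *\<^sub>R
        z)) *
        f (cos \<theta> *\<^sub>R w + sin \<theta> *\<^sub>R z) (path_drift w \<theta> (path_inv w \<theta> (cos \<theta> *\<^sub>R w + sin \<theta> *\<^sub>R z)))
            \<partial>lborel)"
    using s by (intro nn_integral_lborel_affine) auto
  also have "\<dots> = (\<integral>\<^sup>+z. ennreal (gauss_density z) * f (cos \<theta> *\<^sub>R w + sin \<theta> *\<^sub>R z) (path_drift w \<theta>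
      z) \<partial>lborel)"
    by (subst nn_integral_cmult[symmetric], measurable) (simp add: mult.assoc[symmetric]
        pd[simplified] inv)
  also have "\<dots> = (\<integral>\<^sup>+z. f (cos \<theta> *\<^sub>R w + sin \<theta> *\<^sub>R z) (path_drift w \<theta> z) \<partial>std_gaussian)"
    by (rule nn_integral_std_gaussian[symmetric]) measurable
  finally show ?thesis .
qed

text \<open>
  The fundamental theorem of calculus holds pointwise for the density of \<open>cos \<theta> w + sin \<theta> Z\<close>.
  Fubini's theorem transfers it to the integral over \<open>A\<close>, since the derivative of the density is
  integrable in both variables as long as \<open>\<theta>\<close> stays away from \<open>0\<close>.
\<close>

lemma smoothed_difference:
  fixes A :: "(real^'d::finite) set"
  assumes [measurable]: "A \<in> sets borel" and ab: "0 < a" "a \<le> b" "b \<le> pi / 2"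
  shows "integrable lborel (\<lambda>\<theta>. indicator {a..b} \<theta> * smoothed_deriv A \<theta> w)"
    and "smoothed A b w - smoothed A a w = (\<integral>\<theta>. indicator {a..b} \<theta> * smoothed_deriv A \<theta> w \<partial>lborel)"
proof -
  have s: "sin \<theta> > 0" if "\<theta> \<in> {a..b}" for \<theta>
    using that ab pi_gt_zero by (intro sin_gt_zero) auto
  define p where "p = (\<lambda>\<theta> y. path_density w \<theta> y)"
  define q where "q = (\<lambda>\<theta> y. path_density w \<theta> y * path_drift w \<theta> (path_inv w \<theta> y))"
  have [measurable]: "(\<lambda>(\<theta>, y). q \<theta> y) \<in> borel_measurable (borel \<Otimes>\<^sub>M borel)" unfolding q_def by
      measurable
  have p0: "0 \<le> path_density w \<theta> y" if "\<theta> \<in> {a..b}" for \<theta> y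
    using s[OF that] by (simp add: path_density_def)
  have sm: "smoothed A \<theta> w = (\<integral>y. p \<theta> y * indicator A y \<partial>lborel)" if "\<theta> \<in> {a..b}" for \<theta>
    unfolding smoothed_def p_def
    by (rule integral_path_density[of "\<lambda>y u. indicator A y", OF _ s[OF that], symmetric]) measurable
  have smd: "smoothed_deriv A \<theta> w = (\<integral>y. q \<theta> y * indicator A y \<partial>lborel)" if "\<theta> \<in> {a..b}" for \<theta>
    unfolding smoothed_deriv_def q_def
    using integral_path_density[of "\<lambda>y u. indicator A y * u", OF _ s[OF that], of w] by (simp add:
        ac_simps)
  define M where "M = 1 / sin a * (1 + CARD('d)) * 2 + norm w"
  have sa: "sin a > 0" using s[of a] ab by auto
  have drift: "\<bar>path_drift w \<theta> z\<bar> \<le> M * exp (2 * norm z)" if t: "\<theta> \<in> {a..b}" for \<theta> z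
  proof -
    have "sin a \<le> sin \<theta>" using t ab by (intro sin_monotone_2pi_le) auto
    moreover have "0 \<le> cos \<theta>" using t ab pi_gt_zero by (intro cos_ge_zero) auto
    ultimately have cs: "0 \<le> cos \<theta> / sin \<theta>" "cos \<theta> / sin \<theta> \<le> 1 / sin a"
      using sa by (auto intro!: frac_le)
    have e1: "norm z \<le> exp (norm z)" using exp_ge_add_one_self[of "norm z"] by linarith
    then have e2: "(norm z)\<^sup>2 \<le> exp (2 * norm z)" 
      using power_mono[OF e1, of 2] by (simp add: exp_of_nat_mult[symmetric])
    have e3: "norm z \<le> exp (2 * norm z)" by (rule order_trans[OF e1]) simp
    have e4: "1 \<le> exp (2 * norm z)" by simp
    have "\<bar>path_drift w \<theta> z\<bar> \<le> \<bar>(cos \<theta> / sin \<theta>) * ((norm z)\<^sup>2 - CARD('d))\<bar> + \<bar>z \<bullet> w\<bar>"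
      unfolding path_drift_def by (rule abs_triangle_ineq4)
    also have "\<dots> \<le> 1 / sin a * ((norm z)\<^sup>2 + CARD('d)) + norm w * norm z"
    proof (intro add_mono)
      show "\<bar>(cos \<theta> / sin \<theta>) * ((norm z)\<^sup>2 - CARD('d))\<bar> \<le> 1 / sin a * ((norm z)\<^sup>2 + CARD('d))"
        unfolding abs_mult using cs sa by (intro mult_mono) (auto simp: abs_le_iff)
      show "\<bar>z \<bullet> w\<bar> \<le> norm w * norm z" by (metis Cauchy_Schwarz_ineq2 mult.commute)
    qed
    also have "\<dots> \<le> 1 / sin a * (exp (2 * norm z) + CARD('d) * exp (2 * norm z)) + norm w * exp (2
        * norm z)"
      using sa e2 e3 e4 by (intro add_mono mult_left_mono) auto
    also have "\<dots> \<le> M * exp (2 * norm z)" using sa by (simp add: M_def field_simps)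
    finally show ?thesis .
  qed
  define F where "F = (\<lambda>(\<theta>, y). indicator {a..b} \<theta> * (q \<theta> y * indicator A y))"
  have [measurable]: "F \<in> borel_measurable (lborel \<Otimes>\<^sub>M lborel)" unfolding F_def by measurable
  define C where "C = (\<integral>z. M * exp (2 * norm z) \<partial>(std_gaussian :: (real^'d) measure))"
  have M: "M \<ge> 0" using sa by (simp add: M_def)
  have q_le: "(\<integral>\<^sup>+y. ennreal (norm (q \<theta> y * indicator A y)) \<partial>lborel) \<le> ennreal C" if t: "\<theta> \<in>
      {a..b}" for \<theta>
  proof -
    have "(\<integral>\<^sup>+y. ennreal (norm (q \<theta> y * indicator A y)) \<partial>lborel)
        \<le> (\<integral>\<^sup>+y. ennreal (path_density w \<theta> y) * ennreal \<bar>path_drift w \<theta> (path_inv w \<theta> y)\<bar> \<partial>lborel)"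
      using p0[OF t] by (intro nn_integral_mono) (auto simp: q_def abs_mult
          ennreal_mult[symmetric] indicator_def)
    also have "\<dots> = (\<integral>\<^sup>+z. ennreal \<bar>path_drift w \<theta> z\<bar> \<partial>std_gaussian)"
      by (rule nn_integral_path_density[of "\<lambda>y u. ennreal \<bar>u\<bar>", OF _ s[OF t]]) measurable
    also have "\<dots> \<le> (\<integral>\<^sup>+z. ennreal (M * exp (2 * norm z)) \<partial>(std_gaussian :: (real^'d) measure))"
      by (intro nn_integral_mono ennreal_leI drift t)
    also have "\<dots> = ennreal C"
      unfolding C_def using M by (intro nn_integral_eq_integral integrable_mult_right
          integrable_exp_norm) auto
    finally show ?thesis .
  qed
  have F: "integrable (lborel \<Otimes>\<^sub>M lborel) F"
  proof (rule integrableI_bounded)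
    have "(\<integral>\<^sup>+x. ennreal (norm (F x)) \<partial>(lborel \<Otimes>\<^sub>M lborel)) = (\<integral>\<^sup>+\<theta>. (\<integral>\<^sup>+y. ennreal (norm (F (\<theta>,
        y))) \<partial>lborel) \<partial>lborel)"
      by (rule lborel.nn_integral_fst[symmetric]) measurable
    also have "\<dots> \<le> (\<integral>\<^sup>+\<theta>. ennreal C * indicator {a..b} \<theta> \<partial>lborel)"
    proof (rule nn_integral_mono)
      fix \<theta> :: real
      show "(\<integral>\<^sup>+y. ennreal (norm (F (\<theta>, y))) \<partial>lborel) \<le> ennreal C * indicator {a..b} \<theta>"
        using q_le[of \<theta>] by (auto simp: F_def indicator_def[of "{a..b}"])
    qed
    also have "\<dots> = ennreal C * ennreal (b - a)"
      using ab by (subst nn_integral_cmult_indicator) auto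
    also have "\<dots> < \<infinity>" by (simp add: ennreal_mult_less_top)
    finally show "(\<integral>\<^sup>+x. ennreal (norm (F x)) \<partial>(lborel \<Otimes>\<^sub>M lborel)) < \<infinity>" .
  qed measurable
  have inner: "(\<integral>y. F (\<theta>, y) \<partial>lborel) = indicator {a..b} \<theta> * smoothed_deriv A \<theta> w" for \<theta>
    using smd[of \<theta>] by (auto simp: F_def indicator_def[of "{a..b}"])
  show "integrable lborel (\<lambda>\<theta>. indicator {a..b} \<theta> * smoothed_deriv A \<theta> w)"
    using lborel_pair.integrable_fst'[OF F] unfolding inner .
  have ftc: "(\<integral>\<theta>. F (\<theta>, y) \<partial>lborel) = p b y * indicator A y - p a y * indicator A y" for y
  proof -
    have "(\<integral>\<theta>. indicator {a..b} \<theta> *\<^sub>R q \<theta> y \<partial>lborel) = p b y - p a y"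
    proof (rule integral_FTC_atLeastAtMost[OF ab(2)])
      fix \<theta> assume "a \<le> \<theta>" "\<theta> \<le> b"
      then show "((\<lambda>\<theta>. p \<theta> y) has_vector_derivative q \<theta> y) (at \<theta> within {a..b})"
        unfolding p_def q_def
        using path_density_deriv[OF s[of \<theta>], of w y]
        by (auto simp: has_real_derivative_iff_has_vector_derivative intro:
            has_vector_derivative_at_within)
    next
      have "sin \<theta> \<noteq> 0" if "\<theta> \<in> {a..b}" for \<theta> using s[OF that] by simp
      then show "continuous_on {a..b} (\<lambda>\<theta>. q \<theta> y)"
        unfolding q_def path_density_def path_drift_def path_inv_def
        by (intro continuous_intros continuous_on_compose2[OF continuous_gauss_density[of UNIV]])
            auto
    qed
    then have "(\<integral>\<theta>. (indicator {a..b} \<theta> *\<^sub>R q \<theta> y) * indicator A y \<partial>lborel) = (p b y - p a y) *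
        indicator A y"
      by (subst integral_mult_left_zero) simp
    then show ?thesis by (simp add: F_def algebra_simps)
  qed
  have int_p: "integrable lborel (\<lambda>y. p \<theta> y * indicator A y)" if t: "\<theta> \<in> {a..b}" for \<theta>
  proof (rule integrableI_bounded)
    have "(\<integral>\<^sup>+y. ennreal (norm (p \<theta> y * indicator A y)) \<partial>lborel) \<le> (\<integral>\<^sup>+y. ennreal (path_density w
        \<theta> y) * 1 \<partial>lborel)"
      using p0[OF t] by (intro nn_integral_mono) (auto simp: p_def indicator_def)
    also have "\<dots> = (\<integral>\<^sup>+z. 1 \<partial>(std_gaussian :: (real^'d) measure))"
      by (rule nn_integral_path_density[of "\<lambda>y u. 1", OF _ s[OF t]]) measurable
    finally show "(\<integral>\<^sup>+y. ennreal (norm (p \<theta> y * indicator A y)) \<partial>lborel) < \<infinity>"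
      using gauss.emeasure_space_1[where 'd = 'd] by (auto intro: le_less_trans)
  qed (simp add: p_def)
  have "(\<integral>\<theta>. indicator {a..b} \<theta> * smoothed_deriv A \<theta> w \<partial>lborel) = (\<integral>y. (\<integral>\<theta>. F (\<theta>, y) \<partial>lborel)
      \<partial>lborel)"
    unfolding inner[symmetric]
    using lborel_pair.Fubini_integral[of "\<lambda>\<theta> y. F (\<theta>, y)"] F by simp
  also have "\<dots> = smoothed A b w - smoothed A a w"
    unfolding ftc using ab int_p[of a] int_p[of b] sm[of a] sm[of b] by simp
  finally show "smoothed A b w - smoothed A a w = (\<integral>\<theta>. indicator {a..b} \<theta> * smoothed_deriv A \<theta> w
      \<partial>lborel)" ..
qed

section \<open>Discrepancy and smoothing\<close>

text \<open>
  Up to \<open>\<pi>/3\<close> the derivative is at least \<open>1/2\<close>; beyond, \<open>sin x \<ge> sqrt 3 / 2\<close> exceeds \<open>\<pi>/4\<close>.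
\<close>

lemma sin_ge_half: 
  assumes "0 \<le> x" "x \<le> pi / 2"
  shows "x / 2 \<le> sin x"
proof (cases "x \<le> pi / 3")
  case True
  have "(\<lambda>x. sin x - x / 2) 0 \<le> (\<lambda>x. sin x - x / 2) x"
  proof (rule DERIV_nonneg_imp_nondecreasing[OF assms(1)])
    fix t assume t: "0 \<le> t" "t \<le> x"
    have "cos (pi / 3) \<le> cos t" using t True by (intro cos_monotone_0_pi_le) auto
    then show "\<exists>y. ((\<lambda>x. sin x - x / 2) has_real_derivative y) (at t) \<and> 0 \<le> y"
      by (intro exI[of _ "cos t - 1/2"]) (auto intro!: derivative_eq_intros simp: cos_60)
  qed
  then show ?thesis by simp
next
  case False
  have "sin (pi / 3) \<le> sin x" using False assms by (intro sin_monotone_2pi_le) auto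
  moreover have "1.73 \<le> sqrt 3" by (rule real_le_rsqrt) (simp add: power2_eq_square)
  moreover have "x / 2 \<le> 0.8" using assms(2) pi_approx(2) by simp
  ultimately show ?thesis by (simp add: sin_60)
qed

lemma exp_moment_ge_1: "1 \<le> exp_moment TYPE('d::finite)"
proof -
  have "(\<integral>z. 1 \<partial>(std_gaussian :: (real^'d) measure)) \<le> exp_moment TYPE('d)"
    unfolding exp_moment_def by (intro integral_mono integrable_exp_norm) auto
  then show ?thesis by simp
qed

text \<open>
  Markov's inequality.
\<close>

lemma gaussian_large_ball:
  "3 / 4 \<le> measure std_gaussian (ball (0 :: real^'d::finite) (4 * exp_moment TYPE('d)))"
proof -
  let ?\<kappa> = "exp_moment TYPE('d)"
  let ?B = "ball (0 :: real^'d) (4 * ?\<kappa>)"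
  have \<kappa>: "1 \<le> ?\<kappa>" by (rule exp_moment_ge_1)
  have "4 * ?\<kappa> * measure std_gaussian (- ?B) = (\<integral>z. 4 * ?\<kappa> * indicator (- ?B) z \<partial>std_gaussian)"
    by simp
  also have "\<dots> \<le> (\<integral>z. exp (6 * norm z) \<partial>(std_gaussian :: (real^'d) measure))"
  proof (intro integral_mono integrable_exp_norm integrable_mult_right integrable_real_indicator)
    fix z :: "real^'d"
    have "norm z \<le> exp (6 * norm z)" using exp_ge_add_one_self[of "6 * norm z"] norm_ge_zero[of z]
        by linarith
    then show "4 * ?\<kappa> * indicator (- ?B) z \<le> exp (6 * norm z)" by (auto simp: indicator_def)
  qed (auto simp: gauss.emeasure_eq_measure)
  finally have "4 * measure std_gaussian (- ?B) \<le> 1" using \<kappa> by (simp add: exp_moment_def)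
  moreover have "measure std_gaussian (- ?B) = 1 - measure std_gaussian ?B"
    using gauss.prob_compl[of ?B] by (simp add: Compl_eq_Diff_UNIV)
  ultimately show ?thesis by simp
qed

text \<open>
  The ball carries at least three quarters of the mass, and outside it \<open>G\<close> is at least \<open>-\<delta>\<close>.
\<close>

lemma mean_bound_imp_core_bound:
  fixes G :: "real^'d::finite \<Rightarrow> real"
  assumes [measurable]: "G \<in> borel_measurable borel" and bd: "\<And>z. \<bar>G z\<bar> \<le> \<delta>"
    and core: "\<And>z. norm z < 4 * exp_moment TYPE('d) \<Longrightarrow> x \<le> G z" and mean: "(\<integral>z. G z \<partial>std_gaussian)
        \<le> \<eta>"
    and \<eta>: "0 \<le> \<eta>"
  shows "x \<le> 4 / 3 * \<eta> + \<delta> / 3"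
proof (cases "x \<le> 0")
  case True
  then show ?thesis using bd[of 0] \<eta> by simp
next
  case False
  let ?B = "ball (0 :: real^'d) (4 * exp_moment TYPE('d))"
  define q where "q = measure std_gaussian ?B"
  have q: "3 / 4 \<le> q" unfolding q_def by (rule gaussian_large_ball)
  have \<delta>: "0 \<le> \<delta>" using bd[of 0] by simp
  have "x * q - \<delta> * (1 - q) = (\<integral>z. x * indicator ?B z - \<delta> * (1 - indicator ?B z) \<partial>std_gaussian)"
    by (simp add: q_def gauss.emeasure_eq_measure integrable_real_indicator)
  also have "\<dots> \<le> (\<integral>z. G z \<partial>std_gaussian)"
  proof (rule integral_mono)
    show "integrable std_gaussian (\<lambda>z. x * indicator ?B z - \<delta> * (1 - indicator ?B z))"
      by (simp add: gauss.emeasure_eq_measure integrable_real_indicator)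
    show "integrable std_gaussian G"
      using bd by (intro gauss.integrable_const_bound[where B = \<delta>]) auto
    show "x * indicator ?B z - \<delta> * (1 - indicator ?B z) \<le> G z" for z
      using core[of z] bd[of z] by (auto simp: indicator_def abs_le_iff)
  qed
  also have "\<dots> \<le> \<eta>" by (rule mean)
  finally have "x * q \<le> \<eta> + \<delta> * (1 - q)" by simp
  moreover have "x * (3 / 4) \<le> x * q" using q False by (intro mult_left_mono) auto
  moreover have "\<delta> * (1 - q) \<le> \<delta> * (1 / 4)" using q \<delta> by (intro mult_left_mono) auto
  ultimately show ?thesis by simp
qed

definition average :: "'w set \<Rightarrow> ('w \<Rightarrow> real) \<Rightarrow> real" where
  "average \<Omega> f = (\<Sum>\<omega>\<in>\<Omega>. f \<omega>) / card \<Omega>"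

lemma average_mono: "(\<And>\<omega>. \<omega> \<in> \<Omega> \<Longrightarrow> f \<omega> \<le> g \<omega>) \<Longrightarrow> average \<Omega> f \<le> average \<Omega> g"
  unfolding average_def by (intro divide_right_mono sum_mono) auto

lemma average_add: "average \<Omega> (\<lambda>\<omega>. f \<omega> + g \<omega>) = average \<Omega> f + average \<Omega> g"
  and average_diff: "average \<Omega> (\<lambda>\<omega>. f \<omega> - g \<omega>) = average \<Omega> f - average \<Omega> g"
  and average_cmult: "average \<Omega> (\<lambda>\<omega>. c * f \<omega>) = c * average \<Omega> f"
  and average_sum: "average \<Omega> (\<lambda>\<omega>. \<Sum>i\<in>I. h i \<omega>) = (\<Sum>i\<in>I. average \<Omega> (h i))"
  unfolding average_def
  by (auto simp: sum.distrib add_divide_distrib sum_subtractf diff_divide_distrib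
      sum_distrib_left[symmetric]
      sum_divide_distrib[symmetric] sum.swap[of _ I])

lemma abs_average_le: "\<bar>average \<Omega> f\<bar> \<le> average \<Omega> (\<lambda>\<omega>. \<bar>f \<omega>\<bar>)"
  unfolding average_def by (simp add: divide_right_mono)

lemma average_const: "finite \<Omega> \<Longrightarrow> \<Omega> \<noteq> {} \<Longrightarrow> average \<Omega> (\<lambda>_. c) = c"
  by (simp add: average_def)

lemma average_cong: "(\<And>\<omega>. \<omega> \<in> \<Omega> \<Longrightarrow> f \<omega> = g \<omega>) \<Longrightarrow> average \<Omega> f = average \<Omega> g"
  unfolding average_def by (auto intro: sum.cong)

lemma integral_average:
  assumes "\<And>\<omega>. \<omega> \<in> \<Omega> \<Longrightarrow> integrable M (f \<omega>)"
  shows "(\<integral>z. average \<Omega> (\<lambda>\<omega>. f \<omega> z) \<partial>M) = average \<Omega> (\<lambda>\<omega>. \<integral>z. f \<omega> z \<partial>M)"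
  unfolding average_def using assms by (simp add: Bochner_Integration.integral_sum)

definition convex_borel :: "(real^'d::finite) set set" where
  "convex_borel = {A. convex A \<and> A \<in> sets borel}"

definition discrepancy :: "'w set \<Rightarrow> ('w \<Rightarrow> real^'d::finite) \<Rightarrow> real" where
  "discrepancy \<Omega> W = (SUP A\<in>convex_borel. \<bar>average \<Omega> (\<lambda>\<omega>. indicator A (W \<omega>)) - measure
      std_gaussian A\<bar>)"

text \<open>
  The constant of \<open>gaussian_boundary_layer\<close>.
\<close>

definition layer_const :: "'d::finite itself \<Rightarrow> real" where
  "layer_const _ = 32 * (real CARD('d))\<^sup>2"

lemma layer_const_ge_1: "1 \<le> layer_const TYPE('d::finite)"
proof -
  have "1 \<le> real CARD('d)" by (simp add: Suc_leI)
  then have "1 \<le> (real CARD('d))\<^sup>2" by simp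
  then show ?thesis unfolding layer_const_def by linarith
qed

locale finite_sample =
  fixes \<Omega> :: "'w set" and W :: "'w \<Rightarrow> real^'d::finite"
  assumes \<Omega>: "finite \<Omega>" "\<Omega> \<noteq> {}"
begin

abbreviation "avg \<equiv> average \<Omega>"
abbreviation "\<delta> \<equiv> discrepancy \<Omega> W"

lemma avg_const [simp]: "avg (\<lambda>_. c) = c" using average_const[OF \<Omega>] .

lemma avg_indicator: "0 \<le> avg (\<lambda>\<omega>. indicator (A \<omega>) (X \<omega>))" "avg (\<lambda>\<omega>. indicator (A \<omega>) (X \<omega>)) \<le> 1"
proof -
  have "avg (\<lambda>_. 0) \<le> avg (\<lambda>\<omega>. indicator (A \<omega>) (X \<omega>))" by (rule average_mono) simp
  then show "0 \<le> avg (\<lambda>\<omega>. indicator (A \<omega>) (X \<omega>))" by simp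
  have "avg (\<lambda>\<omega>. indicator (A \<omega>) (X \<omega>)) \<le> avg (\<lambda>_. 1)" by (rule average_mono) (simp add:
      indicator_def)
  then show "avg (\<lambda>\<omega>. indicator (A \<omega>) (X \<omega>)) \<le> 1" by simp
qed

lemma deviation_le_1: "\<bar>avg (\<lambda>\<omega>. indicator A (W \<omega>)) - measure std_gaussian A\<bar> \<le> 1"
  using avg_indicator[of "\<lambda>_. A" W] gauss.prob_le_1[of A] measure_nonneg[of std_gaussian A] by
      linarith

lemma discrepancy_upper:
  assumes "convex A" "A \<in> sets borel"
  shows "\<bar>avg (\<lambda>\<omega>. indicator A (W \<omega>)) - measure std_gaussian A\<bar> \<le> \<delta>"
  unfolding discrepancy_def
  by (rule cSUP_upper) (use assms deviation_le_1 in \<open>auto simp: convex_borel_def intro!: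
      bdd_aboveI2\<close>)

lemma discrepancy_least:
  assumes "\<And>A. convex A \<Longrightarrow> A \<in> sets borel \<Longrightarrow> \<bar>avg (\<lambda>\<omega>. indicator A (W \<omega>)) - measure std_gaussian A\<bar>
      \<le> c"
  shows "\<delta> \<le> c"
proof -
  have "({} :: (real^'d) set) \<in> convex_borel" by (simp add: convex_borel_def)
  then show ?thesis unfolding discrepancy_def
    by (intro cSUP_least) (use assms in \<open>auto simp: convex_borel_def\<close>)
qed

lemma discrepancy_nonneg: "0 \<le> \<delta>" and discrepancy_le_1: "\<delta> \<le> 1"
  using discrepancy_upper[of "{}"] discrepancy_least[OF deviation_le_1] by auto

lemma discrepancy_affine:
  assumes "convex A" "A \<in> sets borel"
  shows "\<bar>avg (\<lambda>\<omega>. indicator A (c *\<^sub>R W \<omega> + v)) - measure std_gaussian {w. c *\<^sub>R w + v \<in> A}\<bar> \<le> \<delta>"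
proof -
  have "convex {w. c *\<^sub>R w + v \<in> A}"
  proof (rule convexI)
    fix x y :: "real^'d" and s t :: real
    assume *: "x \<in> {w. c *\<^sub>R w + v \<in> A}" "y \<in> {w. c *\<^sub>R w + v \<in> A}" "0 \<le> s" "0 \<le> t" "s + t = 1"
    then have "s *\<^sub>R (c *\<^sub>R x + v) + t *\<^sub>R (c *\<^sub>R y + v) \<in> A" using assms(1) by (intro convexD) auto
    moreover have "s *\<^sub>R (c *\<^sub>R x + v) + t *\<^sub>R (c *\<^sub>R y + v) = c *\<^sub>R (s *\<^sub>R x + t *\<^sub>R y) + (s + t)
        *\<^sub>R v"
      by (simp add: algebra_simps)
    ultimately show "s *\<^sub>R x + t *\<^sub>R y \<in> {w. c *\<^sub>R w + v \<in> A}" using * by simp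
  qed
  moreover have "{w. c *\<^sub>R w + v \<in> A} \<in> sets borel" using assms(2) by measurable
  ultimately show ?thesis using discrepancy_upper[of "{w. c *\<^sub>R w + v \<in> A}"] by (simp add:
      indicator_def)
qed

lemma scaled_thicken: "c > 0 \<Longrightarrow> {w. c *\<^sub>R w \<in> thicken A r} = thicken {w. c *\<^sub>R w \<in> A} (r / c)"
  and scaled_erode: "c > 0 \<Longrightarrow> {w. c *\<^sub>R w \<in> erode A r} = erode {w. c *\<^sub>R w \<in> A} (r / c)"
  for A :: "(real^'d) set"
proof -
  show th: "{w. c *\<^sub>R w \<in> thicken A r} = thicken {w. c *\<^sub>R w \<in> A} (r / c)" if c: "c > 0" for A ::
      "(real^'d) set"
  proof (intro set_eqI)
    fix w :: "real^'d"
    have d: "dist y (c *\<^sub>R w) < r \<longleftrightarrow> dist (y /\<^sub>R c) w < r / c" for y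
    proof -
      have "y - c *\<^sub>R w = c *\<^sub>R (y /\<^sub>R c - w)" using c by (simp add: algebra_simps)
      then have "dist y (c *\<^sub>R w) = c * dist (y /\<^sub>R c) w" using c by (simp add: dist_norm)
      then show ?thesis using c by (simp add: field_simps)
    qed
    have "(\<exists>y\<in>A. dist y (c *\<^sub>R w) < r) \<longleftrightarrow> (\<exists>u. c *\<^sub>R u \<in> A \<and> dist u w < r / c)"
      unfolding d using c by (metis scaleR_scaleR divideR_right less_numeral_extra(3) scaleR_one
          left_inverse inverse_eq_divide mult.commute)
    then show "w \<in> {w. c *\<^sub>R w \<in> thicken A r} \<longleftrightarrow> w \<in> thicken {w. c *\<^sub>R w \<in> A} (r / c)"
      by (auto simp: thicken_def)
  qed
  show "{w. c *\<^sub>R w \<in> erode A r} = erode {w. c *\<^sub>R w \<in> A} (r / c)" if c: "c > 0"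
    using th[OF c, of "- A"] unfolding erode_eq_Compl by (auto simp: set_eq_iff Compl_eq)
qed

text \<open>
  The layer is a difference of two convex sets, so its probability under the law of \<open>c W\<close> is at
  most \<open>2\<delta>\<close> more than under that of \<open>c Z\<close>.  Dividing the width by \<open>c\<close> is harmless for \<open>c \<ge> 1/2\<close>;
  for smaller \<open>c\<close> the width \<open>r \<ge> \<sigma>\<close> is at least \<open>1/2\<close> and the claim is trivial.
\<close>

lemma sample_boundary_layer:
  assumes A: "convex A" and cs: "0 \<le> c" "0 < \<sigma>" "c\<^sup>2 + \<sigma>\<^sup>2 = 1" and r: "\<sigma> \<le> r"
  shows "avg (\<lambda>\<omega>. indicator (thicken A r - erode A r) (c *\<^sub>R W \<omega>)) \<le> 2 * layer_const TYPE('d) * r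
      + 2 * \<delta>"
proof (cases "1 / 2 \<le> c")
  case True
  have c: "c > 0" and r0: "r > 0" using True cs r by auto
  let ?T = "thicken A r" and ?E = "erode A r"
  have TE: "?E \<subseteq> ?T" using erode_subset[OF r0, of A] subset_thicken[OF r0, of A] by blast
  have "convex {w. c *\<^sub>R w \<in> A}"
    using convex_linear_vimage[OF linear_scaleR A, of c] by (simp add: vimage_def)
  then have "measure std_gaussian (thicken {w. c *\<^sub>R w \<in> A} (r / c) - erode {w. c *\<^sub>R w \<in> A} (r /
      c)) \<le> layer_const TYPE('d) * (r / c)"
    using gaussian_boundary_layer[of "{w. c *\<^sub>R w \<in> A}" "r / c"] r0 c by (simp add: layer_const_def)
  also have "\<dots> \<le> layer_const TYPE('d) * (2 * r)"
    using True c r0 layer_const_ge_1[where 'd = 'd] by (intro mult_left_mono) (auto simp: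
        field_simps)
  finally have "measure std_gaussian ({w. c *\<^sub>R w \<in> ?T} - {w. c *\<^sub>R w \<in> ?E}) \<le> 2 * layer_const
      TYPE('d) * r"
    by (simp add: scaled_thicken[OF c] scaled_erode[OF c])
  moreover have "measure std_gaussian ({w. c *\<^sub>R w \<in> ?T} - {w. c *\<^sub>R w \<in> ?E})
      = measure std_gaussian {w. c *\<^sub>R w \<in> ?T} - measure std_gaussian {w. c *\<^sub>R w \<in> ?E}"
    using TE by (intro gauss.finite_measure_Diff) auto
  moreover have "avg (\<lambda>\<omega>. indicator (?T - ?E) (c *\<^sub>R W \<omega>))
      = avg (\<lambda>\<omega>. indicator ?T (c *\<^sub>R W \<omega>)) - avg (\<lambda>\<omega>. indicator ?E (c *\<^sub>R W \<omega>))"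
    unfolding average_diff[symmetric] using TE by (intro average_cong) (auto simp: indicator_def)
  moreover have "\<bar>avg (\<lambda>\<omega>. indicator ?T (c *\<^sub>R W \<omega>)) - measure std_gaussian {w. c *\<^sub>R w \<in> ?T}\<bar> \<le> \<delta>"
    using discrepancy_affine[OF convex_thicken[OF A], of r c 0] by simp
  moreover have "\<bar>avg (\<lambda>\<omega>. indicator ?E (c *\<^sub>R W \<omega>)) - measure std_gaussian {w. c *\<^sub>R w \<in> ?E}\<bar> \<le> \<delta>"
    using discrepancy_affine[OF convex_erode[OF A], of r c 0] by simp
  ultimately show ?thesis by linarith
next
  case False
  have "c\<^sup>2 \<le> (1/2)\<^sup>2" using False cs by (intro power_mono) auto
  then have "(1/2)\<^sup>2 \<le> \<sigma>\<^sup>2" using cs(3) by (simp add: power2_eq_square)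
  then have "1/2 \<le> \<sigma>" using cs by (intro power2_le_imp_le[of "1/2" \<sigma>]) auto
  then have "1 \<le> 2 * r" using r by simp
  also have "\<dots> \<le> layer_const TYPE('d) * (2 * r)" using layer_const_ge_1[where 'd = 'd] r cs by
      (simp add: mult_le_cancel_right1)
  finally show ?thesis
    using avg_indicator(2)[of "\<lambda>_. thicken A r - erode A r" "\<lambda>\<omega>. c *\<^sub>R W \<omega>"] discrepancy_nonneg by
        simp
qed

text \<open>
  Suppose \<open>W\<close> overcharges \<open>A\<close>.  Compare \<open>cos \<theta> W + sin \<theta> Z\<close> with the Gaussian law on a
  neighbourhood of (the dilate of) \<open>A\<close> of width \<open>r = 4 \<kappa> sin \<theta>\<close>.  When \<open>|Z|\<close> is below its typical
  bound \<open>4 \<kappa>\<close>, this neighbourhood catches all of \<open>W \<in> A\<close>, while its Gaussian measure exceeds that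
  of \<open>A\<close> by a boundary layer at most; for the other values of \<open>Z\<close> the comparison loses at most
  \<open>\<delta>\<close>.  If \<open>W\<close> undercharges \<open>A\<close>, the same works with the eroded set.
\<close>

lemma discrepancy_smoothing:
  assumes \<theta>: "0 < \<theta>" "\<theta> < pi / 2" and \<eta>: "0 \<le> \<eta>"
    and le: "\<And>A. convex A \<Longrightarrow> A \<in> sets borel \<Longrightarrow> \<bar>avg (\<lambda>\<omega>. smoothed A \<theta> (W \<omega>)) - measure std_gaussian
        A\<bar> \<le> \<eta>"
  shows "\<delta> \<le> 4 / 3 * \<eta> + \<delta> / 3 + 8 * exp_moment TYPE('d) * layer_const TYPE('d) * (sin \<theta> / cos \<theta>)"
proof (rule discrepancy_least)
  fix A :: "(real^'d) set" assume A: "convex A" "A \<in> sets borel"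
  define c \<sigma> where "c = cos \<theta>" "\<sigma> = sin \<theta>"
  have c: "c > 0" and s: "\<sigma> > 0" using \<theta> by (auto simp: c_\<sigma>_def intro: cos_gt_zero sin_gt_zero2)
  have cs: "c\<^sup>2 + \<sigma>\<^sup>2 = 1" by (simp add: c_\<sigma>_def)
  have \<kappa>: "1 \<le> exp_moment TYPE('d)" by (rule exp_moment_ge_1)
  \<comment> \<open>The size of \<open>sin \<theta> Z\<close> on the event that \<open>|Z|\<close> is below its typical bound.\<close>
  define r where "r = 4 * exp_moment TYPE('d) * \<sigma>"
  have r: "r > 0" using \<kappa> s by (simp add: r_def)
  define \<rho> where "\<rho> = layer_const TYPE('d) * (2 * r / c)"
  define A' where "A' = {y. y /\<^sub>R c \<in> A}"
  have A': "convex A'"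
    using convex_linear_vimage[OF linear_scaleR A(1), of "inverse c"] by (simp add: A'_def
        vimage_def)
  have AA': "c *\<^sub>R w \<in> A' \<longleftrightarrow> w \<in> A" for w using c by (simp add: A'_def)
  define G where "G = (\<lambda>U z. avg (\<lambda>\<omega>. indicator U (c *\<^sub>R W \<omega> + \<sigma> *\<^sub>R z)) - measure std_gaussian
      {w. c *\<^sub>R w + \<sigma> *\<^sub>R z \<in> U})"
  have Gm: "G U \<in> borel_measurable borel" if [measurable]: "U \<in> sets borel" for U
    unfolding G_def average_def by measurable
  have Gb: "\<bar>G U z\<bar> \<le> \<delta>" if "convex U" "U \<in> sets borel" for U z
    unfolding G_def by (rule discrepancy_affine[OF that])
  have GI: "\<bar>\<integral>z. G U z \<partial>std_gaussian\<bar> \<le> \<eta>" if U: "convex U" and [measurable]: "U \<in> sets borel" for U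
  proof -
    have i1: "integrable std_gaussian (\<lambda>z. indicator U (c *\<^sub>R W \<omega> + \<sigma> *\<^sub>R z) :: real)" for \<omega>
      by (rule gauss.integrable_const_bound[where B = 1]) (auto simp: indicator_def)
    have i2: "integrable std_gaussian (\<lambda>z::real^'d. measure std_gaussian {w. c *\<^sub>R w + \<sigma> *\<^sub>R z \<in>
        U})"
      by (rule gauss.integrable_const_bound[where B = 1]) auto
    have i3: "integrable std_gaussian (\<lambda>z. avg (\<lambda>\<omega>. indicator U (c *\<^sub>R W \<omega> + \<sigma> *\<^sub>R z)))"
      unfolding average_def by (intro integrable_divide Bochner_Integration.integrable_sum i1)
    have "(\<integral>z. G U z \<partial>std_gaussian) = avg (\<lambda>\<omega>. smoothed U \<theta> (W \<omega>)) - measure std_gaussian U"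
    proof -
      have "(\<integral>z. G U z \<partial>std_gaussian) = (\<integral>z. avg (\<lambda>\<omega>. indicator U (c *\<^sub>R W \<omega> + \<sigma> *\<^sub>R z))
          \<partial>std_gaussian)
          - (\<integral>z. measure std_gaussian {w. c *\<^sub>R w + \<sigma> *\<^sub>R z \<in> U} \<partial>std_gaussian)"
        unfolding G_def by (rule Bochner_Integration.integral_diff[OF i3 i2])
      also have "(\<integral>z. avg (\<lambda>\<omega>. indicator U (c *\<^sub>R W \<omega> + \<sigma> *\<^sub>R z)) \<partial>std_gaussian) = avg (\<lambda>\<omega>.
          smoothed U \<theta> (W \<omega>))"
        unfolding smoothed_def c_\<sigma>_def[symmetric] by (rule integral_average[OF i1])
      also have "(\<integral>z. measure std_gaussian {w. c *\<^sub>R w + \<sigma> *\<^sub>R z \<in> U} \<partial>std_gaussian) = measure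
          std_gaussian U"
        by (rule std_gaussian_mixture[OF \<open>U \<in> sets borel\<close> cs s])
      finally show ?thesis .
    qed
    then show ?thesis using le[OF U] by simp
  qed
  have dist2: "dist y w < 2 * r / c" if "dist (c *\<^sub>R y) (c *\<^sub>R w + \<sigma> *\<^sub>R z) < r" "norm z < 4 *
      exp_moment TYPE('d)" for y w z :: "real^'d"
  proof -
    have "c * dist y w = dist (c *\<^sub>R y) (c *\<^sub>R w)" using c by (simp add: dist_norm flip:
        scaleR_diff_right)
    also have "\<dots> \<le> dist (c *\<^sub>R y) (c *\<^sub>R w + \<sigma> *\<^sub>R z) + dist (c *\<^sub>R w + \<sigma> *\<^sub>R z) (c *\<^sub>R w)" by
        (rule dist_triangle)
    also have "dist (c *\<^sub>R w + \<sigma> *\<^sub>R z) (c *\<^sub>R w) < r" using s that by (simp add: dist_norm r_def)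
    finally show ?thesis using that c by (simp add: field_simps)
  qed
  have layer: "measure std_gaussian (thicken A (2 * r / c) - erode A (2 * r / c)) \<le> \<rho>"
    unfolding \<rho>_def using gaussian_boundary_layer[OF A(1), of "2 * r / c"] r c by (simp add:
        layer_const_def)
  have rc: "0 < 2 * r / c" using r c by simp
  have up: "measure std_gaussian (thicken A (2 * r / c)) \<le> measure std_gaussian A + \<rho>"
  proof -
    have "measure std_gaussian (thicken A (2 * r / c)) \<le> measure std_gaussian (A \<union> (thicken A (2 *
        r / c) - erode A (2 * r / c)))"
      using erode_subset[OF rc, of A] A by (intro gauss.finite_measure_mono) auto
    also have "\<dots> \<le> measure std_gaussian A + measure std_gaussian (thicken A (2 * r / c) - erode A
        (2 * r / c))"
      using A by (intro measure_Un_le) auto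
    finally show ?thesis using layer by simp
  qed
  have down: "measure std_gaussian A - \<rho> \<le> measure std_gaussian (erode A (2 * r / c))"
  proof -
    have "measure std_gaussian A \<le> measure std_gaussian (erode A (2 * r / c) \<union> (thicken A (2 * r /
        c) - erode A (2 * r / c)))"
      using subset_thicken[OF rc, of A] A by (intro gauss.finite_measure_mono) auto
    also have "\<dots> \<le> measure std_gaussian (erode A (2 * r / c)) + measure std_gaussian (thicken A (2
        * r / c) - erode A (2 * r / c))"
      by (intro measure_Un_le) auto
    finally show ?thesis using layer by simp
  qed
  let ?x = "avg (\<lambda>\<omega>. indicator A (W \<omega>)) - measure std_gaussian A"
  have "?x - \<rho> \<le> 4 / 3 * \<eta> + \<delta> / 3"
  proof (rule mean_bound_imp_core_bound[OF Gm Gb _ _ \<eta>])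
    let ?U = "thicken A' r"
    show U: "?U \<in> sets borel" "?U \<in> sets borel" "convex ?U" by (auto intro: convex_thicken A')
    show "(\<integral>z. G ?U z \<partial>std_gaussian) \<le> \<eta>" using GI[OF U(3,1)] by simp
    fix z :: "real^'d" assume z: "norm z < 4 * exp_moment TYPE('d)"
    have "avg (\<lambda>\<omega>. indicator A (W \<omega>)) \<le> avg (\<lambda>\<omega>. indicator ?U (c *\<^sub>R W \<omega> + \<sigma> *\<^sub>R z))"
    proof (rule average_mono)
      fix \<omega>
      have "c *\<^sub>R W \<omega> + \<sigma> *\<^sub>R z \<in> ?U" if "W \<omega> \<in> A"
        unfolding thicken_def using that z s by (intro UN_I[of "c *\<^sub>R W \<omega>"]) (auto simp: AA'
            dist_norm r_def)
      then show "indicator A (W \<omega>) \<le> (indicator ?U (c *\<^sub>R W \<omega> + \<sigma> *\<^sub>R z) :: real)" by (auto simp: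
          indicator_def)
    qed
    moreover have "measure std_gaussian {w. c *\<^sub>R w + \<sigma> *\<^sub>R z \<in> ?U} \<le> measure std_gaussian
        (thicken A (2 * r / c))"
    proof (rule gauss.finite_measure_mono)
      show "{w. c *\<^sub>R w + \<sigma> *\<^sub>R z \<in> ?U} \<subseteq> thicken A (2 * r / c)"
      proof safe
        fix w assume "c *\<^sub>R w + \<sigma> *\<^sub>R z \<in> ?U"
        then obtain y where y: "y \<in> A'" "dist y (c *\<^sub>R w + \<sigma> *\<^sub>R z) < r" by (auto simp: thicken_def)
        then have "dist (y /\<^sub>R c) w < 2 * r / c" using dist2[of "y /\<^sub>R c" w z] z c by simp
        then show "w \<in> thicken A (2 * r / c)" using y by (auto simp: thicken_def A'_def)
      qed
    qed simp
    ultimately show "?x - \<rho> \<le> G ?U z" unfolding G_def using up by linarith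
  qed
  moreover have "- ?x - \<rho> \<le> 4 / 3 * \<eta> + \<delta> / 3"
  proof (rule mean_bound_imp_core_bound[where G = "\<lambda>z. - G (erode A' r) z", OF _ _ _ _ \<eta>])
    let ?U = "erode A' r"
    have U: "?U \<in> sets borel" "convex ?U" by (auto intro: convex_erode A')
    show "(\<lambda>z. - G ?U z) \<in> borel_measurable borel" using Gm[OF U(1)] by simp
    show "\<bar>- G ?U z\<bar> \<le> \<delta>" for z using Gb[OF U(2,1)] by simp
    show "(\<integral>z. - G ?U z \<partial>std_gaussian) \<le> \<eta>" using GI[OF U(2,1)] by simp
    fix z :: "real^'d" assume z: "norm z < 4 * exp_moment TYPE('d)"
    have "avg (\<lambda>\<omega>. indicator ?U (c *\<^sub>R W \<omega> + \<sigma> *\<^sub>R z)) \<le> avg (\<lambda>\<omega>. indicator A (W \<omega>))"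
    proof (rule average_mono)
      fix \<omega>
      have "W \<omega> \<in> A" if "c *\<^sub>R W \<omega> + \<sigma> *\<^sub>R z \<in> ?U"
        using that z s by (auto simp: erode_def subset_eq AA'[symmetric] dist_norm r_def)
      then show "indicator ?U (c *\<^sub>R W \<omega> + \<sigma> *\<^sub>R z) \<le> (indicator A (W \<omega>) :: real)" by (auto simp:
          indicator_def)
    qed
    moreover have "measure std_gaussian (erode A (2 * r / c)) \<le> measure std_gaussian {w. c *\<^sub>R w +
        \<sigma> *\<^sub>R z \<in> ?U}"
    proof (rule gauss.finite_measure_mono)
      show "erode A (2 * r / c) \<subseteq> {w. c *\<^sub>R w + \<sigma> *\<^sub>R z \<in> ?U}"
      proof safe
        fix w assume w: "w \<in> erode A (2 * r / c)"
        have "y \<in> A'" if "dist (c *\<^sub>R w + \<sigma> *\<^sub>R z) y < r" for y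
          using dist2[of "y /\<^sub>R c" w z] z c that w by (auto simp: erode_def subset_eq A'_def
              dist_commute)
        then show "c *\<^sub>R w + \<sigma> *\<^sub>R z \<in> ?U" by (auto simp: erode_def)
      qed
    qed measurable
    ultimately show "- ?x - \<rho> \<le> - G ?U z" unfolding G_def using down by linarith
  qed
  moreover have "\<rho> = 8 * exp_moment TYPE('d) * layer_const TYPE('d) * (sin \<theta> / cos \<theta>)"
    by (simp add: \<rho>_def r_def c_\<sigma>_def)
  ultimately show "\<bar>?x\<bar> \<le> 4 / 3 * \<eta> + \<delta> / 3 + 8 * exp_moment TYPE('d) * layer_const TYPE('d) *
      (sin \<theta> / cos \<theta>)" by linarith
qed

end

section \<open>Walks with nearly constant diffusion\<close>

text \<open>
  A finite sample space with bijections \<open>move i\<close> that displace \<open>W\<close> by \<open>step i\<close>.  The steps add up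
  to \<open>-4 W\<close>, and the second and third order sums of the steps are within \<open>b\<close> and \<open>a b\<close> of \<open>8 I\<close>
  and \<open>0\<close> in mean square.  The values \<open>4\<close> and \<open>8 = 2 * 4\<close> are those of the walk on permutations by
  moves to the end and to the front; their ratio makes the standard Gaussian law approximately
  stationary.
\<close>

locale balanced_walk = finite_sample \<Omega> W
  for \<Omega> :: "'w set" and W :: "'w \<Rightarrow> real^'d::finite" +
  fixes I :: "'i set" and move :: "'i \<Rightarrow> 'w \<Rightarrow> 'w" and step :: "'i \<Rightarrow> 'w \<Rightarrow> real^'d" and a b :: real
  assumes I: "finite I"
    and move: "\<And>i. i \<in> I \<Longrightarrow> bij_betw (move i) \<Omega> \<Omega>"
    and step: "\<And>i \<omega>. i \<in> I \<Longrightarrow> \<omega> \<in> \<Omega> \<Longrightarrow> W (move i \<omega>) = W \<omega> + step i \<omega>"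
    and drift: "\<And>\<omega>. \<omega> \<in> \<Omega> \<Longrightarrow> (\<Sum>i\<in>I. step i \<omega>) = - 4 *\<^sub>R W \<omega>"
    and step_le: "\<And>i \<omega>. i \<in> I \<Longrightarrow> \<omega> \<in> \<Omega> \<Longrightarrow> norm (step i \<omega>) \<le> a"
    and second: "\<And>r s. average \<Omega> (\<lambda>\<omega>. ((\<Sum>i\<in>I. step i \<omega> $ r * step i \<omega> $ s) - (if r = s then 8 else
        0))\<^sup>2) \<le> b\<^sup>2"
    and third: "\<And>r s t. average \<Omega> (\<lambda>\<omega>. (\<Sum>i\<in>I. step i \<omega> $ r * step i \<omega> $ s * step i \<omega> $ t)\<^sup>2) \<le> (a
        * b)\<^sup>2"
    and card_I: "card I * a ^ 4 \<le> b\<^sup>2"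
    and ab: "0 < a" "a \<le> b"
begin

definition second_error :: "'d \<Rightarrow> 'd \<Rightarrow> 'w \<Rightarrow> real" where
  "second_error r s \<omega> = (\<Sum>i\<in>I. step i \<omega> $ r * step i \<omega> $ s) - (if r = s then 8 else 0)"

definition third_sum :: "'d \<Rightarrow> 'd \<Rightarrow> 'd \<Rightarrow> 'w \<Rightarrow> real" where
  "third_sum r s t \<omega> = (\<Sum>i\<in>I. step i \<omega> $ r * step i \<omega> $ s * step i \<omega> $ t)"

definition hermite2_error :: "'w \<Rightarrow> real^'d \<Rightarrow> real" where
  "hermite2_error \<omega> z = (\<Sum>i\<in>I. hermite2 (step i \<omega>) z) - 8 * (\<Sum>r\<in>UNIV. hermite2 (axis r 1) z)"

definition hermite3_sum :: "'w \<Rightarrow> real^'d \<Rightarrow> real" where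
  "hermite3_sum \<omega> z = (\<Sum>i\<in>I. hermite3 (step i \<omega>) z)"

lemma inner_sq_components: "(v \<bullet> z)\<^sup>2 = (\<Sum>r\<in>UNIV. \<Sum>s\<in>UNIV. v $ r * v $ s * (z $ r * z $ s))"
  for v z :: "real^'d"
  by (simp add: inner_vec_def power2_eq_square sum_product ac_simps)

lemma norm_sq_components: "(norm v)\<^sup>2 = (\<Sum>r\<in>UNIV. \<Sum>s\<in>UNIV. v $ r * v $ s * (if r = s then 1 else
    0))"
  for v :: "real^'d"
  by (simp add: inner_vec_def power2_eq_square if_distrib[where f = "\<lambda>c. _ * c"] cong: if_cong
      flip: dot_square_norm[unfolded power2_eq_square])

lemma hermite2_error_eq:
  "hermite2_error \<omega> z = (\<Sum>r\<in>UNIV. \<Sum>s\<in>UNIV. second_error r s \<omega> * (z $ r * z $ s - (if r = s then 1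
      else 0)))"
proof -
  have h: "hermite2 v z = (\<Sum>r\<in>UNIV. \<Sum>s\<in>UNIV. v $ r * v $ s * (z $ r * z $ s - (if r = s then 1
      else 0)))" for v :: "real^'d"
    unfolding hermite2_def inner_sq_components norm_sq_components
    by (simp add: sum_subtractf[symmetric] right_diff_distrib)
  have "(\<Sum>i\<in>I. hermite2 (step i \<omega>) z)
      = (\<Sum>r\<in>UNIV. \<Sum>s\<in>UNIV. (\<Sum>i\<in>I. step i \<omega> $ r * step i \<omega> $ s) * (z $ r * z $ s - (if r = s then 1
          else 0)))"
    unfolding h sum_distrib_right by (subst sum.swap, rule sum.cong[OF refl], rule sum.swap)
  moreover have "(\<Sum>r\<in>UNIV. hermite2 (axis r 1) z) = (\<Sum>r\<in>UNIV. z $ r * z $ r - 1)"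
    by (simp add: hermite2_def inner_axis' power2_eq_square norm_axis_1)
  then have "8 * (\<Sum>r\<in>UNIV. hermite2 (axis r 1) z)
      = (\<Sum>r\<in>UNIV. \<Sum>s\<in>UNIV. (if r = s then 8 else 0) * (z $ r * z $ s - (if r = s then 1 else 0)))"
    by (simp add: sum_distrib_left if_distrib[where f = "\<lambda>c. c * _"] cong: if_cong)
  ultimately show ?thesis
    by (simp add: hermite2_error_def second_error_def sum_subtractf[symmetric] left_diff_distrib)
qed

lemma hermite3_sum_eq:
  "hermite3_sum \<omega> z = (\<Sum>r\<in>UNIV. \<Sum>s\<in>UNIV. \<Sum>t\<in>UNIV.
      third_sum r s t \<omega> * (z $ r * z $ s * z $ t - (if r = s then 3 * z $ t else 0)))"
proof -
  have h: "hermite3 v z = (\<Sum>r\<in>UNIV. \<Sum>s\<in>UNIV. \<Sum>t\<in>UNIV.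
      v $ r * v $ s * v $ t * (z $ r * z $ s * z $ t - (if r = s then 3 * z $ t else 0)))" for v
          :: "real^'d"
  proof -
    have sq: "(v \<bullet> z)\<^sup>2 - 3 * (norm v)\<^sup>2 = (\<Sum>r\<in>UNIV. \<Sum>s\<in>UNIV. v $ r * v $ s * (z $ r * z $ s - (if
        r = s then 3 else 0)))"
      unfolding inner_sq_components norm_sq_components sum_distrib_left sum_subtractf[symmetric]
      by (intro sum.cong refl) (auto simp: algebra_simps)
    have "hermite3 v z = ((v \<bullet> z)\<^sup>2 - 3 * (norm v)\<^sup>2) * (v \<bullet> z)"
      by (simp add: hermite3_def algebra_simps power2_eq_square power3_eq_cube)
    also have "\<dots> = (\<Sum>r\<in>UNIV. \<Sum>s\<in>UNIV. v $ r * v $ s * (z $ r * z $ s - (if r = s then 3 else 0)))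
        * (\<Sum>t\<in>UNIV. v $ t * z $ t)"
      unfolding sq by (simp add: inner_vec_def)
    also have "\<dots> = (\<Sum>r\<in>UNIV. \<Sum>s\<in>UNIV. \<Sum>t\<in>UNIV. (v $ r * v $ s * (z $ r * z $ s - (if r = s then 3
        else 0))) * (v $ t * z $ t))"
      by (simp only: sum_distrib_right, simp only: sum_distrib_left)
    also have "\<dots> = (\<Sum>r\<in>UNIV. \<Sum>s\<in>UNIV. \<Sum>t\<in>UNIV.
      v $ r * v $ s * v $ t * (z $ r * z $ s * z $ t - (if r = s then 3 * z $ t else 0)))"
      by (intro sum.cong refl) (auto simp: algebra_simps)
    finally show ?thesis .
  qed
  show ?thesis unfolding hermite3_sum_def h third_sum_def sum_distrib_right
    by (subst sum.swap, rule sum.cong[OF refl], subst sum.swap, rule sum.cong[OF refl], rule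
        sum.swap)
qed

lemma exp_bounds:
  fixes x :: real assumes "0 \<le> x"
  shows "x\<^sup>2 + 1 \<le> exp (5 * x)" "x ^ 3 + 3 * x \<le> 4 * exp (5 * x)"
proof -
  have e: "1 + x \<le> exp x" by (rule exp_ge_add_one_self)
  have "x\<^sup>2 + 1 \<le> (1 + x)\<^sup>2" using assms by (simp add: power2_eq_square algebra_simps)
  also have "\<dots> \<le> exp (2 * x)" using power_le_exp[OF assms, of 2] by simp
  also have "\<dots> \<le> exp (5 * x)" using assms by simp
  finally show "x\<^sup>2 + 1 \<le> exp (5 * x)" .
  have "x ^ 3 \<le> (1 + x) ^ 3" using assms by (intro power_mono) auto
  also have "\<dots> \<le> exp (3 * x)" using power_le_exp[OF assms, of 3] by simp
  also have "\<dots> \<le> exp (5 * x)" using assms by simp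
  finally have "x ^ 3 \<le> exp (5 * x)" .
  moreover have "exp x \<le> exp (5 * x)" using assms by simp
  ultimately show "x ^ 3 + 3 * x \<le> 4 * exp (5 * x)" using e by linarith
qed

definition second_size :: "'w \<Rightarrow> real" where
  "second_size \<omega> = (\<Sum>r\<in>UNIV. \<Sum>s\<in>UNIV. \<bar>second_error r s \<omega>\<bar>)"

definition third_size :: "'w \<Rightarrow> real" where
  "third_size \<omega> = (\<Sum>r\<in>UNIV. \<Sum>s\<in>UNIV. \<Sum>t\<in>UNIV. \<bar>third_sum r s t \<omega>\<bar>)"

lemma hermite2_error_le: "\<bar>hermite2_error \<omega> z\<bar> \<le> second_size \<omega> * exp (5 * norm z)"
proof -
  have "\<bar>z $ r * z $ s - (if r = s then 1 else 0)\<bar> \<le> exp (5 * norm z)" for r s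
  proof -
    have "\<bar>z $ r * z $ s\<bar> \<le> (norm z)\<^sup>2"
      unfolding abs_mult power2_eq_square by (intro mult_mono component_le_norm_cart) auto
    moreover have "\<bar>z $ r * z $ s - (if r = s then 1 else 0)\<bar> \<le> \<bar>z $ r * z $ s\<bar> + 1"
      by (rule order_trans[OF abs_triangle_ineq4]) simp
    ultimately show ?thesis using exp_bounds(1)[of "norm z"] by simp
  qed
  then have "\<bar>second_error r s \<omega> * (z $ r * z $ s - (if r = s then 1 else 0))\<bar> \<le> \<bar>second_error r s
      \<omega>\<bar> * exp (5 * norm z)" for r s
    unfolding abs_mult by (intro mult_left_mono) auto
  then show ?thesis
    unfolding hermite2_error_eq second_size_def sum_distrib_right
    by (intro order_trans[OF sum_abs] sum_mono)
qed

lemma hermite3_sum_le: "\<bar>hermite3_sum \<omega> z\<bar> \<le> third_size \<omega> * (4 * exp (5 * norm z))"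
proof -
  have "\<bar>z $ r * z $ s * z $ t - (if r = s then 3 * z $ t else 0)\<bar> \<le> 4 * exp (5 * norm z)" for r s t
  proof -
    have "\<bar>z $ r * z $ s * z $ t\<bar> \<le> norm z * norm z * norm z"
      unfolding abs_mult by (intro mult_mono component_le_norm_cart) auto
    moreover have "\<bar>(if r = s then 3 * z $ t else 0)\<bar> \<le> 3 * norm z"
      using component_le_norm_cart[of z t] by (simp add: abs_mult)
    ultimately show ?thesis using exp_bounds(2)[of "norm z"] by (simp add: power3_eq_cube)
  qed
  then have "\<bar>third_sum r s t \<omega> * (z $ r * z $ s * z $ t - (if r = s then 3 * z $ t else 0))\<bar>
      \<le> \<bar>third_sum r s t \<omega>\<bar> * (4 * exp (5 * norm z))" for r s t
    unfolding abs_mult by (intro mult_left_mono) auto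
  then show ?thesis
    unfolding hermite3_sum_eq third_size_def sum_distrib_right
    by (intro order_trans[OF sum_abs] sum_mono)
qed

lemma avg_second_size: "avg (\<lambda>\<omega>. (second_size \<omega>)\<^sup>2) \<le> real CARD('d) ^ 4 * b\<^sup>2"
proof -
  have "(second_size \<omega>)\<^sup>2 \<le> (real CARD('d))\<^sup>2 * (\<Sum>r\<in>UNIV. \<Sum>s\<in>UNIV. (second_error r s \<omega>)\<^sup>2)" for \<omega>
  proof -
    have "(second_size \<omega>)\<^sup>2 \<le> CARD('d) * (\<Sum>r\<in>UNIV. (\<Sum>s\<in>UNIV. \<bar>second_error r s \<omega>\<bar>)\<^sup>2)"
      unfolding second_size_def using sum_squared_le_sum_of_squares[of "\<lambda>r. \<Sum>s\<in>UNIV. \<bar>second_error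
          r s \<omega>\<bar>" UNIV]
      by (simp add: mult.commute)
    also have "\<dots> \<le> CARD('d) * (\<Sum>r\<in>UNIV. CARD('d) * (\<Sum>s\<in>UNIV. (second_error r s \<omega>)\<^sup>2))"
      using sum_squared_le_sum_of_squares[of "\<lambda>s. \<bar>second_error _ s \<omega>\<bar>" "UNIV :: 'd set"]
      by (intro mult_left_mono sum_mono) (auto simp: mult.commute)
    finally show ?thesis by (simp add: sum_distrib_left power2_eq_square mult.assoc)
  qed
  then have "avg (\<lambda>\<omega>. (second_size \<omega>)\<^sup>2) \<le> avg (\<lambda>\<omega>. (real CARD('d))\<^sup>2 * (\<Sum>r\<in>UNIV. \<Sum>s\<in>UNIV.
      (second_error r s \<omega>)\<^sup>2))"
    by (rule average_mono)
  also have "\<dots> = (real CARD('d))\<^sup>2 * (\<Sum>r\<in>UNIV. \<Sum>s\<in>UNIV. avg (\<lambda>\<omega>. (second_error r s \<omega>)\<^sup>2))"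
    by (simp add: average_cmult average_sum)
  also have "\<dots> \<le> (real CARD('d))\<^sup>2 * (\<Sum>r\<in>(UNIV :: 'd set). \<Sum>s\<in>(UNIV :: 'd set). b\<^sup>2)"
    using second by (intro mult_left_mono sum_mono) (auto simp: second_error_def)
  finally show ?thesis by (simp add: power2_eq_square power4_eq_xxxx mult.assoc)
qed

text \<open>
  The inequality \<open>|x| \<le> x\<^sup>2 / (2ab) + ab / 2\<close> replaces the first absolute moment by the second.
\<close>

lemma avg_third_size: "avg third_size \<le> real CARD('d) ^ 3 * (a * b)"
proof -
  have ab0: "0 < a * b" using ab by simp
  have le: "avg (\<lambda>\<omega>. \<bar>third_sum r s t \<omega>\<bar>) \<le> a * b" for r s t
  proof -
    have "\<bar>x\<bar> \<le> (1 / (2 * (a * b))) * x\<^sup>2 + (a * b) / 2" for x :: real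
    proof -
      have "0 \<le> (\<bar>x\<bar> - a * b)\<^sup>2" by simp
      then have "2 * (a * b) * \<bar>x\<bar> \<le> x\<^sup>2 + (a * b)\<^sup>2" by (simp add: power2_diff ac_simps)
      then have "\<bar>x\<bar> \<le> (x\<^sup>2 + (a * b)\<^sup>2) / (2 * (a * b))" using ab0 by (subst pos_le_divide_eq)
          (auto simp: ac_simps)
      also have "\<dots> = (1 / (2 * (a * b))) * x\<^sup>2 + (a * b) / 2" using ab by (simp add:
          add_divide_distrib power2_eq_square)
      finally show ?thesis .
    qed
    then have "avg (\<lambda>\<omega>. \<bar>third_sum r s t \<omega>\<bar>) \<le> avg (\<lambda>\<omega>. (1 / (2 * (a * b))) * (third_sum r s t
        \<omega>)\<^sup>2 + (a * b) / 2)"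
      by (intro average_mono)
    also have "\<dots> = (1 / (2 * (a * b))) * avg (\<lambda>\<omega>. (third_sum r s t \<omega>)\<^sup>2) + (a * b) / 2"
      by (simp only: average_add average_cmult avg_const)
    also have "\<dots> \<le> (1 / (2 * (a * b))) * (a * b)\<^sup>2 + (a * b) / 2"
      using third ab0 by (intro add_right_mono mult_left_mono) (auto simp: third_sum_def)
    also have "\<dots> = a * b" using ab0 by (simp add: power2_eq_square field_simps)
    finally show ?thesis .
  qed
  have "avg third_size = (\<Sum>r\<in>UNIV. \<Sum>s\<in>UNIV. \<Sum>t\<in>UNIV. avg (\<lambda>\<omega>. \<bar>third_sum r s t \<omega>\<bar>))"
    unfolding third_size_def by (simp only: average_sum)
  also have "\<dots> \<le> (\<Sum>r\<in>(UNIV :: 'd set). \<Sum>s\<in>(UNIV :: 'd set). \<Sum>t\<in>(UNIV :: 'd set). a * b)"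
    by (intro sum_mono le)
  finally show ?thesis by (simp add: power3_eq_cube mult.assoc)
qed

end

context finite_sample
begin

text \<open>
  How much a Gaussian perturbation of size \<open>\<sigma>\<close> changes the membership of \<open>c W\<close> in \<open>A\<close>, weighted by
  the growth of the test functions.
\<close>

definition boundary_weight :: "(real^'d) set \<Rightarrow> real \<Rightarrow> real \<Rightarrow> 'w \<Rightarrow> real" where
  "boundary_weight A c \<sigma> \<omega> =
     (\<integral>z. \<bar>indicator A (c *\<^sub>R W \<omega> + \<sigma> *\<^sub>R z) - indicator A (c *\<^sub>R W \<omega>)\<bar> * exp (5 * norm z)
         \<partial>std_gaussian)"

lemma integrable_boundary_weight:
  assumes [measurable]: "A \<in> sets borel"
  shows "integrable std_gaussian (\<lambda>z::real^'d. \<bar>indicator A (x + \<sigma> *\<^sub>R z) - indicator A x\<bar> * exp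
      (5 * norm z) :: real)"
  by (rule integrable_exp_bounded[where C = 1 and t = 5]) (auto simp: indicator_def)

lemma boundary_weight_nonneg: "0 \<le> boundary_weight A c \<sigma> \<omega>"
  unfolding boundary_weight_def by (rule integral_nonneg_AE) simp

lemma exp5_le: "(\<integral>z. exp (5 * norm z) \<partial>(std_gaussian :: (real^'d) measure)) \<le> exp_moment TYPE('d)"
  unfolding exp_moment_def by (intro integral_mono integrable_exp_norm) auto

lemma boundary_weight_le:
  assumes "A \<in> sets borel"
  shows "boundary_weight A c \<sigma> \<omega> \<le> exp_moment TYPE('d)"
proof -
  have "boundary_weight A c \<sigma> \<omega> \<le> (\<integral>z. exp (5 * norm z) \<partial>(std_gaussian :: (real^'d) measure))"
    unfolding boundary_weight_def
    by (intro integral_mono integrable_boundary_weight assms integrable_exp_norm) (auto simp: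
        indicator_def)
  also note exp5_le
  finally show ?thesis .
qed

text \<open>
  Membership changes only if \<open>c W\<close> is within \<open>\<sigma> (1 + |z|)\<close> of the boundary.  The summand \<open>1\<close> makes
  the distance to the perturbed point strictly smaller than the width, as the open balls in
  \<open>thicken\<close> and \<open>erode\<close> require.
\<close>

lemma avg_boundary_weight:
  assumes A: "convex A" "A \<in> sets borel" and cs: "0 \<le> c" "0 < \<sigma>" "c\<^sup>2 + \<sigma>\<^sup>2 = 1"
  shows "avg (boundary_weight A c \<sigma>) \<le> 2 * exp_moment TYPE('d) * (layer_const TYPE('d) * \<sigma> + \<delta>)"
proof -
  let ?L = "layer_const TYPE('d)"
  let ?f = "\<lambda>\<omega> (z::real^'d). \<bar>indicator A (c *\<^sub>R W \<omega> + \<sigma> *\<^sub>R z) - indicator A (c *\<^sub>R W \<omega>)\<bar> :: real"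
  have "avg (boundary_weight A c \<sigma>) = (\<integral>z. avg (\<lambda>\<omega>. ?f \<omega> z * exp (5 * norm z)) \<partial>std_gaussian)"
    unfolding boundary_weight_def by (rule integral_average[symmetric], rule
        integrable_boundary_weight[OF A(2)])
  also have "\<dots> \<le> (\<integral>z. (2 * ?L * \<sigma> + 2 * \<delta>) * exp (6 * norm z) \<partial>(std_gaussian :: (real^'d) measure))"
  proof (rule integral_mono)
    show "integrable std_gaussian (\<lambda>z. avg (\<lambda>\<omega>. ?f \<omega> z * exp (5 * norm z)))"
      unfolding average_def by (intro integrable_divide Bochner_Integration.integrable_sum
          integrable_boundary_weight A)
    show "integrable std_gaussian (\<lambda>z::real^'d. (2 * ?L * \<sigma> + 2 * \<delta>) * exp (6 * norm z))"
      by (intro integrable_mult_right integrable_exp_norm)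
    fix z :: "real^'d"
    define r where "r = \<sigma> * (1 + norm z)"
    have r: "\<sigma> \<le> r" "norm (\<sigma> *\<^sub>R z) < r" using cs by (auto simp: r_def algebra_simps)
    have "?f \<omega> z \<le> indicator (thicken A r - erode A r) (c *\<^sub>R W \<omega>)" for \<omega>
    proof (cases "c *\<^sub>R W \<omega> + \<sigma> *\<^sub>R z \<in> A \<longleftrightarrow> c *\<^sub>R W \<omega> \<in> A")
      case False
      let ?x = "c *\<^sub>R W \<omega>"
      have d: "?x + \<sigma> *\<^sub>R z \<in> ball ?x r" "?x \<in> ball ?x r" "?x \<in> ball (?x + \<sigma> *\<^sub>R z) r"
        using r cs by (auto simp: dist_norm)
      have "?x \<in> thicken A r" using False d unfolding thicken_def by blast
      moreover have "?x \<notin> erode A r" using False d unfolding erode_def by blast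
      ultimately show ?thesis by (simp add: indicator_def)
    qed (auto simp: indicator_def)
    then have "avg (\<lambda>\<omega>. ?f \<omega> z) \<le> avg (\<lambda>\<omega>. indicator (thicken A r - erode A r) (c *\<^sub>R W \<omega>))"
      by (rule average_mono)
    also have "\<dots> \<le> 2 * ?L * r + 2 * \<delta>" by (rule sample_boundary_layer[OF A(1) cs r(1)])
    also have "\<dots> \<le> (2 * ?L * \<sigma> + 2 * \<delta>) * (1 + norm z)"
      using discrepancy_nonneg by (simp add: r_def algebra_simps)
    also have "\<dots> \<le> (2 * ?L * \<sigma> + 2 * \<delta>) * exp (norm z)"
      using discrepancy_nonneg layer_const_ge_1[where 'd = 'd] cs by (intro mult_left_mono
          exp_ge_add_one_self) auto
    finally have le: "avg (\<lambda>\<omega>. ?f \<omega> z) \<le> (2 * ?L * \<sigma> + 2 * \<delta>) * exp (norm z)" .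
    have e6: "exp (6 * norm z) = exp (5 * norm z) * exp (norm z)" by (simp add: exp_add[symmetric])
    have "avg (\<lambda>\<omega>. ?f \<omega> z * exp (5 * norm z)) = exp (5 * norm z) * avg (\<lambda>\<omega>. ?f \<omega> z)"
      by (simp only: average_cmult[symmetric] mult.commute)
    also have "\<dots> \<le> exp (5 * norm z) * ((2 * ?L * \<sigma> + 2 * \<delta>) * exp (norm z))"
      by (rule mult_left_mono[OF le]) simp
    also have "\<dots> = (2 * ?L * \<sigma> + 2 * \<delta>) * exp (6 * norm z)" unfolding e6 by (rule mult.left_commute)
    finally show "avg (\<lambda>\<omega>. ?f \<omega> z * exp (5 * norm z)) \<le> (2 * ?L * \<sigma> + 2 * \<delta>) * exp (6 * norm z)" .
  qed
  also have "\<dots> = 2 * exp_moment TYPE('d) * (?L * \<sigma> + \<delta>)"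
    unfolding integral_mult_right_zero exp_moment_def by algebra
  finally show ?thesis .
qed

text \<open>
  A test function of mean zero integrates to zero against the constant \<open>indicator A (c W)\<close>, which
  may therefore be subtracted.
\<close>

lemma mean_zero_test_le:
  fixes f :: "real^'d \<Rightarrow> real"
  assumes [measurable]: "A \<in> sets borel" "f \<in> borel_measurable borel" and f: "\<And>z. \<bar>f z\<bar> \<le> M * exp
      (5 * norm z)"
    and mean: "(\<integral>z. f z \<partial>std_gaussian) = 0"
  shows "\<bar>\<integral>z. indicator A (c *\<^sub>R W \<omega> + \<sigma> *\<^sub>R z) * f z \<partial>std_gaussian\<bar> \<le> M * boundary_weight A c \<sigma> \<omega>"
proof -
  let ?x = "c *\<^sub>R W \<omega>"
  have int: "integrable std_gaussian f" by (rule integrable_exp_bounded[OF assms(2) f])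
  have int': "integrable std_gaussian (\<lambda>z. indicator A (?x + \<sigma> *\<^sub>R z) * f z)"
    using f by (intro integrable_exp_bounded[where C = M and t = 5]) (auto simp: indicator_def
        intro: order_trans[OF abs_ge_zero])
  have M: "0 \<le> M" using order_trans[OF abs_ge_zero f[of 0]] by simp
  have "(\<integral>z. indicator A (?x + \<sigma> *\<^sub>R z) * f z \<partial>std_gaussian)
      = (\<integral>z. indicator A (?x + \<sigma> *\<^sub>R z) * f z \<partial>std_gaussian) - (\<integral>z. indicator A ?x * f z
          \<partial>std_gaussian)"
    using mean by simp
  also have "\<dots> = (\<integral>z. (indicator A (?x + \<sigma> *\<^sub>R z) - indicator A ?x) * f z \<partial>std_gaussian)"
    using int int' by (subst Bochner_Integration.integral_diff[symmetric]) (auto simp: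
        left_diff_distrib)
  finally have "\<bar>\<integral>z. indicator A (?x + \<sigma> *\<^sub>R z) * f z \<partial>std_gaussian\<bar>
      = \<bar>\<integral>z. (indicator A (?x + \<sigma> *\<^sub>R z) - indicator A ?x) * f z \<partial>std_gaussian\<bar>" by simp
  also have "\<dots> \<le> (\<integral>z. \<bar>(indicator A (?x + \<sigma> *\<^sub>R z) - indicator A ?x) * f z\<bar> \<partial>std_gaussian)"
    by (rule integral_abs_bound)
  also have "\<dots> \<le> (\<integral>z. M * (\<bar>indicator A (?x + \<sigma> *\<^sub>R z) - indicator A ?x\<bar> * exp (5 * norm z))
      \<partial>std_gaussian)"
  proof (rule integral_mono)
    show "integrable std_gaussian (\<lambda>z. \<bar>(indicator A (?x + \<sigma> *\<^sub>R z) - indicator A ?x) * f z\<bar>)"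
      using int int' by (simp add: left_diff_distrib)
    show "integrable std_gaussian (\<lambda>z. M * (\<bar>indicator A (?x + \<sigma> *\<^sub>R z) - indicator A ?x\<bar> * exp (5
        * norm z)))"
      by (intro integrable_mult_right integrable_boundary_weight assms)
    show "\<bar>(indicator A (?x + \<sigma> *\<^sub>R z) - indicator A ?x) * f z\<bar>
        \<le> M * (\<bar>indicator A (?x + \<sigma> *\<^sub>R z) - indicator A ?x\<bar> * exp (5 * norm z))" for z
      using f[of z] by (auto simp: indicator_def)
  qed
  also have "\<dots> = M * boundary_weight A c \<sigma> \<omega>" by (simp add: boundary_weight_def)
  finally show ?thesis .
qed

end

context balanced_walk
begin

definition against :: "(real^'d) set \<Rightarrow> real \<Rightarrow> 'w \<Rightarrow> (real^'d \<Rightarrow> real) \<Rightarrow> real" where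
  "against A \<theta> \<omega> f = (\<integral>z. indicator A (cos \<theta> *\<^sub>R W \<omega> + sin \<theta> *\<^sub>R z) * f z \<partial>std_gaussian)"

definition total_remainder :: "real \<Rightarrow> 'w \<Rightarrow> real^'d \<Rightarrow> real" where
  "total_remainder k \<omega> z = (\<Sum>i\<in>I. shift_remainder (k *\<^sub>R step i \<omega>) z)"

lemma measurable_hermite_sums [measurable]:
  "hermite2_error \<omega> \<in> borel_measurable borel" "hermite3_sum \<omega> \<in> borel_measurable borel"
  "total_remainder k \<omega> \<in> borel_measurable borel"
  unfolding hermite2_error_def hermite3_sum_def total_remainder_def by measurable

lemma hermite_scale:
  "hermite2 (k *\<^sub>R v) z = k\<^sup>2 * hermite2 v z" "hermite3 (k *\<^sub>R v) z = k ^ 3 * hermite3 v z" for v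
      :: "real^'d"
  by (simp_all add: hermite2_def hermite3_def power_mult_distrib algebra_simps power2_eq_square
      power3_eq_cube)

lemma sum_hermite2_axis: "(\<Sum>r\<in>UNIV. hermite2 (axis r 1) z) = (norm z)\<^sup>2 - CARD('d)" for z ::
    "real^'d"
proof -
  have "(norm z)\<^sup>2 = (\<Sum>r\<in>UNIV. (z $ r)\<^sup>2)"
    by (simp add: inner_vec_def power2_eq_square dot_square_norm[symmetric, unfolded
        power2_eq_square])
  then show ?thesis by (simp add: hermite2_def inner_axis' norm_axis_1 sum_subtractf)
qed

text \<open>
  The first order yields \<open>- 4 k (z \<bullet> W)\<close> by the drift condition, the second \<open>4 k\<^sup>2 (|z|\<^sup>2 - d)\<close>
  and an error; together these are \<open>4 k\<close> times the path drift at \<open>k = cot \<theta>\<close>.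
\<close>

lemma sum_shift_expansion:
  assumes \<omega>: "\<omega> \<in> \<Omega>" and k: "k = cos \<theta> / sin \<theta>"
  shows "(\<Sum>i\<in>I. shift_weight (k *\<^sub>R step i \<omega>) z - 1)
    = 4 * k * path_drift (W \<omega>) \<theta> z + (k\<^sup>2 / 2 * hermite2_error \<omega> z + k ^ 3 / 6 * hermite3_sum \<omega> z
        + total_remainder k \<omega> z)"
proof -
  have "(\<Sum>i\<in>I. shift_weight (k *\<^sub>R step i \<omega>) z - 1)
     = (\<Sum>i\<in>I. k * (step i \<omega> \<bullet> z) + k\<^sup>2 / 2 * hermite2 (step i \<omega>) z + k ^ 3 / 6 * hermite3 (step i
         \<omega>) z
          + shift_remainder (k *\<^sub>R step i \<omega>) z)"
    by (intro sum.cong refl) (simp add: shift_remainder_def hermite_scale)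
  also have "\<dots> = k * ((\<Sum>i\<in>I. step i \<omega>) \<bullet> z) + k\<^sup>2 / 2 * (\<Sum>i\<in>I. hermite2 (step i \<omega>) z) + k ^ 3 / 6
      * hermite3_sum \<omega> z
      + total_remainder k \<omega> z"
    by (simp only: sum.distrib sum_distrib_left[symmetric] inner_sum_left hermite3_sum_def
        total_remainder_def)
  also have "(\<Sum>i\<in>I. hermite2 (step i \<omega>) z) = hermite2_error \<omega> z + 8 * ((norm z)\<^sup>2 - CARD('d))"
    unfolding hermite2_error_def sum_hermite2_axis by simp
  also have "k * ((\<Sum>i\<in>I. step i \<omega>) \<bullet> z) = - 4 * k * (z \<bullet> W \<omega>)"
    unfolding drift[OF \<omega>] by (simp add: inner_commute)
  finally show ?thesis
    unfolding path_drift_def k[symmetric] by (simp add: algebra_simps power2_eq_square)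
qed

lemma integrable_against:
  fixes f :: "real^'d \<Rightarrow> real"
  assumes [measurable]: "A \<in> sets borel" and f: "integrable std_gaussian f"
  shows "integrable std_gaussian (\<lambda>z. indicator A (x + \<sigma> *\<^sub>R z) * f z)"
proof (rule Bochner_Integration.integrable_bound[OF f])
  have [measurable]: "f \<in> borel_measurable borel" using f by simp
  show "(\<lambda>z. indicator A (x + \<sigma> *\<^sub>R z) * f z) \<in> borel_measurable std_gaussian" by measurable
qed (simp add: indicator_def)

text \<open>
  Moving \<open>W\<close> by \<open>step i\<close> displaces \<open>cos \<theta> W + sin \<theta> Z\<close> as much as shifting \<open>Z\<close> by \<open>cot \<theta> step i\<close>.
\<close>

lemma stationarity:
  assumes A[measurable]: "A \<in> sets borel" and s: "sin \<theta> > 0" and i: "i \<in> I"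
  shows "avg (\<lambda>\<omega>. against A \<theta> \<omega> (shift_weight ((cos \<theta> / sin \<theta>) *\<^sub>R step i \<omega>))) = avg (\<lambda>\<omega>. against
      A \<theta> \<omega> (\<lambda>_. 1))"
proof -
  let ?k = "cos \<theta> / sin \<theta>"
  have "against A \<theta> (move i \<omega>) (\<lambda>_. 1) = against A \<theta> \<omega> (shift_weight (?k *\<^sub>R step i \<omega>))" if \<omega>: "\<omega>
      \<in> \<Omega>" for \<omega>
  proof -
    have "cos \<theta> *\<^sub>R W (move i \<omega>) + sin \<theta> *\<^sub>R z = cos \<theta> *\<^sub>R W \<omega> + sin \<theta> *\<^sub>R (z + ?k *\<^sub>R step i \<omega>)"
        for z
      using s by (simp add: step[OF i \<omega>] algebra_simps)
    then show ?thesis unfolding against_def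
      using integral_std_gaussian_shift[of "\<lambda>z. indicator A (cos \<theta> *\<^sub>R W \<omega> + sin \<theta> *\<^sub>R z)" "?k *\<^sub>R
          step i \<omega>"] by simp
  qed
  then have "avg (\<lambda>\<omega>. against A \<theta> \<omega> (shift_weight (?k *\<^sub>R step i \<omega>))) = avg (\<lambda>\<omega>. against A \<theta> (move
      i \<omega>) (\<lambda>_. 1))"
    by (intro average_cong) simp
  also have "\<dots> = avg (\<lambda>\<omega>. against A \<theta> \<omega> (\<lambda>_. 1))"
    unfolding average_def by (simp add: sum.reindex_bij_betw[OF move[OF i], of "\<lambda>\<omega>. against A \<theta> \<omega>
        (\<lambda>_. 1)"])
  finally show ?thesis .
qed

lemma integrable_path_drift: "integrable std_gaussian (path_drift w \<theta> :: real^'d \<Rightarrow> real)"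
  unfolding path_drift_def sum_hermite2_axis[symmetric]
  by (intro Bochner_Integration.integrable_diff integrable_mult_right
      Bochner_Integration.integrable_sum integrable_hermite)
     (simp add: inner_commute[of _ w] integrable_hermite)

lemma integrable_hermite_sums:
  "integrable std_gaussian (hermite2_error \<omega>)" "integrable std_gaussian (hermite3_sum \<omega>)"
  "integrable std_gaussian (total_remainder k \<omega>)"
  unfolding hermite2_error_def hermite3_sum_def total_remainder_def
  by (intro Bochner_Integration.integrable_diff integrable_mult_right
      Bochner_Integration.integrable_sum integrable_hermite)+

lemma mean_hermite_sums:
  "(\<integral>z. hermite2_error \<omega> z \<partial>std_gaussian) = 0" "(\<integral>z. hermite3_sum \<omega> z \<partial>std_gaussian) = 0"
  "(\<integral>z. total_remainder k \<omega> z \<partial>std_gaussian) = 0"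
  unfolding hermite2_error_def hermite3_sum_def total_remainder_def
  by (simp_all add: integrable_hermite hermite_mean_zero Bochner_Integration.integral_sum)

text \<open>
  Sum the stationarity over all moves.  The left-hand side collects what the generator of the
  interpolation contributes, the right-hand side the deviations of the walk from it.
\<close>

lemma stein_identity:
  assumes A[measurable]: "A \<in> sets borel" and s: "sin \<theta> > 0" and k: "k = cos \<theta> / sin \<theta>"
  shows "4 * k * avg (\<lambda>\<omega>. smoothed_deriv A \<theta> (W \<omega>)) = - avg (\<lambda>\<omega>. k\<^sup>2 / 2 * against A \<theta> \<omega>
      (hermite2_error \<omega>)
      + k ^ 3 / 6 * against A \<theta> \<omega> (hermite3_sum \<omega>) + against A \<theta> \<omega> (total_remainder k \<omega>))"
proof -
  note ints = integrable_path_drift integrable_hermite_sums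
  have "0 = (\<Sum>i\<in>I. avg (\<lambda>\<omega>. against A \<theta> \<omega> (shift_weight (k *\<^sub>R step i \<omega>))) - avg (\<lambda>\<omega>. against A \<theta>
      \<omega> (\<lambda>_. 1)))"
    using stationarity[OF A s] by (simp add: k)
  also have "\<dots> = avg (\<lambda>\<omega>. \<Sum>i\<in>I. against A \<theta> \<omega> (shift_weight (k *\<^sub>R step i \<omega>)) - against A \<theta> \<omega> (\<lambda>_.
      1))"
    by (simp only: average_sum average_diff)
  also have "\<dots> = avg (\<lambda>\<omega>. 4 * k * smoothed_deriv A \<theta> (W \<omega>) + (k\<^sup>2 / 2 * against A \<theta> \<omega>
      (hermite2_error \<omega>)
      + k ^ 3 / 6 * against A \<theta> \<omega> (hermite3_sum \<omega>) + against A \<theta> \<omega> (total_remainder k \<omega>)))"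
  proof (rule average_cong)
    fix \<omega> assume \<omega>: "\<omega> \<in> \<Omega>"
    let ?h = "\<lambda>z. indicator A (cos \<theta> *\<^sub>R W \<omega> + sin \<theta> *\<^sub>R z) :: real"
    have "(\<Sum>i\<in>I. against A \<theta> \<omega> (shift_weight (k *\<^sub>R step i \<omega>)) - against A \<theta> \<omega> (\<lambda>_. 1))
        = (\<Sum>i\<in>I. \<integral>z. ?h z * (shift_weight (k *\<^sub>R step i \<omega>) z - 1) \<partial>std_gaussian)"
      unfolding against_def right_diff_distrib
      by (intro sum.cong refl Bochner_Integration.integral_diff[symmetric] integrable_against A
          integrable_hermite; simp)
    also have "\<dots> = (\<integral>z. (\<Sum>i\<in>I. ?h z * (shift_weight (k *\<^sub>R step i \<omega>) z - 1)) \<partial>std_gaussian)"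
      by (intro Bochner_Integration.integral_sum[symmetric] integrable_against A
          Bochner_Integration.integrable_diff integrable_hermite; simp)
    also have "\<dots> = (\<integral>z. 4 * k * (?h z * path_drift (W \<omega>) \<theta> z) + (k\<^sup>2 / 2 * (?h z * hermite2_error
        \<omega> z)
        + k ^ 3 / 6 * (?h z * hermite3_sum \<omega> z) + ?h z * total_remainder k \<omega> z) \<partial>std_gaussian)"
      unfolding sum_distrib_left[symmetric] sum_shift_expansion[OF \<omega> k]
      by (intro Bochner_Integration.integral_cong refl) (simp add: algebra_simps)
    also have "\<dots> = 4 * k * smoothed_deriv A \<theta> (W \<omega>) + (k\<^sup>2 / 2 * against A \<theta> \<omega> (hermite2_error \<omega>)
      + k ^ 3 / 6 * against A \<theta> \<omega> (hermite3_sum \<omega>) + against A \<theta> \<omega> (total_remainder k \<omega>))"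
      using ints[THEN integrable_against[OF A]] by (simp add: against_def smoothed_deriv_def)
    finally show "(\<Sum>i\<in>I. against A \<theta> \<omega> (shift_weight (k *\<^sub>R step i \<omega>)) - against A \<theta> \<omega> (\<lambda>_. 1)) =
        \<dots>" .
  qed
  finally show ?thesis by (simp only: average_add average_cmult)
qed

end

text \<open>
  A common bound for the constants of the three error terms in \<open>smoothed_deriv_le\<close>.
\<close>

definition rate_const :: "'d::finite itself \<Rightarrow> real" where
  "rate_const D = real CARD('d) ^ 4 + (exp_moment D)\<^sup>2 * layer_const D + exp_moment D * real
      CARD('d) ^ 3"

lemma rate_const_ge_1: "1 \<le> rate_const TYPE('d::finite)"
proof -
  have "1 \<le> real CARD('d)" by (simp add: Suc_leI)
  then have "1 \<le> real CARD('d) ^ 4" by simp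
  then show ?thesis unfolding rate_const_def
    using exp_moment_ge_1[where 'd = 'd] layer_const_ge_1[where 'd = 'd] by (simp add:
        add_increasing2)
qed

text \<open>
  With \<open>K = 48 rate_const\<close>, the choice made in \<open>discrepancy_bound\<close>, this is \<open>2 K + 48 \<kappa> L K\<close> for
  the moment \<open>\<kappa>\<close> and the layer constant \<open>L\<close>.
\<close>

definition core_const :: "'d::finite itself \<Rightarrow> real" where
  "core_const D = 48 * rate_const D * (2 + 48 * exp_moment D * layer_const D)"

lemma core_const_pos: "0 < core_const TYPE('d::finite)"
  unfolding core_const_def
  using rate_const_ge_1[where 'd = 'd] exp_moment_ge_1[where 'd = 'd] layer_const_ge_1[where 'd =
      'd]
  by (intro mult_pos_pos add_pos_nonneg mult_nonneg_nonneg) linarith+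

context balanced_walk
begin

lemma against_le:
  fixes f :: "real^'d \<Rightarrow> real"
  assumes A[measurable]: "A \<in> sets borel" "f \<in> borel_measurable borel" and f: "\<And>z. \<bar>f z\<bar> \<le> M * exp
      (5 * norm z)" and M: "0 \<le> M"
    and mean: "(\<integral>z. f z \<partial>std_gaussian) = 0"
  shows "\<bar>against A \<theta> \<omega> f\<bar> \<le> M * boundary_weight A (cos \<theta>) (sin \<theta>) \<omega>"
    and "\<bar>against A \<theta> \<omega> f\<bar> \<le> M * exp_moment TYPE('d)"
proof -
  show 1: "\<bar>against A \<theta> \<omega> f\<bar> \<le> M * boundary_weight A (cos \<theta>) (sin \<theta>) \<omega>"
    unfolding against_def by (rule mean_zero_test_le[OF A f mean])
  also have "\<dots> \<le> M * exp_moment TYPE('d)"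
    by (intro mult_left_mono boundary_weight_le A(1) M)
  finally show "\<bar>against A \<theta> \<omega> f\<bar> \<le> M * exp_moment TYPE('d)" .
qed

lemma second_size_nonneg: "0 \<le> second_size \<omega>" and third_size_nonneg: "0 \<le> third_size \<omega>"
  unfolding second_size_def third_size_def by (intro sum_nonneg abs_ge_zero)+

lemma total_remainder_le:
  assumes \<omega>: "\<omega> \<in> \<Omega>" and k: "0 \<le> k" "k * a \<le> 1"
  shows "\<bar>total_remainder k \<omega> z\<bar> \<le> k ^ 4 * b\<^sup>2 * exp (5 * norm z)"
proof -
  have "\<bar>shift_remainder (k *\<^sub>R step i \<omega>) z\<bar> \<le> k ^ 4 * a ^ 4 * exp (5 * norm z)" if i: "i \<in> I" for i
  proof -
    have n: "norm (k *\<^sub>R step i \<omega>) \<le> k * a" using k step_le[OF i \<omega>] by (simp add: mult_left_mono)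
    have "\<bar>shift_remainder (k *\<^sub>R step i \<omega>) z\<bar> \<le> norm (k *\<^sub>R step i \<omega>) ^ 4 * exp (5 * norm z)"
      using n k by (intro shift_remainder_bound) simp
    also have "\<dots> \<le> (k * a) ^ 4 * exp (5 * norm z)" using n by (intro mult_right_mono power_mono)
        auto
    finally show ?thesis by (simp add: power_mult_distrib)
  qed
  then have "\<bar>total_remainder k \<omega> z\<bar> \<le> (\<Sum>i\<in>I. k ^ 4 * a ^ 4 * exp (5 * norm z))"
    unfolding total_remainder_def by (intro order_trans[OF sum_abs] sum_mono)
  also have "\<dots> = k ^ 4 * (card I * a ^ 4) * exp (5 * norm z)" by simp
  also have "\<dots> \<le> k ^ 4 * b\<^sup>2 * exp (5 * norm z)"
    using card_I k by (intro mult_right_mono mult_left_mono) auto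
  finally show ?thesis .
qed

text \<open>
  Balancing \<open>x y \<le> p x\<^sup>2 + q y\<^sup>2\<close> with \<open>p\<close> proportional to \<open>sqrt \<sigma> / b\<close> gives a main term of order
  \<open>b sqrt \<sigma>\<close>, hence \<open>b / sqrt \<sigma>\<close> after division by \<open>\<sigma>\<close>; this is integrable at \<open>\<sigma> = 0\<close>, whereas the
  trivial bound would lead to \<open>b / \<sigma>\<close> and a logarithm.
\<close>

lemma avg_second_times_weight:
  assumes A: "convex A" "A \<in> sets borel" and cs: "0 \<le> c" "0 < \<sigma>" "c\<^sup>2 + \<sigma>\<^sup>2 = 1"
  shows "avg (\<lambda>\<omega>. second_size \<omega> * boundary_weight A c \<sigma> \<omega>) \<le> rate_const TYPE('d) * b * (sqrt \<sigma> + \<delta>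
      / sqrt \<sigma>)"
proof -
  let ?\<kappa> = "exp_moment TYPE('d)" and ?L = "layer_const TYPE('d)" and ?B = "boundary_weight A c \<sigma>"
  have b: "b > 0" using ab by simp
  have \<kappa>: "1 \<le> ?\<kappa>" and L: "1 \<le> ?L" by (rule exp_moment_ge_1, rule layer_const_ge_1)
  have s: "sqrt \<sigma> > 0" "sqrt \<sigma> * sqrt \<sigma> = \<sigma>" using cs by auto
  \<comment> \<open>Weights with \<open>p q = 1/4\<close>, for \<open>x y \<le> p x\<^sup>2 + q y\<^sup>2\<close>.\<close>
  define p where "p = sqrt \<sigma> / (2 * b)"
  define q where "q = b / (2 * sqrt \<sigma>)"
  have pq: "p > 0" "q > 0" "p * q = 1 / 4" using b s by (auto simp: p_def q_def)
  have amgm: "x * y \<le> p * x\<^sup>2 + q * y\<^sup>2" for x y :: real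
  proof -
    have "0 \<le> p * (x - 2 * q * y)\<^sup>2" using pq by simp
    also have "\<dots> = p * x\<^sup>2 - 4 * (p * q) * (x * y) + 4 * (p * q) * (q * y\<^sup>2)"
      by (simp add: power2_eq_square algebra_simps)
    finally show ?thesis using pq by simp
  qed
  have sq: "(?B \<omega>)\<^sup>2 \<le> ?\<kappa> * ?B \<omega>" for \<omega>
    using mult_right_mono[OF boundary_weight_le[OF A(2)] boundary_weight_nonneg] by (simp add:
        power2_eq_square)
  have "avg (\<lambda>\<omega>. second_size \<omega> * ?B \<omega>) \<le> avg (\<lambda>\<omega>. p * (second_size \<omega>)\<^sup>2 + (q * ?\<kappa>) * ?B \<omega>)"
  proof (rule average_mono)
    fix \<omega>
    have "second_size \<omega> * ?B \<omega> \<le> p * (second_size \<omega>)\<^sup>2 + q * (?B \<omega>)\<^sup>2" by (rule amgm)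
    also have "\<dots> \<le> p * (second_size \<omega>)\<^sup>2 + q * (?\<kappa> * ?B \<omega>)"
      using sq pq by (intro add_left_mono mult_left_mono) auto
    finally show "second_size \<omega> * ?B \<omega> \<le> p * (second_size \<omega>)\<^sup>2 + (q * ?\<kappa>) * ?B \<omega>" by (simp add:
        mult.assoc)
  qed
  also have "\<dots> = p * avg (\<lambda>\<omega>. (second_size \<omega>)\<^sup>2) + q * ?\<kappa> * avg ?B"
    by (simp only: average_add average_cmult)
  also have "\<dots> \<le> p * (real CARD('d) ^ 4 * b\<^sup>2) + q * ?\<kappa> * (2 * ?\<kappa> * (?L * \<sigma> + \<delta>))"
    using pq \<kappa> by (intro add_mono mult_left_mono avg_second_size avg_boundary_weight A cs) auto
  also have "\<dots> = b * (real CARD('d) ^ 4 / 2 * sqrt \<sigma> + ?\<kappa>\<^sup>2 * ((?L * \<sigma> + \<delta>) / sqrt \<sigma>))"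
    using b by (simp add: p_def q_def power2_eq_square algebra_simps add_divide_distrib)
  also have "(?L * \<sigma> + \<delta>) / sqrt \<sigma> = ?L * sqrt \<sigma> + \<delta> / sqrt \<sigma>"
    using s by (simp add: add_divide_distrib real_div_sqrt flip: times_divide_eq_right)
  also have "b * (real CARD('d) ^ 4 / 2 * sqrt \<sigma> + ?\<kappa>\<^sup>2 * (?L * sqrt \<sigma> + \<delta> / sqrt \<sigma>))
      = b * ((real CARD('d) ^ 4 / 2 + ?\<kappa>\<^sup>2 * ?L) * sqrt \<sigma> + ?\<kappa>\<^sup>2 * (\<delta> / sqrt \<sigma>))"
    by (simp add: algebra_simps)
  also have "\<dots> \<le> b * (rate_const TYPE('d) * sqrt \<sigma> + rate_const TYPE('d) * (\<delta> / sqrt \<sigma>))"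
  proof (intro mult_left_mono add_mono mult_right_mono)
    have "?\<kappa>\<^sup>2 * 1 \<le> ?\<kappa>\<^sup>2 * ?L" using L by (intro mult_left_mono) auto
    moreover have "0 \<le> real CARD('d) ^ 4" "0 \<le> ?\<kappa> * real CARD('d) ^ 3" using \<kappa> by auto
    ultimately show "?\<kappa>\<^sup>2 \<le> rate_const TYPE('d)" "real CARD('d) ^ 4 / 2 + ?\<kappa>\<^sup>2 * ?L \<le> rate_const
        TYPE('d)"
      unfolding rate_const_def by linarith+
  qed (use b s discrepancy_nonneg in auto)
  finally show ?thesis by (simp add: algebra_simps)
qed

text \<open>
  In \<open>stein_identity\<close> divided by \<open>4 k\<close>, with \<open>k = cot \<theta> \<le> 1/\<sigma>\<close>, the errors of second, third and
  fourth order carry the factors \<open>k\<close>, \<open>k\<^sup>2\<close> and \<open>k\<^sup>3\<close>.  The second and the fourth gain from the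
  boundary layer; the third is bounded without it.  The condition on \<open>a\<close> makes \<open>k\<close> times each step
  at most \<open>1\<close> in norm, as the remainder bound requires.
\<close>

lemma smoothed_deriv_le:
  assumes A: "convex A" "A \<in> sets borel" and \<theta>: "0 < \<theta>" "\<theta> < pi / 2" and a: "a \<le> sin \<theta>"
  defines "\<sigma> \<equiv> sin \<theta>"
  shows "\<bar>avg (\<lambda>\<omega>. smoothed_deriv A \<theta> (W \<omega>))\<bar>
    \<le> rate_const TYPE('d) * (b / sqrt \<sigma> + b * \<delta> / (\<sigma> * sqrt \<sigma>) + b\<^sup>2 / \<sigma>\<^sup>2 + b\<^sup>2 * \<delta> / \<sigma> ^ 3)"
proof -
  let ?\<kappa> = "exp_moment TYPE('d)" and ?L = "layer_const TYPE('d)" and ?B = "boundary_weight A (cos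
      \<theta>) \<sigma>" and ?C = "rate_const TYPE('d)"
  have c: "cos \<theta> > 0" and s: "\<sigma> > 0" using \<theta> by (auto simp: \<sigma>_def intro: cos_gt_zero sin_gt_zero2)
  have cs: "0 \<le> cos \<theta>" "0 < \<sigma>" "(cos \<theta>)\<^sup>2 + \<sigma>\<^sup>2 = 1" using c s by (auto simp: \<sigma>_def)
  have b: "b > 0" and a0: "a > 0" using ab by auto
  have \<kappa>: "1 \<le> ?\<kappa>" and L: "1 \<le> ?L" and C: "1 \<le> ?C" by (rule exp_moment_ge_1, rule
      layer_const_ge_1, rule rate_const_ge_1)
  define k where "k = cos \<theta> / sin \<theta>"
  have k: "k > 0" using c s by (simp add: k_def \<sigma>_def)
  have k1: "k \<le> 1 / \<sigma>" unfolding k_def \<sigma>_def using s by (intro divide_right_mono) (auto simp: \<sigma>_def)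
  have ka: "k * a \<le> 1"
  proof -
    have "k * a \<le> (1 / \<sigma>) * \<sigma>" using k1 k a a0 s by (intro mult_mono) (auto simp: \<sigma>_def)
    then show ?thesis using s by simp
  qed
  have h2: "\<bar>against A \<theta> \<omega> (hermite2_error \<omega>)\<bar> \<le> second_size \<omega> * ?B \<omega>" for \<omega>
    unfolding \<sigma>_def
    by (rule against_le(1)[OF A(2) _ hermite2_error_le second_size_nonneg mean_hermite_sums(1)])
        measurable
  have h3: "\<bar>against A \<theta> \<omega> (hermite3_sum \<omega>)\<bar> \<le> third_size \<omega> * (4 * ?\<kappa>)" for \<omega>
  proof -
    have "\<bar>hermite3_sum \<omega> z\<bar> \<le> (third_size \<omega> * 4) * exp (5 * norm z)" for z
      using hermite3_sum_le[of \<omega> z] by (simp add: mult.assoc)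
    from against_le(2)[OF A(2) _ this _ mean_hermite_sums(2)] third_size_nonneg[of \<omega>]
    show ?thesis by (simp add: mult.assoc)
  qed
  have h4: "\<bar>against A \<theta> \<omega> (total_remainder k \<omega>)\<bar> \<le> k ^ 4 * b\<^sup>2 * ?B \<omega>" if "\<omega> \<in> \<Omega>" for \<omega>
    unfolding \<sigma>_def
    using against_le(1)[OF A(2) _ total_remainder_le[OF that _ ka] _ mean_hermite_sums(3)] k by simp
  have "4 * k * \<bar>avg (\<lambda>\<omega>. smoothed_deriv A \<theta> (W \<omega>))\<bar> = \<bar>4 * k * avg (\<lambda>\<omega>. smoothed_deriv A \<theta> (W \<omega>))\<bar>"
    using k by (simp add: abs_mult)
  also have "\<dots> = \<bar>avg (\<lambda>\<omega>. k\<^sup>2 / 2 * against A \<theta> \<omega> (hermite2_error \<omega>)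
      + k ^ 3 / 6 * against A \<theta> \<omega> (hermite3_sum \<omega>) + against A \<theta> \<omega> (total_remainder k \<omega>))\<bar>"
    by (subst stein_identity[OF A(2) _ k_def]) (use s in \<open>auto simp: \<sigma>_def\<close>)
  also have "\<dots> \<le> avg (\<lambda>\<omega>. k\<^sup>2 / 2 * (second_size \<omega> * ?B \<omega>) + (k ^ 3 / 6 * (4 * ?\<kappa>)) * third_size \<omega>
      + (k ^ 4 * b\<^sup>2) * ?B \<omega>)"
  proof (rule order_trans[OF abs_average_le average_mono])
    fix \<omega> assume \<omega>: "\<omega> \<in> \<Omega>"
    have "\<bar>k\<^sup>2 / 2 * against A \<theta> \<omega> (hermite2_error \<omega>)\<bar> \<le> k\<^sup>2 / 2 * (second_size \<omega> * ?B \<omega>)"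
      unfolding abs_mult using h2[of \<omega>] by (intro mult_mono) auto
    moreover have "\<bar>k ^ 3 / 6 * against A \<theta> \<omega> (hermite3_sum \<omega>)\<bar> \<le> k ^ 3 / 6 * (third_size \<omega> * (4 *
        ?\<kappa>))"
      unfolding abs_mult using h3[of \<omega>] k by (intro mult_mono) auto
    moreover note h4[OF \<omega>]
    ultimately show "\<bar>k\<^sup>2 / 2 * against A \<theta> \<omega> (hermite2_error \<omega>) + k ^ 3 / 6 * against A \<theta> \<omega>
        (hermite3_sum \<omega>)
        + against A \<theta> \<omega> (total_remainder k \<omega>)\<bar>
      \<le> k\<^sup>2 / 2 * (second_size \<omega> * ?B \<omega>) + (k ^ 3 / 6 * (4 * ?\<kappa>)) * third_size \<omega> + (k ^ 4 * b\<^sup>2) *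
          ?B \<omega>"
      by (simp add: ac_simps)
  qed
  also have "\<dots> = k\<^sup>2 / 2 * avg (\<lambda>\<omega>. second_size \<omega> * ?B \<omega>) + (k ^ 3 / 6 * (4 * ?\<kappa>)) * avg
      third_size + (k ^ 4 * b\<^sup>2) * avg ?B"
    by (simp only: average_add average_cmult)
  also have "\<dots> \<le> k\<^sup>2 / 2 * (?C * b * (sqrt \<sigma> + \<delta> / sqrt \<sigma>)) + (k ^ 3 / 6 * (4 * ?\<kappa>)) * (real
      CARD('d) ^ 3 * (a * b))
      + (k ^ 4 * b\<^sup>2) * (2 * ?\<kappa> * (?L * \<sigma> + \<delta>))"
    using k \<kappa> by (intro add_mono mult_left_mono avg_second_times_weight avg_third_size
        avg_boundary_weight A cs) auto
  also have "\<dots> = 4 * k * (k / 8 * (?C * b * (sqrt \<sigma> + \<delta> / sqrt \<sigma>)) + k\<^sup>2 / 6 * (?\<kappa> * real CARD('d)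
      ^ 3 * (a * b))
      + k ^ 3 / 2 * b\<^sup>2 * (?\<kappa> * (?L * \<sigma> + \<delta>)))"
    by (simp add: algebra_simps power2_eq_square power3_eq_cube power4_eq_xxxx)
  finally have "\<bar>avg (\<lambda>\<omega>. smoothed_deriv A \<theta> (W \<omega>))\<bar> \<le> k / 8 * (?C * b * (sqrt \<sigma> + \<delta> / sqrt \<sigma>))
      + k\<^sup>2 / 6 * (?\<kappa> * real CARD('d) ^ 3 * (a * b)) + k ^ 3 / 2 * b\<^sup>2 * (?\<kappa> * (?L * \<sigma> + \<delta>))"
    using k by (simp only: mult_le_cancel_left_pos zero_less_mult_iff zero_less_numeral simp_thms)
  also have "\<dots> \<le> (1 / \<sigma>) * (?C * b * (sqrt \<sigma> + \<delta> / sqrt \<sigma>)) + (1 / \<sigma>)\<^sup>2 / 6 * (?C * b\<^sup>2) + (1 / \<sigma>)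
      ^ 3 / 2 * b\<^sup>2 * (?C * (\<sigma> + \<delta>))"
  proof -
    have k8: "k / 8 \<le> 1 / \<sigma>" using k1 k by simp
    have k6: "k\<^sup>2 / 6 \<le> (1 / \<sigma>)\<^sup>2 / 6" using k1 k by (intro divide_right_mono power_mono) auto
    have k2: "k ^ 3 / 2 * b\<^sup>2 \<le> (1 / \<sigma>) ^ 3 / 2 * b\<^sup>2"
      using k1 k by (intro mult_right_mono divide_right_mono power_mono) auto
    have "?\<kappa> \<le> ?\<kappa>\<^sup>2" using \<kappa> by (simp add: power2_eq_square)
    then have "?\<kappa> * ?L \<le> ?\<kappa>\<^sup>2 * ?L" using L by (intro mult_right_mono) auto
    then have KL: "?\<kappa> * ?L \<le> ?C" and Kd: "?\<kappa> * real CARD('d) ^ 3 \<le> ?C"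
      using \<kappa> L zero_le_power[of "real CARD('d)" 4] zero_le_power[of "real CARD('d)" 3]
        mult_nonneg_nonneg[of ?\<kappa> "real CARD('d) ^ 3"] mult_nonneg_nonneg[OF zero_le_power2, of ?L
            ?\<kappa>]
      unfolding rate_const_def by linarith+
    have "?\<kappa> * 1 \<le> ?\<kappa> * ?L" using \<kappa> L by (intro mult_left_mono) auto
    then have K: "?\<kappa> \<le> ?C" using KL by simp
    have "a * b \<le> b * b" using ab by (intro mult_right_mono) auto
    then have three: "?\<kappa> * real CARD('d) ^ 3 * (a * b) \<le> ?C * b\<^sup>2"
      using Kd \<kappa> ab C by (intro mult_mono) (auto simp: power2_eq_square)
    have "?\<kappa> * (?L * \<sigma> + \<delta>) = (?\<kappa> * ?L) * \<sigma> + ?\<kappa> * \<delta>" by (simp add: algebra_simps)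
    also have "\<dots> \<le> ?C * \<sigma> + ?C * \<delta>" using KL K s discrepancy_nonneg by (intro add_mono
        mult_right_mono) auto
    finally have four: "?\<kappa> * (?L * \<sigma> + \<delta>) \<le> ?C * (\<sigma> + \<delta>)" by (simp add: distrib_left)
    have nonneg: "0 \<le> ?C * b * (sqrt \<sigma> + \<delta> / sqrt \<sigma>)" "0 \<le> ?\<kappa> * real CARD('d) ^ 3 * (a * b)" "0 \<le>
        ?\<kappa> * (?L * \<sigma> + \<delta>)"
      using s \<kappa> L C b a0 discrepancy_nonneg by auto
    show ?thesis
      by (rule add_mono[OF add_mono[OF mult_right_mono[OF k8 nonneg(1)] mult_mono[OF k6 three _
          nonneg(2)]]
            mult_mono[OF k2 four _ nonneg(3)]]) (use s in auto)
  qed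
  also have "\<dots> \<le> ?C * (b / sqrt \<sigma> + b * \<delta> / (\<sigma> * sqrt \<sigma>) + b\<^sup>2 / \<sigma>\<^sup>2 + b\<^sup>2 * \<delta> / \<sigma> ^ 3)"
  proof -
    have e: "(1 / \<sigma>) * sqrt \<sigma> = 1 / sqrt \<sigma>" using s by (simp add: field_simps)
    have e3: "(1 / \<sigma>) ^ 3 * \<sigma> = (1 / \<sigma>)\<^sup>2" using s by (simp add: power2_eq_square power3_eq_cube)
    have split: "i * (C * b * (r + d * q)) + i\<^sup>2 / 6 * (C * b\<^sup>2) + i ^ 3 / 2 * b\<^sup>2 * (C * (s + d))
        = C * (b * (i * r) + b * d * (i * q) + b\<^sup>2 * i\<^sup>2 / 6 + b\<^sup>2 * (i ^ 3 * s) / 2 + b\<^sup>2 * i ^ 3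
            * d / 2)"
      for i C b r d q s :: real
      by (simp add: algebra_simps add_divide_distrib)
    have eq: "(1 / \<sigma>) * (?C * b * (sqrt \<sigma> + \<delta> / sqrt \<sigma>)) + (1 / \<sigma>)\<^sup>2 / 6 * (?C * b\<^sup>2) + (1 / \<sigma>) ^
        3 / 2 * b\<^sup>2 * (?C * (\<sigma> + \<delta>))
        = ?C * (b * (1 / sqrt \<sigma>) + b * \<delta> / (\<sigma> * sqrt \<sigma>) + b\<^sup>2 * (1 / \<sigma>)\<^sup>2 * (1/6 + 1/2) + b\<^sup>2 * (1
            / \<sigma>) ^ 3 * \<delta> / 2)"
      using split[of "1 / \<sigma>" ?C b "sqrt \<sigma>" \<delta> "1 / sqrt \<sigma>" \<sigma>] unfolding e e3 by simp
    have "0 \<le> b\<^sup>2 * (1 / \<sigma>)\<^sup>2" "0 \<le> b\<^sup>2 * (1 / \<sigma>) ^ 3 * \<delta>" using s discrepancy_nonneg by auto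
    have "b * (1 / sqrt \<sigma>) + b * \<delta> / (\<sigma> * sqrt \<sigma>) + b\<^sup>2 * (1 / \<sigma>)\<^sup>2 * (1/6 + 1/2) + b\<^sup>2 * (1 / \<sigma>)
        ^ 3 * \<delta> / 2
       \<le> b / sqrt \<sigma> + b * \<delta> / (\<sigma> * sqrt \<sigma>) + b\<^sup>2 / \<sigma>\<^sup>2 + b\<^sup>2 * \<delta> / \<sigma> ^ 3"
    proof -
      have eqs: "b\<^sup>2 / \<sigma>\<^sup>2 = b\<^sup>2 * (1 / \<sigma>)\<^sup>2" "b\<^sup>2 * \<delta> / \<sigma> ^ 3 = b\<^sup>2 * (1 / \<sigma>) ^ 3 * \<delta>" "b / sqrt
          \<sigma> = b * (1 / sqrt \<sigma>)"
        by (simp_all add: power_divide)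
      have gen: "p + q + X * (1/6 + 1/2) + Y / 2 \<le> p + q + X + Y" if "0 \<le> X" "0 \<le> Y" for p q X Y
          :: real
        using that by simp
      show ?thesis
        unfolding eqs by (rule gen) fact+
    qed
    then show ?thesis unfolding eq using C by (intro mult_left_mono) auto
  qed
  finally show ?thesis .
qed

lemma smoothed_pi_half: "smoothed A (pi / 2) w = measure std_gaussian A" if "A \<in> sets borel"
  using that by (simp add: smoothed_def)

lemma sin_power_bounds:
  assumes "0 < \<theta>" "\<theta> \<le> pi / 2"
  shows "1 / sqrt (sin \<theta>) \<le> 2 / sqrt \<theta>" "1 / (sin \<theta> * sqrt (sin \<theta>)) \<le> 4 / (\<theta> * sqrt \<theta>)"
    "1 / (sin \<theta>)\<^sup>2 \<le> 4 / \<theta>\<^sup>2" "1 / sin \<theta> ^ 3 \<le> 8 / \<theta> ^ 3"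
proof -
  have s: "\<theta> / 2 \<le> sin \<theta>" using assms by (intro sin_ge_half) auto
  have q: "sqrt \<theta> / 2 \<le> sqrt (sin \<theta>)"
  proof -
    have "sqrt \<theta> / 2 = sqrt (\<theta> / 4)" by (simp add: real_sqrt_divide)
    also have "\<dots> \<le> sqrt (sin \<theta>)" using s assms by simp
    finally show ?thesis .
  qed
  have pos: "0 < \<theta> / 2" "0 < sqrt \<theta> / 2" using assms by auto
  show "1 / sqrt (sin \<theta>) \<le> 2 / sqrt \<theta>" using frac_le[OF _ _ pos(2) q, of 1 1] by simp
  have "(\<theta> / 2) * (sqrt \<theta> / 2) \<le> sin \<theta> * sqrt (sin \<theta>)" using s q pos by (intro mult_mono) auto
  from frac_le[OF _ _ mult_pos_pos[OF pos] this, of 1 1]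
  show "1 / (sin \<theta> * sqrt (sin \<theta>)) \<le> 4 / (\<theta> * sqrt \<theta>)" by simp
  show "1 / (sin \<theta>)\<^sup>2 \<le> 4 / \<theta>\<^sup>2"
    using frac_le[OF _ _ zero_less_power[OF pos(1)] power_mono[OF s], of 1 1 2] pos by (simp add:
        power_divide)
  show "1 / sin \<theta> ^ 3 \<le> 8 / \<theta> ^ 3"
    using frac_le[OF _ _ zero_less_power[OF pos(1)] power_mono[OF s], of 1 1 3] pos by (simp add:
        power_divide)
qed

text \<open>
  The bound of \<open>smoothed_deriv_le\<close> after inserting \<open>sin \<theta> \<ge> \<theta>/2\<close> and rounding the constants; it
  has an explicit primitive.
\<close>

definition path_bound :: "real \<Rightarrow> real" where
  "path_bound \<theta> = rate_const TYPE('d) *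
     (2 * b / sqrt \<theta> + 4 * b * \<delta> / (\<theta> * sqrt \<theta>) + 4 * b\<^sup>2 / \<theta>\<^sup>2 + 8 * b\<^sup>2 * \<delta> / \<theta> ^ 3)"

definition path_bound_primitive :: "real \<Rightarrow> real" where
  "path_bound_primitive \<theta> = rate_const TYPE('d) *
     (4 * b * sqrt \<theta> - 8 * b * \<delta> / sqrt \<theta> - 4 * b\<^sup>2 / \<theta> - 4 * b\<^sup>2 * \<delta> / \<theta>\<^sup>2)"

lemma path_bound_primitive_deriv:
  assumes "0 < \<theta>"
  shows "(path_bound_primitive has_real_derivative path_bound \<theta>) (at \<theta>)"
proof -
  have sq: "sqrt \<theta> * sqrt \<theta> = \<theta>" "sqrt \<theta> > 0" using assms by auto
  have 1: "((\<lambda>\<theta>. 4 * b * sqrt \<theta>) has_real_derivative 2 * b / sqrt \<theta>) (at \<theta>)"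
    using assms by (auto intro!: derivative_eq_intros simp: field_simps)
  have 2: "((\<lambda>\<theta>. 8 * b * \<delta> / sqrt \<theta>) has_real_derivative - (4 * b * \<delta> / (\<theta> * sqrt \<theta>))) (at \<theta>)"
    using assms sq by (auto intro!: derivative_eq_intros simp: divide_simps)
  have 3: "((\<lambda>\<theta>. 4 * b\<^sup>2 / \<theta>) has_real_derivative - (4 * b\<^sup>2 / \<theta>\<^sup>2)) (at \<theta>)"
    using assms by (auto intro!: derivative_eq_intros simp: power2_eq_square)
  have 4: "((\<lambda>\<theta>. 4 * b\<^sup>2 * \<delta> / \<theta>\<^sup>2) has_real_derivative - (8 * b\<^sup>2 * \<delta> / \<theta> ^ 3)) (at \<theta>)"
    using assms by (auto intro!: derivative_eq_intros simp: power2_eq_square power3_eq_cube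
        divide_simps)
  from DERIV_cmult[OF DERIV_diff[OF DERIV_diff[OF DERIV_diff[OF 1 2] 3] 4], of "rate_const
      TYPE('d)"]
  show ?thesis unfolding path_bound_primitive_def[abs_def] path_bound_def by simp
qed

text \<open>
  At \<open>\<theta> = \<pi>/2\<close> the smoothed indicator no longer depends on \<open>W\<close>.  The derivative bound is needed
  only for \<open>\<theta> < \<pi>/2\<close>, where \<open>cot \<theta>\<close> is positive; the end point is a null set.
\<close>

lemma smoothed_close_to_gaussian:
  assumes A: "convex A" "A \<in> sets borel" and t: "0 < t" "t \<le> pi / 2" and a: "a \<le> t / 2"
  shows "\<bar>avg (\<lambda>\<omega>. smoothed A t (W \<omega>)) - measure std_gaussian A\<bar>
    \<le> path_bound_primitive (pi / 2) - path_bound_primitive t"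
proof -
  let ?D = "\<lambda>\<theta>. avg (\<lambda>\<omega>. smoothed_deriv A \<theta> (W \<omega>))"
  let ?ind = "\<lambda>\<theta>. indicator {t..pi / 2} \<theta> :: real"
  note diff = smoothed_difference[OF A(2) t order_refl]
  have intD: "integrable lborel (\<lambda>\<theta>. ?ind \<theta> * ?D \<theta>)"
    unfolding average_cmult[symmetric] unfolding average_def
    by (intro integrable_divide Bochner_Integration.integrable_sum diff(1))
  have "measure std_gaussian A - avg (\<lambda>\<omega>. smoothed A t (W \<omega>)) = avg (\<lambda>\<omega>. smoothed A (pi / 2) (W \<omega>)
      - smoothed A t (W \<omega>))"
    by (simp add: average_diff smoothed_pi_half[OF A(2)])
  also have "\<dots> = (\<integral>\<theta>. ?ind \<theta> * ?D \<theta> \<partial>lborel)"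
    unfolding diff(2) average_cmult[symmetric] by (rule integral_average[symmetric], rule diff(1))
  finally have "\<bar>avg (\<lambda>\<omega>. smoothed A t (W \<omega>)) - measure std_gaussian A\<bar> = \<bar>\<integral>\<theta>. ?ind \<theta> * ?D \<theta>
      \<partial>lborel\<bar>"
    by (simp add: abs_minus_commute)
  also have "\<dots> \<le> (\<integral>\<theta>. \<bar>?ind \<theta> * ?D \<theta>\<bar> \<partial>lborel)" by (rule integral_abs_bound)
  also have "\<dots> \<le> (\<integral>\<theta>. ?ind \<theta> *\<^sub>R path_bound \<theta> \<partial>lborel)"
  proof (rule integral_mono_AE)
    show "integrable lborel (\<lambda>\<theta>. \<bar>?ind \<theta> * ?D \<theta>\<bar>)" using intD by simp
    show "integrable lborel (\<lambda>\<theta>. ?ind \<theta> *\<^sub>R path_bound \<theta>)"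
      using t unfolding path_bound_def by (intro borel_integrable_compact continuous_intros) auto
    have le: "\<bar>?ind \<theta> * ?D \<theta>\<bar> \<le> ?ind \<theta> *\<^sub>R path_bound \<theta>" if ne: "\<theta> \<noteq> pi / 2" for \<theta>
    proof (cases "\<theta> \<in> {t..pi / 2}")
      case True
      then have \<theta>: "0 < \<theta>" "\<theta> < pi / 2" using t ne by auto
      have "a \<le> sin \<theta>" using a True sin_ge_half[of \<theta>] \<theta> by auto
      note B = sin_power_bounds[of \<theta>]
      have b: "0 \<le> b" using ab by simp
      have "\<bar>?D \<theta>\<bar> \<le> rate_const TYPE('d) * (b / sqrt (sin \<theta>) + b * \<delta> / (sin \<theta> * sqrt (sin \<theta>)) +
          b\<^sup>2 / (sin \<theta>)\<^sup>2 + b\<^sup>2 * \<delta> / sin \<theta> ^ 3)"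
        by (rule smoothed_deriv_le[OF A \<theta> \<open>a \<le> sin \<theta>\<close>])
      also have "\<dots> = rate_const TYPE('d) * (b * (1 / sqrt (sin \<theta>)) + b * \<delta> * (1 / (sin \<theta> * sqrt
          (sin \<theta>)))
          + b\<^sup>2 * (1 / (sin \<theta>)\<^sup>2) + b\<^sup>2 * \<delta> * (1 / sin \<theta> ^ 3))" by simp
      also have "\<dots> \<le> rate_const TYPE('d) * (b * (2 / sqrt \<theta>) + b * \<delta> * (4 / (\<theta> * sqrt \<theta>)) + b\<^sup>2 *
          (4 / \<theta>\<^sup>2) + b\<^sup>2 * \<delta> * (8 / \<theta> ^ 3))"
        using \<theta> b discrepancy_nonneg rate_const_ge_1[where 'd = 'd]
        by (intro mult_left_mono add_mono B) auto
      also have "\<dots> = path_bound \<theta>" by (simp add: path_bound_def ac_simps)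
      finally show ?thesis using True by simp
    qed simp
    show "AE \<theta> in lborel. \<bar>?ind \<theta> * ?D \<theta>\<bar> \<le> ?ind \<theta> *\<^sub>R path_bound \<theta>"
      using AE_lborel_singleton[of "pi / 2"] by eventually_elim (rule le)
  qed
  also have "\<dots> = path_bound_primitive (pi / 2) - path_bound_primitive t"
  proof (rule integral_FTC_atLeastAtMost[OF t(2)])
    fix \<theta> assume "t \<le> \<theta>" "\<theta> \<le> pi / 2"
    then show "(path_bound_primitive has_vector_derivative path_bound \<theta>) (at \<theta> within {t..pi / 2})"
      using path_bound_primitive_deriv[of \<theta>] t
      by (auto simp: has_real_derivative_iff_has_vector_derivative intro:
          has_vector_derivative_at_within)
  next
    show "continuous_on {t..pi / 2} path_bound"
      using t unfolding path_bound_def by (intro continuous_intros) auto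
  qed
  finally show ?thesis .
qed

text \<open>
  Apply the smoothing inequality at \<open>\<theta>\<^sub>0 = K b\<close>.  The smoothing error of
  \<open>smoothed_close_to_gaussian\<close> is a multiple of \<open>b\<close> plus a multiple of \<open>\<delta> / K\<close>, and \<open>K\<close> is chosen
  to make the latter \<open>\<delta> / 4\<close>.  The terms with \<open>\<delta>\<close> on the right then add up to \<open>2 \<delta> / 3\<close>.  If
  \<open>K b > 1\<close>, the bound exceeds \<open>1\<close>.
\<close>

lemma discrepancy_bound: "\<delta> \<le> core_const TYPE('d) * b"
proof -
  let ?C = "rate_const TYPE('d)" and ?\<kappa> = "exp_moment TYPE('d)" and ?L = "layer_const TYPE('d)"
  have C: "1 \<le> ?C" and \<kappa>: "1 \<le> ?\<kappa>" and L: "1 \<le> ?L" by (rule rate_const_ge_1, rule exp_moment_ge_1,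
      rule layer_const_ge_1)
  have \<kappa>L: "1 \<le> ?\<kappa> * ?L" using \<kappa> L mult_mono[of 1 ?\<kappa> 1 ?L] by simp
  have b: "b > 0" using ab by simp
  define K where "K = 48 * ?C"
  have K: "48 \<le> K" using C by (simp add: K_def)
  have core: "core_const TYPE('d) = 2 * K + 48 * (?\<kappa> * ?L) * K" by (simp add: core_const_def K_def
      algebra_simps)
  show ?thesis
  proof (cases "K * b \<le> 1")
    case False
    have "K * b \<le> core_const TYPE('d) * b" unfolding core using K \<kappa>L b by (intro mult_right_mono)
        auto
    then show ?thesis using False discrepancy_le_1 by simp
  next
    case True
    define t where "t = K * b"
    have t: "0 < t" "t \<le> 1" using K b True by (auto simp: t_def)
    have pi: "1 < pi / 2" using pi_gt3 by simp
    have at: "a \<le> t / 2"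
    proof -
      have "a \<le> 24 * b" using ab by simp
      also have "\<dots> \<le> (K / 2) * b" using K b by (intro mult_right_mono) auto
      finally show ?thesis by (simp add: t_def)
    qed
    define \<eta> where "\<eta> = 12 * ?C * b + \<delta> / 4"
    have prim: "path_bound_primitive (pi / 2) - path_bound_primitive t \<le> \<eta>"
    proof -
      have b1: "b \<le> 1 / K" using True K by (simp add: field_simps)
      have t1: "b / sqrt t \<le> 1 / K"
      proof -
        have "t\<^sup>2 \<le> t" using t by (simp add: power2_eq_square mult_left_le)
        then have "t \<le> sqrt t" by (rule real_le_rsqrt)
        then have "b / sqrt t \<le> b / t" using t b by (intro divide_left_mono) auto
        also have "\<dots> = 1 / K" using b K by (simp add: t_def)
        finally show ?thesis .
      qed
      have t2: "b\<^sup>2 / t \<le> b" using b K by (simp add: t_def power2_eq_square field_simps)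
      have t3: "b\<^sup>2 / t\<^sup>2 \<le> 1 / K"
      proof -
        have "b\<^sup>2 / t\<^sup>2 = (1 / K) * (1 / K)" using b by (simp add: t_def power2_eq_square)
        also have "\<dots> \<le> (1 / K) * 1" using K by (intro mult_left_mono) auto
        finally show ?thesis by simp
      qed
      have p2: "sqrt (pi / 2) \<le> 2" using pi_less_4 by (intro real_le_lsqrt) auto
      let ?h = "\<lambda>\<theta>. 4 * b * sqrt \<theta> - 8 * b * \<delta> / sqrt \<theta> - 4 * b\<^sup>2 / \<theta> - 4 * b\<^sup>2 * \<delta> / \<theta>\<^sup>2"
      have "0 \<le> 8 * b * \<delta> / sqrt (pi / 2)" "0 \<le> 4 * b\<^sup>2 / (pi / 2)" "0 \<le> 4 * b\<^sup>2 * \<delta> / (pi / 2)\<^sup>2"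
        using b discrepancy_nonneg by auto
      then have "?h (pi / 2) \<le> 4 * b * sqrt (pi / 2)" by linarith
      also have "\<dots> \<le> 4 * b * 2" using p2 b by (intro mult_left_mono) auto
      finally have 1: "?h (pi / 2) \<le> 8 * b" by simp
      have "- ?h t \<le> 8 * \<delta> * (b / sqrt t) + 4 * (b\<^sup>2 / t) + 4 * \<delta> * (b\<^sup>2 / t\<^sup>2)"
        using b t by (simp add: ac_simps)
      also have "\<dots> \<le> 8 * \<delta> * (1 / K) + 4 * b + 4 * \<delta> * (1 / K)"
        using discrepancy_nonneg by (intro add_mono mult_left_mono t1 t2 t3) auto
      finally have 2: "- ?h t \<le> 12 * \<delta> / K + 4 * b" by simp
      have "path_bound_primitive (pi / 2) - path_bound_primitive t = ?C * (?h (pi / 2) - ?h t)"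
        by (simp add: path_bound_primitive_def algebra_simps)
      also have "\<dots> \<le> ?C * (12 * b + 12 * \<delta> / K)" using 1 2 C by (intro mult_left_mono) auto
      also have "\<dots> = \<eta>" using C by (simp add: \<eta>_def K_def algebra_simps)
      finally show ?thesis .
    qed
    have \<eta>0: "0 \<le> \<eta>" using C b discrepancy_nonneg by (simp add: \<eta>_def)
    have "\<delta> \<le> 4 / 3 * \<eta> + \<delta> / 3 + 8 * ?\<kappa> * ?L * (sin t / cos t)"
    proof (rule discrepancy_smoothing[OF _ _ \<eta>0])
      fix A :: "(real^'d) set" assume "convex A" "A \<in> sets borel"
      then show "\<bar>avg (\<lambda>\<omega>. smoothed A t (W \<omega>)) - measure std_gaussian A\<bar> \<le> \<eta>"
        using smoothed_close_to_gaussian[of A t] t pi at prim by linarith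
    qed (use t pi in auto)
    moreover have "8 * ?\<kappa> * ?L * (sin t / cos t) \<le> 8 * ?\<kappa> * ?L * (2 * t)"
    proof (rule mult_left_mono)
      have "cos (pi / 3) \<le> cos t" using t pi_gt3 by (intro cos_monotone_0_pi_le) auto
      then have c: "1 / 2 \<le> cos t" by (simp add: cos_60)
      have "sin t / cos t \<le> t / (1 / 2)" using c t sin_x_le_x[of t] by (intro frac_le) auto
      then show "sin t / cos t \<le> 2 * t" by simp
    qed (use \<kappa> L in auto)
    moreover have "8 * ?\<kappa> * ?L * (2 * t) = 16 * (?\<kappa> * ?L * t)" "\<eta> = 12 * (?C * b) + \<delta> / 4"
      by (simp_all add: \<eta>_def)
    ultimately have "\<delta> \<le> 48 * (?C * b) + 48 * (?\<kappa> * ?L * t)" by linarith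
    also have "\<dots> \<le> core_const TYPE('d) * b"
      unfolding core t_def using K b by (simp add: K_def algebra_simps)
    finally show ?thesis .
  qed
qed

end

section \<open>Random permutations\<close>

text \<open>
  Expand the product of the two sums after a move, average over the permutations (which the move
  leaves invariant) and add up all moves: the terms of first order are \<open>-4\<close> times the product
  twice.
\<close>

lemma sum_jump_products:
  fixes m m' :: "nat \<Rightarrow> nat \<Rightarrow> real"
  assumes anti: "\<And>u v. u \<in> {1..n} \<Longrightarrow> v \<in> {1..n} \<Longrightarrow> m u v = - m v u"
    and anti': "\<And>u v. u \<in> {1..n} \<Longrightarrow> v \<in> {1..n} \<Longrightarrow> m' u v = - m' v u"
  shows "(\<Sum>p | p permutes {1..n}. \<Sum>ie\<in>moves n. jump n m ie p * jump n m' ie p)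
       = 8 * (\<Sum>p | p permutes {1..n}. pair_sum n m p * pair_sum n m' p)"
proof -
  let ?P = "{p. p permutes {1..n}}" and ?W = "pair_sum n m" and ?W' = "pair_sum n m'"
  have "(\<Sum>p\<in>?P. jump n m ie p * jump n m' ie p) = - (\<Sum>p\<in>?P. jump n m ie p * ?W' p + ?W p * jump n
      m' ie p)"
    if ie: "ie \<in> moves n" for ie
  proof -
    obtain i e where ie': "ie = (i, e)" "i \<in> {1..n}" using ie by auto
    let ?q = "inv (relocate n (i, e))"
    have q: "?q permutes {1..n}" by (intro permutes_inv relocate_permutes ie')
    have "(\<Sum>p\<in>?P. ?W p * ?W' p) = (\<Sum>p\<in>?P. ?W (p \<circ> ?q) * ?W' (p \<circ> ?q))"
      by (rule sum.reindex_bij_betw[OF bij_betw_compose_perm[OF q], symmetric])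
    also have "\<dots> = (\<Sum>p\<in>?P. (?W p + jump n m ie p) * (?W' p + jump n m' ie p))"
    proof (rule sum.cong[OF refl])
      fix p assume "p \<in> ?P"
      then show "?W (p \<circ> ?q) * ?W' (p \<circ> ?q) = (?W p + jump n m ie p) * (?W' p + jump n m' ie p)"
        using pair_sum_jump[of n m p i e, OF anti _ ie'(2)] pair_sum_jump[of n m' p i e, OF anti'
            _ ie'(2)] ie'(1) by simp
    qed
    finally show ?thesis by (simp add: algebra_simps sum.distrib)
  qed
  then have "(\<Sum>ie\<in>moves n. \<Sum>p\<in>?P. jump n m ie p * jump n m' ie p)
      = (\<Sum>ie\<in>moves n. - (\<Sum>p\<in>?P. jump n m ie p * ?W' p + ?W p * jump n m' ie p))"
    by (rule sum.cong[OF refl])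
  also have "\<dots> = - (\<Sum>p\<in>?P. \<Sum>ie\<in>moves n. jump n m ie p * ?W' p + ?W p * jump n m' ie p)"
    unfolding sum_negf by (subst sum.swap) (rule refl)
  also have "(\<Sum>p\<in>?P. \<Sum>ie\<in>moves n. jump n m ie p * ?W' p + ?W p * jump n m' ie p)
      = (\<Sum>p\<in>?P. (\<Sum>ie\<in>moves n. jump n m ie p) * ?W' p + ?W p * (\<Sum>ie\<in>moves n. jump n m' ie p))"
    by (simp only: sum.distrib sum_distrib_left sum_distrib_right)
  also have "\<dots> = (\<Sum>p\<in>?P. - 8 * (?W p * ?W' p))"
  proof (rule sum.cong[OF refl])
    fix p assume "p \<in> ?P"
    then show "(\<Sum>ie\<in>moves n. jump n m ie p) * ?W' p + ?W p * (\<Sum>ie\<in>moves n. jump n m' ie p) = - 8 *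
        (?W p * ?W' p)"
      using sum_jumps[of n m p, OF anti] sum_jumps[of n m' p, OF anti'] by simp
  qed
  finally show ?thesis by (subst sum.swap) (simp add: sum_distrib_left[symmetric] sum_negf)
qed

lemma sum_pair_sum_zero:
  fixes m :: "nat \<Rightarrow> nat \<Rightarrow> real"
  assumes anti: "\<And>u v. u \<in> {1..n} \<Longrightarrow> v \<in> {1..n} \<Longrightarrow> m u v = - m v u"
  shows "(\<Sum>p | p permutes {1..n}. pair_sum n m p) = 0"
proof -
  have "(\<Sum>p | p permutes {1..n}. \<Sum>ie\<in>moves n. jump n m ie p) = (\<Sum>p | p permutes {1..n}. - 4 *
      pair_sum n m p)"
    using sum_jumps[of n m, OF anti] by (intro sum.cong refl) simp
  then show ?thesis
    using odd_jump_statistic_mean_zero[of "\<lambda>x. x" n m] by (simp add: sum_distrib_left[symmetric]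
        sum_negf)
qed

lemma pair_sum_linear:
  assumes "linear f"
  shows "f (pair_sum n m p) = pair_sum n (\<lambda>u v. f (m u v)) p"
  by (simp add: pair_sum_def linear_sum[OF assms])

lemma jump_linear:
  assumes "linear f"
  shows "f (jump n m ie p) = jump n (\<lambda>u v. f (m u v)) ie p"
  by (simp add: jump_def linear_sum[OF assms] linear_cmul[OF assms])

lemma linear_component: "linear (\<lambda>x :: real^'d. x $ r)"
  by (intro bounded_linear.linear bounded_linear_vec_nth)

text \<open>
  The walk by moves to the end and to the front is balanced with \<open>a = 2 B\<close> and
  \<open>b = 384 sqrt n B\<^sup>2\<close>.  On the ball of radius \<open>2 B\<close> the monomials of degree two and three have
  Lipschitz constants \<open>4 B\<close> and \<open>12 B\<^sup>2\<close>; the resulting variance bound for degree three is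
  \<open>4096 n (12 B\<^sup>3)\<^sup>2 = (a b)\<^sup>2\<close>, which determines \<open>b\<close>.  Unit covariance gives \<open>n B\<^sup>2 \<ge> 1\<close>, hence
  \<open>a \<le> b\<close>.
\<close>

lemma permutation_discrepancy:
  fixes m :: "nat \<Rightarrow> nat \<Rightarrow> real^'d::finite"
  assumes anti: "\<And>u v. u \<in> {1..n} \<Longrightarrow> v \<in> {1..n} \<Longrightarrow> m u v = - m v u"
    and row: "\<And>u. u \<in> {1..n} \<Longrightarrow> (\<Sum>v\<in>{1..n}. norm (m u v)) \<le> B"
    and cov: "\<And>r s. average {p. p permutes {1..n}} (\<lambda>p. pair_sum n m p $ r * pair_sum n m p $ s) =
        (if r = s then 1 else 0)"
  shows "discrepancy {p. p permutes {1..n}} (pair_sum n m) \<le> 384 * core_const TYPE('d) * (sqrt n *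
      B\<^sup>2)"
proof -
  let ?P = "{p. p permutes {1..n}}"
  have P: "finite ?P" "?P \<noteq> {}" "card ?P = fact n"
    by (auto simp: finite_permutations card_permutations intro: permutes_id)
  have comp: "jump n m ie p $ r = jump n (\<lambda>u v. m u v $ r) ie p" "pair_sum n m p $ r = pair_sum n
      (\<lambda>u v. m u v $ r) p" for ie p r
    using jump_linear[OF linear_component] pair_sum_linear[OF linear_component] by blast+
  have antic: "m u v $ r = - m v u $ r" if "u \<in> {1..n}" "v \<in> {1..n}" for u v r
    using anti[OF that] by simp
  have mean2: "(\<Sum>p\<in>?P. \<Sum>ie\<in>moves n. jump n m ie p $ r * jump n m ie p $ s) / fact n = (if r = s
      then 8 else 0)" for r s
  proof -
    have "(\<Sum>p\<in>?P. \<Sum>ie\<in>moves n. jump n m ie p $ r * jump n m ie p $ s) = 8 * (\<Sum>p\<in>?P. pair_sum n m p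
        $ r * pair_sum n m p $ s)"
      unfolding comp by (intro sum_jump_products antic)
    then have "(\<Sum>p\<in>?P. \<Sum>ie\<in>moves n. jump n m ie p $ r * jump n m ie p $ s) / fact n
        = 8 * average ?P (\<lambda>p. pair_sum n m p $ r * pair_sum n m p $ s)"
      by (simp only: average_def P(3) of_nat_fact times_divide_eq_right)
    then show ?thesis by (simp only: cov) simp
  qed
  have jl: "norm (jump n m ie p) \<le> 2 * B" if "p \<in> ?P" "ie \<in> moves n" for ie p
    using norm_jump_le[of n m B p ie, OF row] that by blast
  \<comment> \<open>The squared jumps in one coordinate have mean total \<open>8\<close> and are at most \<open>4 B\<^sup>2\<close> each.\<close>
  have B: "1 \<le> n * B\<^sup>2"
  proof -
    have "(8::real) = (\<Sum>p\<in>?P. \<Sum>ie\<in>moves n. jump n m ie p $ undefined * jump n m ie p $ undefined)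
        / fact n"
      using mean2[of undefined undefined] by simp
    also have "\<dots> \<le> (\<Sum>p\<in>?P. \<Sum>ie\<in>moves n. (2 * B)\<^sup>2) / fact n"
    proof (intro divide_right_mono sum_mono)
      fix p ie assume "p \<in> ?P" "ie \<in> moves n"
      then have "\<bar>jump n m ie p $ undefined\<bar> \<le> 2 * B" using jl component_le_norm_cart order_trans
          by blast
      then show "jump n m ie p $ undefined * jump n m ie p $ undefined \<le> (2 * B)\<^sup>2"
        using power_mono[of "\<bar>jump n m ie p $ undefined\<bar>" "2 * B" 2] by (simp add: power2_eq_square)
    qed simp
    also have "\<dots> = 8 * (n * B\<^sup>2)" using P(3) by (simp add: card_cartesian_product
        power_mult_distrib)
    finally show ?thesis by simp
  qed
  then have n: "n \<ge> 1" by (cases n) auto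
  have B0: "B \<ge> 0"
  proof -
    have "0 \<le> (\<Sum>v\<in>{1..n}. norm (m 1 v))" by (intro sum_nonneg) auto
    then show ?thesis using row[of 1] n by auto
  qed
  then have Bpos: "B > 0" using B by (cases "B = 0") auto
  have sB: "1 \<le> sqrt n * B" 
  proof -
    have "sqrt 1 \<le> sqrt (n * B\<^sup>2)" using B by (intro real_sqrt_le_mono) simp
    then show ?thesis using B0 by (simp add: real_sqrt_mult)
  qed
  define b where "b = 384 * (sqrt n * B\<^sup>2)"
  have b2: "b\<^sup>2 = 147456 * (n * B ^ 4)" by (simp add: b_def power_mult_distrib)
  have small: "\<bar>x $ r\<bar> \<le> 2 * B" if "norm x \<le> 2 * B" for x :: "real^'d" and r
    using that component_le_norm_cart[of x r] by simp
  have dif: "\<bar>x $ r - y $ r\<bar> \<le> norm (x - y)" for x y :: "real^'d" and r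
    using component_le_norm_cart[of "x - y" r] by simp
  have lip2: "\<bar>x $ r * x $ s - y $ r * y $ s\<bar> \<le> (4 * B) * norm (x - y)"
    if x: "norm x \<le> 2 * B" and y: "norm y \<le> 2 * B" for x y :: "real^'d" and r s
  proof -
    have "x $ r * x $ s - y $ r * y $ s = x $ r * (x $ s - y $ s) + y $ s * (x $ r - y $ r)"
      by (simp add: algebra_simps)
    also have "\<bar>\<dots>\<bar> \<le> \<bar>x $ r\<bar> * \<bar>x $ s - y $ s\<bar> + \<bar>y $ s\<bar> * \<bar>x $ r - y $ r\<bar>"
      unfolding abs_mult[symmetric] by (rule abs_triangle_ineq)
    also have "\<dots> \<le> 2 * B * norm (x - y) + 2 * B * norm (x - y)"
      using B0 by (intro add_mono mult_mono small x y dif) auto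
    finally show ?thesis by simp
  qed
  have lip3: "\<bar>x $ r * x $ s * x $ t - y $ r * y $ s * y $ t\<bar> \<le> (12 * B\<^sup>2) * norm (x - y)"
    if x: "norm x \<le> 2 * B" and y: "norm y \<le> 2 * B" for x y :: "real^'d" and r s t
  proof -
    have "x $ r * x $ s * x $ t - y $ r * y $ s * y $ t = x $ t * (x $ r * x $ s - y $ r * y $ s)
        + y $ r * y $ s * (x $ t - y $ t)"
      by (simp add: algebra_simps)
    also have "\<bar>\<dots>\<bar> \<le> \<bar>x $ t\<bar> * \<bar>x $ r * x $ s - y $ r * y $ s\<bar> + \<bar>y $ r\<bar> * \<bar>y $ s\<bar> * \<bar>x $ t - y $
        t\<bar>"
      unfolding abs_mult[symmetric] by (rule abs_triangle_ineq)
    also have "\<dots> \<le> 2 * B * (4 * B * norm (x - y)) + 2 * B * (2 * B) * norm (x - y)"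
      using B0 by (intro add_mono mult_mono small x y dif lip2) auto
    finally show ?thesis by (simp add: power2_eq_square)
  qed
  interpret W: balanced_walk ?P "pair_sum n m" "moves n" "\<lambda>ie p. p \<circ> inv (relocate n ie)" "jump n
      m" "2 * B" b
  proof
    show "finite ?P" "?P \<noteq> {}" using P by auto
    show "finite (moves n)" by simp
    show "bij_betw (\<lambda>p. p \<circ> inv (relocate n ie)) ?P ?P" if ie: "ie \<in> moves n" for ie
    proof -
      obtain i e where "ie = (i, e)" "i \<in> {1..n}" using ie by auto
      then show ?thesis by (simp only:) (intro bij_betw_compose_perm permutes_inv relocate_permutes)
    qed
    show "pair_sum n m (p \<circ> inv (relocate n ie)) = pair_sum n m p + jump n m ie p" if "ie \<in> moves
        n" "p \<in> ?P" for ie p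
      using that pair_sum_jump[of n m p, OF anti] by (cases ie) auto
    show "(\<Sum>ie\<in>moves n. jump n m ie p) = - 4 *\<^sub>R pair_sum n m p" if "p \<in> ?P" for p
      using that sum_jumps[of n m p, OF anti] by blast
    show "norm (jump n m ie p) \<le> 2 * B" if "ie \<in> moves n" "p \<in> ?P" for ie p
      by (rule jl[OF that(2,1)])
    show "average ?P (\<lambda>p. ((\<Sum>ie\<in>moves n. jump n m ie p $ r * jump n m ie p $ s) - (if r = s then 8
        else 0))\<^sup>2) \<le> b\<^sup>2" for r s
    proof -
      have "average ?P (\<lambda>p. ((\<Sum>ie\<in>moves n. jump n m ie p $ r * jump n m ie p $ s) - (if r = s then
          8 else 0))\<^sup>2)
          \<le> 4096 * n * (B * (4 * B))\<^sup>2"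
        using jump_statistic_variance[of n m B "\<lambda>x. x $ r * x $ s" "4 * B", OF anti row lip2] B0
            P(3)
        unfolding mean2 average_def by simp
      also have "\<dots> \<le> b\<^sup>2" unfolding b2 using B0 by (simp add: power_mult_distrib power2_eq_square
          power4_eq_xxxx)
      finally show ?thesis .
    qed
    show "average ?P (\<lambda>p. (\<Sum>ie\<in>moves n. jump n m ie p $ r * jump n m ie p $ s * jump n m ie p $
        t)\<^sup>2) \<le> (2 * B * b)\<^sup>2" for r s t
    proof -
      have mean0: "(\<Sum>p\<in>?P. \<Sum>ie\<in>moves n. jump n m ie p $ r * jump n m ie p $ s * jump n m ie p $ t)
          = 0"
        by (rule odd_jump_statistic_mean_zero) simp
      have "average ?P (\<lambda>p. (\<Sum>ie\<in>moves n. jump n m ie p $ r * jump n m ie p $ s * jump n m ie p $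
          t)\<^sup>2)
          \<le> 4096 * n * (B * (12 * B\<^sup>2))\<^sup>2"
        using jump_statistic_variance[of n m B "\<lambda>x. x $ r * x $ s * x $ t" "12 * B\<^sup>2", OF anti row
            lip3] B0 P(3)
        unfolding mean0 average_def by simp
      also have "\<dots> = (2 * B * b)\<^sup>2"
        unfolding power_mult_distrib[of _ b] b2 by (simp add: power_mult_distrib power2_eq_square
            power4_eq_xxxx)
      finally show ?thesis .
    qed
    show "real (card (moves n)) * (2 * B) ^ 4 \<le> b\<^sup>2"
      unfolding b2 by (simp add: card_cartesian_product power_mult_distrib)
    show "0 < 2 * B" using Bpos by simp
    have "2 * B * 1 \<le> 384 * B * (sqrt n * B)" using sB Bpos by (intro mult_mono) auto
    then show "2 * B \<le> b" by (simp add: b_def power2_eq_square ac_simps)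
  qed
  show ?thesis using W.discrepancy_bound by (simp add: b_def ac_simps)
qed

text \<open>
  The sum of the \<open>2n\<close> squared jumps has eight times this mean, and each jump is at most \<open>2 B\<close>.
\<close>

lemma pair_sum_second_moment_le:
  fixes m :: "nat \<Rightarrow> nat \<Rightarrow> real"
  assumes anti: "\<And>u v. u \<in> {1..n} \<Longrightarrow> v \<in> {1..n} \<Longrightarrow> m u v = - m v u"
    and row: "\<And>u. u \<in> {1..n} \<Longrightarrow> (\<Sum>v\<in>{1..n}. \<bar>m u v\<bar>) \<le> B"
  shows "average {p. p permutes {1..n}} (\<lambda>p. (pair_sum n m p)\<^sup>2) \<le> n * B\<^sup>2"
proof -
  let ?P = "{p. p permutes {1..n}}"
  have c: "card ?P = fact n" by (simp add: card_permutations)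
  have "8 * (\<Sum>p\<in>?P. pair_sum n m p * pair_sum n m p) = (\<Sum>p\<in>?P. \<Sum>ie\<in>moves n. jump n m ie p * jump n
      m ie p)"
    by (rule sum_jump_products[OF anti anti, symmetric])
  also have "\<dots> \<le> (\<Sum>p\<in>?P. \<Sum>ie\<in>moves n. (2 * B)\<^sup>2)"
  proof (intro sum_mono)
    fix p ie assume "p \<in> ?P" "ie \<in> moves n"
    then have "\<bar>jump n m ie p\<bar> \<le> 2 * B" using norm_jump_le[of n m B p ie] row by simp
    then show "jump n m ie p * jump n m ie p \<le> (2 * B)\<^sup>2"
      using power_mono[of "\<bar>jump n m ie p\<bar>" "2 * B" 2] by (simp add: power2_eq_square)
  qed
  also have "\<dots> = 8 * (fact n * (n * B\<^sup>2))" using c by (simp add: card_cartesian_product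
      power_mult_distrib)
  finally show ?thesis unfolding average_def c by (simp add: field_simps power2_eq_square)
qed

lemma std_gaussian_negligible:
  fixes N :: "(real^'d::finite) set"
  assumes "negligible N" "N \<in> sets borel"
  shows "measure std_gaussian N = 0"
proof -
  have "N \<in> null_sets lborel"
    using assms by (simp add: negligible_iff_null_sets null_sets_completion_iff)
  then have "AE x in lborel. x \<notin> N" by (rule AE_not_in)
  then have "(\<integral>\<^sup>+x. ennreal (gauss_density x) * indicator N x \<partial>lborel) = (\<integral>\<^sup>+(x::real^'d). 0
      \<partial>lborel)"
    by (intro nn_integral_cong_AE) (auto elim!: eventually_mono simp: indicator_def)
  then have "emeasure std_gaussian N = 0"
    using assms(2) by (simp add: std_gaussian_eq emeasure_density)
  then show ?thesis by (simp add: measure_def)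
qed

text \<open>
  A convex set lies between its interior and its closure, which are convex Borel sets and differ
  by the frontier.  Every set is measurable for the completion of the finitely supported \<open>\<mu>\<close>, and
  a convex set is measurable for that of \<open>\<nu>\<close>, so both completed measures can be compared on these
  two Borel sets.
\<close>

lemma convex_dist_le:
  fixes \<mu> \<nu> :: "(real^'d::finite) measure"
  assumes \<mu>: "finite_measure \<mu>" "sets \<mu> = sets borel" and R: "finite R" "- R \<in> null_sets \<mu>"
    and \<nu>: "finite_measure \<nu>" "sets \<nu> = sets borel" and fr: "\<And>A. convex A \<Longrightarrow> measure \<nu> (frontier A)
        = 0"
    and le: "\<And>A. convex A \<Longrightarrow> A \<in> sets borel \<Longrightarrow> \<bar>measure \<mu> A - measure \<nu> A\<bar> \<le> c"
  shows "convex_dist \<mu> \<nu> \<le> c"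
  unfolding convex_dist_def
proof (rule cSUP_least)
  show "{A :: (real^'d) set. convex A} \<noteq> {}" by (auto intro: convex_empty)
  fix A :: "(real^'d) set" assume "A \<in> {A. convex A}"
  then have A: "convex A" by simp
  interpret \<mu>: finite_measure \<mu> by (rule \<mu>)
  interpret \<nu>: finite_measure \<nu> by (rule \<nu>)
  let ?I = "interior A" and ?C = "closure A"
  have IC: "?I \<in> sets borel" "?C \<in> sets borel" "convex ?I" "convex ?C" using A by auto
  have sand: "?I \<subseteq> A" "A \<subseteq> ?C" by (auto simp: interior_subset closure_subset)
  have fm: "finite_measure (completion M)" if "finite_measure M" for M :: "(real^'d) measure"
    using that by (intro finite_measureI) (simp add: finite_measure.emeasure_finite)
  have mono: "measure M ?I \<le> measure (completion M) A" "measure (completion M) A \<le> measure M ?C"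
    if M: "finite_measure M" "sets M = sets borel" and "A \<in> sets (completion M)" for M
  proof -
    interpret c: finite_measure "completion M" by (rule fm[OF M(1)])
    have ms: "?I \<in> sets M" "?C \<in> sets M" using IC M by auto
    have "measure (completion M) ?I \<le> measure (completion M) A"
      using that sand by (intro c.finite_measure_mono) auto
    then show "measure M ?I \<le> measure (completion M) A" using ms by simp
    have "measure (completion M) A \<le> measure (completion M) ?C"
      using ms sand by (intro c.finite_measure_mono) auto
    then show "measure (completion M) A \<le> measure M ?C" using ms by simp
  qed
  have "A \<in> sets (completion \<mu>)"
  proof (rule sets_completionI[of A "A \<inter> R" "A - R" "- R"])
    have "finite (A \<inter> R)" using R by auto
    then show "A \<inter> R \<in> sets \<mu>" using \<mu>(2) by (simp add: finite_imp_closed)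
  qed (use R in auto)
  note M = mono[OF \<mu> this]
  have frn: "frontier A \<in> null_sets \<nu>"
    using fr[OF A] \<nu>(2) by (simp add: null_sets_def \<nu>.emeasure_eq_measure)
  have "A \<in> sets (completion \<nu>)"
  proof (rule sets_completionI[of A ?I "A \<inter> frontier A" "frontier A"])
    show "A = ?I \<union> A \<inter> frontier A" using sand by (auto simp: frontier_def)
  qed (use frn IC \<nu>(2) in auto)
  note N = mono[OF \<nu> this]
  have "measure \<nu> ?C \<le> measure \<nu> (?I \<union> frontier A)"
    using IC \<nu>(2) by (intro \<nu>.finite_measure_mono) (auto simp: frontier_def)
  also have "\<dots> \<le> measure \<nu> ?I + measure \<nu> (frontier A)"
    using IC \<nu>(2) by (intro measure_Un_le) auto
  finally have "measure \<nu> ?C \<le> measure \<nu> ?I" using fr[OF A] by simp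
  then show "\<bar>measure (completion \<mu>) A - measure (completion \<nu>) A\<bar> \<le> c"
    using M N le[OF IC(3,1)] le[OF IC(4,2)] by linarith
qed

lemma expectation_uniform_perm:
  fixes f :: "(nat \<Rightarrow> nat) \<Rightarrow> real"
  shows "measure_pmf.expectation (uniform_perm n) f = average {p. p permutes {1..n}} f"
  unfolding uniform_perm_def average_def
  by (subst integral_pmf_of_set) (auto simp: finite_permutations intro: permutes_id)

lemma matrix_vector_mult_eq_sum: "(A *v x) $ r = (\<Sum>j\<in>UNIV. A $ r $ j * x $ j)"
  by (simp add: matrix_vector_mult_def)

lemma row_sum_le_beta:
  fixes M :: "'d::finite \<Rightarrow> nat \<Rightarrow> nat \<Rightarrow> real"
  assumes "u \<in> {1..n}"
  shows "(\<Sum>v=1..n. \<bar>M r u v\<bar>) \<le> beta n M"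
  unfolding beta_def
  by (rule cSUP_upper2[where x = "(r, u)"]) (use assms in auto)

theorem theorem3p6:
  "\<exists>C>0. \<forall>n (M :: 'd::finite \<Rightarrow> nat \<Rightarrow> nat \<Rightarrow> real) \<Sigma>.
     (\<forall>r. antisymmetric_matrix n (M r)) \<longrightarrow>
     (\<forall>r. measure_pmf.variance (uniform_perm n) (\<lambda>p. perm_stat n M p $ r) = 1) \<longrightarrow>
     \<Sigma> = covariance_matrix (measure_pmf (uniform_perm n)) (perm_stat n M) \<longrightarrow>
     positive_definite \<Sigma> \<longrightarrow>
     convex_dist
         (distr (measure_pmf (uniform_perm n)) borel (perm_stat n M))
         (distr std_gaussian borel (\<lambda>z. matrix_sqrt \<Sigma> *v z))
       \<le> C * (onorm (\<lambda>x. matrix_inv (matrix_sqrt \<Sigma>) *v x))\<^sup>2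
           * (real n * beta n M ^ 3 + sqrt (real n) * beta n M * beta2 n M powr (1 / 4))"
proof -
  define C where "C = 384 * core_const TYPE('d) * (real CARD('d))\<^sup>2"
  have C: "C > 0" using core_const_pos[where 'd = 'd] by (simp add: C_def)
  have main: "convex_dist
         (distr (measure_pmf (uniform_perm n)) borel (perm_stat n M))
         (distr std_gaussian borel (\<lambda>z. matrix_sqrt \<Sigma> *v z))
       \<le> C * (onorm (\<lambda>x. matrix_inv (matrix_sqrt \<Sigma>) *v x))\<^sup>2
           * (real n * beta n M ^ 3 + sqrt (real n) * beta n M * beta2 n M powr (1 / 4))"
    if antiM: "\<forall>r. antisymmetric_matrix n (M r)"
      and var: "\<forall>r. measure_pmf.variance (uniform_perm n) (\<lambda>p. perm_stat n M p $ r) = 1"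
      and \<Sigma>: "\<Sigma> = covariance_matrix (measure_pmf (uniform_perm n)) (perm_stat n M)"
      and pd: "positive_definite \<Sigma>"
    for n and M :: "'d \<Rightarrow> nat \<Rightarrow> nat \<Rightarrow> real" and \<Sigma>
  proof -
    let ?P = "{p. p permutes {1..n}}" and ?X = "perm_stat n M"
    define B where "B = matrix_sqrt \<Sigma>"
    define B' where "B' = matrix_inv B"
    have B: "positive_definite B" "B ** B = \<Sigma>" using matrix_sqrt_works[OF pd] by (auto simp: B_def)
    have symB: "transpose B = B" using B(1) by (simp add: positive_definite_def)
    have inv: "B' ** B = mat 1" "B ** B' = mat 1"
    proof -
      have "inj ((*v) B)"
      proof (rule injI)
        fix x y assume "B *v x = B *v y"
        then have "(x - y) \<bullet> (B *v (x - y)) = 0" by (simp add: matrix_vector_mult_diff_distrib)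
        then show "x = y" using B(1) unfolding positive_definite_def by (metis less_irrefl
            right_minus_eq)
      qed
      then have "invertible B" by (simp add: invertible_left_inverse
          matrix_left_invertible_injective)
      then have "B ** matrix_inv B = mat 1 \<and> matrix_inv B ** B = mat 1"
        unfolding invertible_def matrix_inv_def by (rule someI_ex)
      then show "B' ** B = mat 1" "B ** B' = mat 1" unfolding B'_def by auto
    qed
    have B'B: "B' *v (B *v x) = x" and BB': "B *v (B' *v x) = x" for x
      using inv by (simp_all add: matrix_vector_mul_assoc)
    define s where "s = onorm ((*v) B')"
    have bl: "bounded_linear ((*v) B')" by (rule matrix_vector_mul_bounded_linear)
    have s0: "0 \<le> s" unfolding s_def by (rule onorm_pos_le[OF bl])
    define mv where "mv = (\<lambda>u v. \<chi> r. M r u v)"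
    define m where "m = (\<lambda>u v. B' *v mv u v)"
    have antic: "M r u v = - M r v u" if "u \<in> {1..n}" "v \<in> {1..n}" for r u v
      using antiM that unfolding antisymmetric_matrix_def by blast
    have antimv: "mv u v = - mv v u" if "u \<in> {1..n}" "v \<in> {1..n}" for u v
      unfolding mv_def vec_eq_iff using antic[OF that] by simp
    have antim: "m u v = - m v u" if "u \<in> {1..n}" "v \<in> {1..n}" for u v
      unfolding m_def antimv[OF that] by (rule linear_neg[OF matrix_vector_mul_linear])
    have X: "?X p = pair_sum n mv p" for p
    proof -
      have "?X p $ r = pair_sum n (M r) p" for r
      proof -
        have "pair_sum n (M r) p = (\<Sum>i=1..n-1. \<Sum>j\<in>{i<..n}. M r (p i) (p j))"
          unfolding pair_sum_def by (intro sum.mono_neutral_right) (auto simp: not_le)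
        also have "\<dots> = ?X p $ r" unfolding perm_stat_def
          by (simp add: atLeastSucAtMost_greaterThanAtMost)
        finally show ?thesis ..
      qed
      moreover have "pair_sum n mv p $ r = pair_sum n (M r) p" for r
        using pair_sum_linear[OF linear_component[of r], of n mv p] by (simp add: mv_def)
      ultimately show ?thesis by (simp add: vec_eq_iff)
    qed
    have Xr: "?X p $ r = pair_sum n (M r) p" for p r
      unfolding X using pair_sum_linear[OF linear_component[of r], of n mv p] by (simp add: mv_def)
    have W: "pair_sum n m p = B' *v ?X p" for p
      unfolding X m_def using pair_sum_linear[of "(*v) B'" n mv p] bl by (simp add:
          bounded_linear.linear)
    have mean0: "average ?P (\<lambda>p. ?X p $ r) = 0" for r
      unfolding Xr average_def using sum_pair_sum_zero[of n "M r", OF antic] by simp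
    have covX: "average ?P (\<lambda>p. ?X p $ i * ?X p $ j) = \<Sigma> $ i $ j" for i j
      unfolding \<Sigma> covariance_matrix_def by (simp add: expectation_uniform_perm mean0 del:
          One_nat_def)
    \<comment> \<open>\<open>B\<close> is symmetric, so whitening by its inverse gives unit covariance.\<close>
    have covW: "average ?P (\<lambda>p. pair_sum n m p $ r * pair_sum n m p $ t) = (if r = t then 1 else
        0)" for r t
    proof -
      have "average ?P (\<lambda>p. pair_sum n m p $ r * pair_sum n m p $ t)
          = average ?P (\<lambda>p. \<Sum>i\<in>UNIV. \<Sum>j\<in>UNIV. (B' $ r $ i * B' $ t $ j) * (?X p $ i * ?X p $ j))"
        unfolding W matrix_vector_mult_eq_sum sum_product by (simp add: ac_simps)
      also have "\<dots> = (\<Sum>i\<in>UNIV. \<Sum>j\<in>UNIV. (B' $ r $ i * B' $ t $ j) * \<Sigma> $ i $ j)"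
        by (simp only: average_sum average_cmult covX)
      also have "\<dots> = (B' ** \<Sigma> ** transpose B') $ r $ t"
        by (simp add: matrix_matrix_mult_def transpose_def sum_distrib_right sum_distrib_left
            ac_simps)
           (subst sum.swap, simp)
      also have "B' ** \<Sigma> ** transpose B' = mat 1"
      proof -
        have "B ** transpose B' = mat 1"
          using arg_cong[OF inv(1), of transpose] by (simp add: matrix_transpose_mul symB
              transpose_mat)
        then show ?thesis using inv(1) B(2) by (metis matrix_mul_assoc matrix_mul_lid)
      qed
      finally show ?thesis by (simp add: mat_def)
    qed
    have beta_row: "(\<Sum>v\<in>{1..n}. \<bar>M r u v\<bar>) \<le> beta n M" if "u \<in> {1..n}" for r u
      by (rule row_sum_le_beta[OF that])
    have "average ?P (\<lambda>p. (?X p $ r)\<^sup>2) = 1" for r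
      using var[rule_format, of r] by (simp add: expectation_uniform_perm mean0 del: One_nat_def)
    then have nb: "1 \<le> n * (beta n M)\<^sup>2"
      using pair_sum_second_moment_le[of n "M undefined" "beta n M", OF antic beta_row] unfolding
          Xr by metis
    then have n: "1 \<le> n" by (cases n) auto
    have b0: "0 \<le> beta n M"
      using beta_row[of 1 undefined] n by (smt (verit) atLeastAtMost_iff abs_ge_zero sum_nonneg
          le_refl)
    define bt where "bt = s * (CARD('d) * beta n M)"
    have row: "(\<Sum>v\<in>{1..n}. norm (m u v)) \<le> bt" if u: "u \<in> {1..n}" for u
    proof -
      have "(\<Sum>v\<in>{1..n}. norm (m u v)) \<le> (\<Sum>v\<in>{1..n}. s * (\<Sum>r\<in>UNIV. \<bar>M r u v\<bar>))"
      proof (rule sum_mono)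
        fix v
        have "norm (m u v) \<le> s * norm (mv u v)" unfolding m_def s_def by (rule onorm[OF bl])
        also have "\<dots> \<le> s * (\<Sum>r\<in>UNIV. \<bar>M r u v\<bar>)"
          using norm_le_l1_cart[of "mv u v"] by (intro mult_left_mono s0) (simp add: mv_def)
        finally show "norm (m u v) \<le> s * (\<Sum>r\<in>UNIV. \<bar>M r u v\<bar>)" .
      qed
      also have "\<dots> = s * (\<Sum>r\<in>UNIV. \<Sum>v\<in>{1..n}. \<bar>M r u v\<bar>)"
        unfolding sum_distrib_left[symmetric] by (subst sum.swap) (rule refl)
      also have "\<dots> \<le> s * (\<Sum>r\<in>(UNIV :: 'd set). beta n M)"
        by (intro mult_left_mono sum_mono beta_row u s0)
      finally show ?thesis by (simp add: bt_def)
    qed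
    have disc: "discrepancy ?P (pair_sum n m) \<le> 384 * core_const TYPE('d) * (sqrt n * bt\<^sup>2)"
      by (rule permutation_discrepancy[OF antim row covW])
    interpret S: finite_sample ?P "pair_sum n m"
      by standard (auto simp: finite_permutations intro: permutes_id)
    have dist: "convex_dist (distr (measure_pmf (uniform_perm n)) borel ?X) (distr std_gaussian
        borel (\<lambda>z. B *v z))
        \<le> discrepancy ?P (pair_sum n m)"
    proof (rule convex_dist_le)
      let ?\<mu> = "distr (measure_pmf (uniform_perm n)) borel ?X" and ?\<nu> = "distr std_gaussian borel
          (\<lambda>z. B *v z)"
      have Bm [measurable]: "(\<lambda>z. B *v z) \<in> borel_measurable borel"
        by (intro borel_measurable_continuous_onI linear_continuous_on
            matrix_vector_mul_bounded_linear)
      have Pset: "set_pmf (uniform_perm n) = ?P"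
        unfolding uniform_perm_def by (rule set_pmf_of_set) (auto simp: finite_permutations intro:
            permutes_id)
      show "finite_measure ?\<mu>" by (intro finite_measure.finite_measure_distr) (auto intro:
          measure_pmf.finite_measure_axioms)
      show "finite_measure ?\<nu>" by (intro finite_measure.finite_measure_distr) (auto intro:
          gauss.finite_measure_axioms)
      show "finite (?X ` ?P)" by (intro finite_imageI) (simp add: finite_permutations)
      then have "- ?X ` ?P \<in> sets borel" by (simp add: finite_imp_closed)
      moreover have "emeasure (measure_pmf (uniform_perm n)) (?X -` (- ?X ` ?P)) = 0"
        by (simp add: measure_pmf.emeasure_eq_measure measure_pmf_zero_iff Pset) auto
      ultimately show "- ?X ` ?P \<in> null_sets ?\<mu>"
        by (simp add: null_sets_def emeasure_distr)
      have nuA: "measure ?\<nu> A = measure std_gaussian {z. B *v z \<in> A}" if "A \<in> sets borel" for A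
        using that by (subst measure_distr) (auto simp: vimage_def)
      show "measure ?\<nu> (frontier A) = 0" if "convex A" for A
      proof -
        have "{z. B *v z \<in> frontier A} = (*v) B' ` frontier A"
          using B'B BB' by (auto simp: image_iff) metis
        moreover have "negligible ((*v) B' ` frontier A)"
          using that
          by (intro negligible_differentiable_image_negligible negligible_convex_frontier
              linear_imp_differentiable_on) auto
        ultimately have "negligible {z. B *v z \<in> frontier A}" by simp
        moreover have [measurable]: "frontier A \<in> sets borel" by (simp add: borel_closed)
        have "{z. B *v z \<in> frontier A} \<in> sets borel" by measurable
        ultimately show ?thesis by (simp add: nuA std_gaussian_negligible)
      qed
      show "\<bar>measure ?\<mu> A - measure ?\<nu> A\<bar> \<le> discrepancy ?P (pair_sum n m)" if A: "convex A" "A \<in>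
          sets borel" for A
      proof -
        have "measure ?\<mu> A = measure_pmf.expectation (uniform_perm n) (\<lambda>p. indicator (?X -` A) p)"
          using A by (subst measure_distr) auto
        also have "\<dots> = average ?P (\<lambda>p. indicator {w. B *v w \<in> A} (pair_sum n m p))"
          unfolding expectation_uniform_perm W by (intro average_cong) (simp add: indicator_def BB')
        finally have \<mu>A: "measure ?\<mu> A = \<dots>" .
        have "convex {w. B *v w \<in> A}"
          using convex_linear_vimage[OF _ A(1), of "(*v) B"] by (simp add: vimage_def)
        moreover have "{w. B *v w \<in> A} \<in> sets borel" using A by measurable
        ultimately show ?thesis unfolding \<mu>A nuA[OF A(2)] by (rule S.discrepancy_upper)
      qed
    qed simp_all
    \<comment> \<open>Multiply by \<open>sqrt n \<beta> \<ge> 1\<close>.\<close>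
    have "sqrt n * (beta n M)\<^sup>2 \<le> n * beta n M ^ 3"
    proof -
      have "sqrt 1 \<le> sqrt (n * (beta n M)\<^sup>2)" using nb by (intro real_sqrt_le_mono) simp
      then have "1 \<le> sqrt n * beta n M" using b0 by (simp add: real_sqrt_mult)
      then have "sqrt n * (beta n M)\<^sup>2 * 1 \<le> sqrt n * (beta n M)\<^sup>2 * (sqrt n * beta n M)"
        by (intro mult_left_mono) auto
      also have "\<dots> = (sqrt n * sqrt n) * beta n M ^ 3" by (simp only: power2_eq_square
          power3_eq_cube ac_simps)
      finally show ?thesis by simp
    qed
    also have "\<dots> \<le> n * beta n M ^ 3 + sqrt n * beta n M * beta2 n M powr (1 / 4)"
      using b0 by simp
    finally have rate: "sqrt n * (beta n M)\<^sup>2 \<le> n * beta n M ^ 3 + sqrt n * beta n M * beta2 n M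
        powr (1 / 4)" .
    have "convex_dist (distr (measure_pmf (uniform_perm n)) borel ?X) (distr std_gaussian borel
        (\<lambda>z. B *v z))
        \<le> C * s\<^sup>2 * (sqrt n * (beta n M)\<^sup>2)"
      using order_trans[OF dist disc] by (simp add: C_def bt_def power_mult_distrib ac_simps)
    also have "\<dots> \<le> C * s\<^sup>2 * (n * beta n M ^ 3 + sqrt n * beta n M * beta2 n M powr (1 / 4))"
      using C by (intro mult_left_mono rate) auto
    finally show ?thesis unfolding s_def B'_def B_def .
  qed
  show ?thesis using C main by (intro exI[of _ C]) blast
qed

end
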